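(* Let $\nu>0$ and $\xi\in\mathbb Z^2\setminus\{0\}$. The kernel $G_\xi(t,y;z)$ ($t>0$, $y,z\in\mathbb R_+$) has the form $$G_\xi(t,y;z)=H_\xi(t,y;z)+R_\xi(t,y;z),$$ where $$H_\xi(t,y;z)=\frac{1}{\sqrt{4\pi\nu t}}\left(e^{-\frac{|z-y|^2}{4\nu t}}+e^{-\frac{|z+y|^2}{4\nu t}}\right)e^{-\nu|\xi|^2t}\,I_2$$ and $$R_\xi(t,y;z)=\frac1{2\pi i}\int_\Gamma e^{\lambda t}\,\frac{\mu+|\xi|}{\mu\lambda|\xi|}\begin{pmatrix}\xi_2^2&-\xi_1\xi_2\\-\xi_1\xi_2&\xi_1^2\end{pmatrix}e^{-\mu|y+z|}\,d\lambda .$$ Moreover, for every $y>0$, the matrix function $G_\xi$ solves $$\partial_tG_\xi(t,y;z)-\nu\Delta_\xi G_\xi(t,y;z)=0\quad(t>0),$$ $$-\nu(\partial_z+|\xi|)G_\xi(t,y;z)|_{z=0}+\nu\,\xi|\xi|^{-1}\,\xi\cdot G_\xi(t,y;z)|_{z=0}=0,$$ $$G_\xi(t,y;z)|_{t=0}=\delta_y(z)\,I_2\quad(z>0),$$ where $\Delta_\xi=-|\xi|^2+\partial_z^2$, the operator $\xi|\xi|^{-1}\xi\cdot$ acts as left multiplication by the matrix $|\xi|^{-1}\xi\xi^{T}$, and the initial condition is understood in the sense that $\lim_{t\to0^+}\int_0^\infty G_\xi(t,y;z)f(z)\,dz=f(y)$ for every smooth $f\colon(0,\infty)\to\mathbb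 C^2$ with compact support.
   Context: $\mathbb R_+=[0,\infty)$; $I_2$ is the $2\times2$ identity matrix; $\mu=\mu(\lambda)=\nu^{-1/2}\sqrt{\lambda+\nu|\xi|^2}$ with the principal branch (so $\operatorname{Re}\mu>0$) for $\lambda\in\mathbb C\setminus(-\infty,-\nu|\xi|^2]$. $A_\xi$ is the realization of $\nu\Delta_\xi$ in $L^2(\mathbb R_+)$ ($\mathbb C^2$-valued) with domain $D(A_\xi)=\{u\in H^2(\mathbb R_+):\ -(\partial_z+|\xi|)u+\xi|\xi|^{-1}\xi\cdot u=0 \text{ at } z=0\}$, and $R(\lambda;A_\xi)=(\lambda-A_\xi)^{-1}$. The kernel $G_{\lambda,\xi}(y,z)$ is the $2\times2$-matrix integral kernel of $R(\lambda;A_\xi)$, i.e. $(R(\lambda;A_\xi)f)(y)=\int_0^\infty G_{\lambda,\xi}(y,z)f(z)\,dz$. The time-dependent Green's function is $G_\xi(t,y;z)=\frac1{2\pi i}\int_\Gamma e^{\lambda t}G_{\lambda,\xi}(y,z)\,d\lambda$, where $\Gamma\subset\mathbb C\setminus\bigl((-\infty,-\nu|\xi|^2]\cup\{0\}\bigr)$ is a path which starts with $\operatorname{Re}\lambda\to-\infty$, $\operatorname{Im}\lambda\to-\infty$, passes around $0$ on its right side, and ends with $\operatorname{Re}\lambda\to-\infty$, $\operatorname{Im}\lambda\to+\infty$ (such as the boundary of a sector with vertex to the right of $0$ and half-opening angle in $(\pi/2,\pi)$). *)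

theory Defs
  imports "HOL-Complex_Analysis.Complex_Analysis"
begin

abbreviation half_line :: "real measure"
  where "half_line \<equiv> lebesgue_on {0..}"

definition L2 :: "(real \<Rightarrow> complex^2) set"
  where "L2 = {u. u \<in> borel_measurable half_line \<and> integrable half_line (\<lambda>x. (norm (u x))\<^sup>2)}"

definition l2norm :: "(real \<Rightarrow> complex^2) \<Rightarrow> real"
  where "l2norm u = sqrt (LINT x|half_line. (norm (u x))\<^sup>2)"

text \<open>Smooth functions on the open half-line with compact support in it; \<open>D n\<close> is the
  \<open>n\<close>-th derivative. Values outside \<open>{0<..}\<close> are irrelevant.\<close>

definition smooth_cpt_supp :: "(real \<Rightarrow> 'a::real_normed_vector) \<Rightarrow> bool"
  where "smooth_cpt_supp f \<longleftrightarrow>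
    (\<exists>D. D 0 = f \<and> (\<forall>n. \<forall>x>0. (D n has_vector_derivative D (Suc n) x) (at x))) \<and>
    (\<exists>S. compact S \<and> S \<subseteq> {0<..} \<and> (\<forall>x\<in>{0<..} - S. f x = 0))"

definition has_weak_deriv :: "(real \<Rightarrow> complex^2) \<Rightarrow> (real \<Rightarrow> complex^2) \<Rightarrow> bool"
  where "has_weak_deriv u v \<longleftrightarrow>
    (\<forall>\<phi>::real \<Rightarrow> real. smooth_cpt_supp \<phi> \<longrightarrow>
      (LINT x|half_line. deriv \<phi> x *\<^sub>R u x) = - (LINT x|half_line. \<phi> x *\<^sub>R v x))"

text \<open>Elements of \<^term>\<open>L2\<close> are functions standing for their a.e.-classes. The weak derivative
  is unique only up to null sets, so \<open>wderiv\<close> selects a representative.\<close>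

definition wderiv :: "(real \<Rightarrow> complex^2) \<Rightarrow> (real \<Rightarrow> complex^2)"
  where "wderiv u = (SOME v. v \<in> L2 \<and> has_weak_deriv u v)"

definition H2 :: "(real \<Rightarrow> complex^2) set"
  where "H2 = {u \<in> L2. \<exists>v\<in>L2. \<exists>w\<in>L2. has_weak_deriv u v \<and> has_weak_deriv v w}"

text \<open>The trace at \<open>0\<close> is the value at \<open>0\<close> of the representative that is continuous on
  \<open>[0,\<infinity>)\<close>; it exists whenever the function and its weak derivative are in \<^term>\<open>L2\<close>.\<close>

definition trace0 :: "(real \<Rightarrow> complex^2) \<Rightarrow> complex^2"
  where "trace0 u = (THE c. \<exists>w. continuous_on {0..} w \<and> (AE x in half_line. w x = u x) \<and> w 0 = c)"

definition xi_norm :: "int^2 \<Rightarrow> real"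
  where "xi_norm \<xi> = norm (\<chi> i. real_of_int (\<xi> $ i))"

text \<open>The matrix \<open>|\<xi>|\<^sup>-\<^sup>1 \<xi> \<xi>\<^sup>T\<close>, i.e. the map \<open>u \<mapsto> \<xi> |\<xi>|\<^sup>-\<^sup>1 \<xi> \<cdot> u\<close>.\<close>

definition xi_mat :: "int^2 \<Rightarrow> complex^2^2"
  where "xi_mat \<xi> = (1 / xi_norm \<xi>) *\<^sub>R (\<chi> i j. of_int (\<xi> $ i * \<xi> $ j))"

definition A_dom :: "int^2 \<Rightarrow> (real \<Rightarrow> complex^2) set"
  where "A_dom \<xi> = {u \<in> H2.
    - (trace0 (wderiv u) + xi_norm \<xi> *\<^sub>R trace0 u) + xi_mat \<xi> *v trace0 u = 0}"

definition A_op :: "real \<Rightarrow> int^2 \<Rightarrow> (real \<Rightarrow> complex^2) \<Rightarrow> (real \<Rightarrow> complex^2)"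
  where "A_op \<nu> \<xi> u = (\<lambda>z. \<nu> *\<^sub>R (- ((xi_norm \<xi>)\<^sup>2 *\<^sub>R u z) + wderiv (wderiv u) z))"

definition resolvent_eq ::
  "real \<Rightarrow> int^2 \<Rightarrow> complex \<Rightarrow> (real \<Rightarrow> complex^2) \<Rightarrow> (real \<Rightarrow> complex^2) \<Rightarrow> bool"
  where "resolvent_eq \<nu> \<xi> lam f u \<longleftrightarrow>
    u \<in> A_dom \<xi> \<and> (AE z in half_line. lam *s u z - A_op \<nu> \<xi> u z = f z)"

definition resolvent_set :: "real \<Rightarrow> int^2 \<Rightarrow> complex set"
  where "resolvent_set \<nu> \<xi> = {lam. \<exists>C. \<forall>f\<in>L2. \<exists>u.
    resolvent_eq \<nu> \<xi> lam f u \<and> l2norm u \<le> C * l2norm f \<and>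
    (\<forall>v. resolvent_eq \<nu> \<xi> lam f v \<longrightarrow> (AE z in half_line. v z = u z))}"

text \<open>An integral kernel of the resolvent is determined only almost everywhere; the pointwise
  defined kernel is the one that is jointly continuous on \<open>[0,\<infinity>) \<times> [0,\<infinity>)\<close>, which is unique there
  (values at negative arguments are arbitrary and never used).\<close>

definition is_resolvent_kernel ::
  "real \<Rightarrow> int^2 \<Rightarrow> complex \<Rightarrow> (real \<Rightarrow> real \<Rightarrow> complex^2^2) \<Rightarrow> bool"
  where "is_resolvent_kernel \<nu> \<xi> lam K \<longleftrightarrow>
    lam \<in> resolvent_set \<nu> \<xi> \<and>
    continuous_on ({0..} \<times> {0..}) (\<lambda>(y, z). K y z) \<and>
    (\<forall>f\<in>L2. \<forall>u. resolvent_eq \<nu> \<xi> lam f u \<longrightarrow>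
      (AE y in half_line. integrable half_line (\<lambda>z. K y z *v f z) \<and>
        u y = (LINT z|half_line. K y z *v f z)))"

definition resolvent_kernel ::
  "real \<Rightarrow> int^2 \<Rightarrow> complex \<Rightarrow> real \<Rightarrow> real \<Rightarrow> complex^2^2"
  where "resolvent_kernel \<nu> \<xi> lam = (SOME K. is_resolvent_kernel \<nu> \<xi> lam K)"

definition mu :: "real \<Rightarrow> int^2 \<Rightarrow> complex \<Rightarrow> complex"
  where "mu \<nu> \<xi> lam = of_real (\<nu> powr (- (1/2))) * csqrt (lam + of_real (\<nu> * (xi_norm \<xi>)\<^sup>2))"

text \<open>The paths \<open>\<Gamma>\<close>, parametrised over the real line. The last condition says that \<open>\<Gamma>\<close> passes
  around \<open>0\<close> on its right side: a continuous choice \<open>\<theta>\<close> of the argument along \<open>\<Gamma>\<close> that starts in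
  \<open>(-\<pi>, -\<pi>/2)\<close> (the third quadrant) ends in \<open>(\<pi>/2, \<pi>)\<close> (the second quadrant). A path passing
  to the left of \<open>0\<close>, through the gap between the cut and \<open>0\<close>, would end in \<open>(-3\<pi>/2, -\<pi>)\<close>.\<close>

definition admissible_path :: "real \<Rightarrow> int^2 \<Rightarrow> (real \<Rightarrow> complex) \<Rightarrow> bool"
  where "admissible_path \<nu> \<xi> \<gamma> \<longleftrightarrow>
    (\<forall>a b. a < b \<longrightarrow> valid_path (subpath a b \<gamma>)) \<and>
    range \<gamma> \<subseteq> - (complex_of_real ` {.. - \<nu> * (xi_norm \<xi>)\<^sup>2} \<union> {0}) \<and>
    filterlim (\<lambda>s. Re (\<gamma> s)) at_bot at_bot \<and> filterlim (\<lambda>s. Im (\<gamma> s)) at_bot at_bot \<and>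
    filterlim (\<lambda>s. Re (\<gamma> s)) at_bot at_top \<and> filterlim (\<lambda>s. Im (\<gamma> s)) at_top at_top \<and>
    (\<exists>\<theta>. continuous_on UNIV \<theta> \<and> (\<forall>s. \<gamma> s = of_real (cmod (\<gamma> s)) * cis (\<theta> s)) \<and>
      (\<forall>\<^sub>F s in at_bot. \<theta> s \<in> {- pi <..< - (pi/2)}) \<and>
      (\<forall>\<^sub>F s in at_top. \<theta> s \<in> {pi/2 <..< pi}))"

text \<open>Contour integrals along a path parametrised over the whole real line are improper
  integrals: limits of the integrals over bounded pieces, both ends tending to infinity
  independently.\<close>

definition has_improper_contour_integral ::
  "(complex \<Rightarrow> complex) \<Rightarrow> complex \<Rightarrow> (real \<Rightarrow> complex) \<Rightarrow> bool"
  where "has_improper_contour_integral f I \<gamma> \<longleftrightarrow>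
    (\<forall>a b. a < b \<longrightarrow> f contour_integrable_on subpath a b \<gamma>) \<and>
    ((\<lambda>(a, b). contour_integral (subpath a b \<gamma>) f) \<longlongrightarrow> I) (at_bot \<times>\<^sub>F at_top)"

definition improper_contour_integrable :: "(complex \<Rightarrow> complex) \<Rightarrow> (real \<Rightarrow> complex) \<Rightarrow> bool"
  where "improper_contour_integrable f \<gamma> \<longleftrightarrow> (\<exists>I. has_improper_contour_integral f I \<gamma>)"

definition improper_contour_integral :: "(real \<Rightarrow> complex) \<Rightarrow> (complex \<Rightarrow> complex) \<Rightarrow> complex"
  where "improper_contour_integral \<gamma> f = (THE I. has_improper_contour_integral f I \<gamma>)"

definition G_integrand ::
  "real \<Rightarrow> int^2 \<Rightarrow> real \<Rightarrow> real \<Rightarrow> real \<Rightarrow> complex \<Rightarrow> complex^2^2"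
  where "G_integrand \<nu> \<xi> t y z lam =
    (\<chi> i j. exp (lam * of_real t) * resolvent_kernel \<nu> \<xi> lam y z $ i $ j)"

definition G_kernel ::
  "real \<Rightarrow> int^2 \<Rightarrow> (real \<Rightarrow> complex) \<Rightarrow> real \<Rightarrow> real \<Rightarrow> real \<Rightarrow> complex^2^2"
  where "G_kernel \<nu> \<xi> \<gamma> t y z = (\<chi> i j. 1 / (2 * of_real pi * \<i>) *
    improper_contour_integral \<gamma> (\<lambda>lam. G_integrand \<nu> \<xi> t y z lam $ i $ j))"

definition H_kernel :: "real \<Rightarrow> int^2 \<Rightarrow> real \<Rightarrow> real \<Rightarrow> real \<Rightarrow> complex^2^2"
  where "H_kernel \<nu> \<xi> t y z =
    (1 / sqrt (4 * pi * \<nu> * t) *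
      (exp (- (\<bar>z - y\<bar>\<^sup>2 / (4 * \<nu> * t))) + exp (- (\<bar>z + y\<bar>\<^sup>2 / (4 * \<nu> * t)))) *
      exp (- \<nu> * (xi_norm \<xi>)\<^sup>2 * t)) *\<^sub>R mat 1"

definition xi_perp_mat :: "int^2 \<Rightarrow> complex^2^2"
  where "xi_perp_mat \<xi> = vector
    [vector [of_int ((\<xi>$2)\<^sup>2), of_int (- \<xi>$1 * \<xi>$2)],
     vector [of_int (- \<xi>$1 * \<xi>$2), of_int ((\<xi>$1)\<^sup>2)]]"

definition R_integrand ::
  "real \<Rightarrow> int^2 \<Rightarrow> real \<Rightarrow> real \<Rightarrow> real \<Rightarrow> complex \<Rightarrow> complex^2^2"
  where "R_integrand \<nu> \<xi> t y z lam =
    (\<chi> i j. exp (lam * of_real t) *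
      ((mu \<nu> \<xi> lam + of_real (xi_norm \<xi>)) / (mu \<nu> \<xi> lam * lam * of_real (xi_norm \<xi>))) *
      xi_perp_mat \<xi> $ i $ j * exp (- mu \<nu> \<xi> lam * of_real \<bar>y + z\<bar>))"

definition R_kernel ::
  "real \<Rightarrow> int^2 \<Rightarrow> (real \<Rightarrow> complex) \<Rightarrow> real \<Rightarrow> real \<Rightarrow> real \<Rightarrow> complex^2^2"
  where "R_kernel \<nu> \<xi> \<gamma> t y z = (\<chi> i j. 1 / (2 * of_real pi * \<i>) *
    improper_contour_integral \<gamma> (\<lambda>lam. R_integrand \<nu> \<xi> t y z lam $ i $ j))"

end

theory Submission
  imports Defs "HOL-Probability.Characteristic_Functions" "HOL-Real_Asymp.Real_Asymp"
begin

text \<open>Along \<open>\<xi>\<close> the boundary condition is the Neumann condition, and orthogonally to \<open>\<xi>\<close> it is a Robin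
  condition. The even reflection of the resolvent kernel \<open>exp (- \<mu> * \<bar>y - z\<bar>) / (2 * \<nu> * \<mu>)\<close> of the full line
  serves the first, and a multiple of \<open>exp (- \<mu> * (y + z))\<close> in the direction orthogonal to \<open>\<xi>\<close> corrects it
  for the second. The difference of two solutions of the resolvent equation is a multiple of
  \<open>exp (- \<mu> * y)\<close>, which violates the boundary condition unless it vanishes, so this is the kernel.

  In the variable \<open>\<mu>\<close> the contour may be moved to the line \<open>Re \<mu> = \<bar>\<xi>\<bar> + 1\<close>, where the integrands are
  Gaussian. The exponentials become heat kernels. The factor \<open>1 / (\<mu> - \<bar>\<xi>\<bar>)\<close> hidden in the reflected part
  is the integral of \<open>exp (- (\<mu> - \<bar>\<xi>\<bar>) * r)\<close> over \<open>r \<ge> 0\<close>, so that part is a superposition of heat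
  kernels, i.e. a complementary error function. The equation, the boundary condition and the initial
  condition are then read off from these closed forms.\<close>

text \<open>Two obstacles shape the work. One is that \<open>A_dom\<close>, \<open>wderiv\<close>
  and \<open>trace0\<close> speak of almost-everywhere classes and choices: a solution of the
  resolvent equation must be brought to a continuous representative before it can be treated as a
  solution of an ordinary differential equation. Test functions, the du Bois-Reymond lemma and the
  primitives \<open>prim\<close> serve this purpose. The other is that an admissible path may wander
  without any control of its length, so that integrands cannot be dominated along it. Integrals are
  therefore computed as increments of a primitive, which is almost constant far to the left because
  of the factor \<open>exp (lam * t)\<close>. This reduces every path to one parabola, the image of
  the line in the mu-plane. There \<open>d lam = 2 * nu * mu * d mu\<close> cancels the denominator
  mu, and \<open>(mu + |xi|) / (mu * lam * |xi|)\<close> turns into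
  \<open>2 / (|xi| * (mu - |xi|))\<close>: the branch point disappears and only the pole at
  \<open>mu = |xi|\<close>, that is \<open>lam = 0\<close>, is left.\<close>

no_notation fps_nth (infixl "$" 75)

section \<open>Test functions on the half line\<close>

text \<open>With \<open>q = (x - a) * (b - x)\<close>, every derivative of
  \<open>exp (- c / q)\<close> has the form \<open>p / q ^ (2 * n) * exp (- c / q)\<close>. These
  are the numerators; the recursion is what the quotient and product rules give when the denominator
  is raised to \<open>q ^ (2 * n + 2)\<close>.\<close>

fun bump_poly :: "real \<Rightarrow> real \<Rightarrow> real \<Rightarrow> nat \<Rightarrow> real poly" where
  "bump_poly c a b 0 = 1"
| "bump_poly c a b (Suc n) = (let q = [:-a, 1:] * [:b, -1:]; p = bump_poly c a b n in
     pderiv p * q\<^sup>2 - smult (2 * real n) (p * pderiv q * q) + smult c (p * pderiv q))"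

text \<open>The index \<open>n\<close> counts derivatives. The parameter \<open>c\<close> is kept
  because the bumps tend pointwise to the indicator of the open interval from \<open>a\<close> to
  \<open>b\<close> as \<open>c\<close> tends to \<open>0\<close>.\<close>

definition bump :: "real \<Rightarrow> real \<Rightarrow> real \<Rightarrow> nat \<Rightarrow> real \<Rightarrow> real" where
  "bump c a b n x = (if a < x \<and> x < b
     then poly (bump_poly c a b n) x / ((x - a) * (b - x)) ^ (2 * n) * exp (- (c / ((x - a) * (b - x)))) else 0)"

text \<open>A single term of the exponential series bounds \<open>exp (c / q)\<close> from below.
  This beats any power of \<open>q\<close> in the denominator of a bump.\<close>

lemma exp_minus_inverse_le_power:
  fixes c q :: real
  assumes "c > 0" "q > 0"
  shows "exp (- (c / q)) \<le> fact k / c ^ k * q ^ k"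
proof -
  have s: "c / q > 0" using assms by simp
  have "(\<Sum>n\<in>{k}. (c / q) ^ n /\<^sub>R fact n) \<le> (\<Sum>n. (c / q) ^ n /\<^sub>R fact n)"
    by (rule sum_le_suminf) (use s summable_exp_generic[of "c/q"] in auto)
  hence "(c / q) ^ k / fact k \<le> exp (c / q)"
    by (simp add: exp_def field_simps)
  hence "exp (- (c / q)) \<le> inverse ((c / q) ^ k / fact k)"
    unfolding exp_minus using s by (intro le_imp_inverse_le) auto
  also have "\<dots> = fact k / c ^ k * q ^ k" by (simp add: field_simps)
  finally show ?thesis .
qed

lemma has_real_derivative_zero_if_quadratic:
  fixes f :: "real \<Rightarrow> real"
  assumes "\<And>y. \<bar>f y - f x\<bar> \<le> K * (y - x)\<^sup>2"
  shows "(f has_real_derivative 0) (at x)"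
  unfolding has_field_derivative_iff
proof (rule Lim_null_comparison)
  show "\<forall>\<^sub>F y in at x. norm ((f y - f x) / (y - x)) \<le> K * \<bar>y - x\<bar>"
    unfolding eventually_at_filter
  proof (rule always_eventually, intro allI impI)
    fix y assume "y \<noteq> x"
    hence pos: "\<bar>y - x\<bar> > 0" by simp
    have "\<bar>f y - f x\<bar> \<le> K * \<bar>y - x\<bar> * \<bar>y - x\<bar>" using assms[of y] by (simp add: power2_eq_square mult.assoc)
    thus "norm ((f y - f x) / (y - x)) \<le> K * \<bar>y - x\<bar>"
      using pos by (simp add: pos_divide_le_eq)
  qed
  show "((\<lambda>y. K * \<bar>y - x\<bar>) \<longlongrightarrow> 0) (at x)"
    by (rule tendsto_eq_intros | simp)+
qed

text \<open>At an endpoint of the support the exponential outweighs the denominator with two powers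
  of \<open>q\<close> to spare. The quadratic bound makes the derivative at that point exist and
  vanish.\<close>

lemma bump_quadratic:
  assumes "c > 0" "a < b" "x = a \<or> x = b"
  obtains K where "\<And>y. \<bar>bump c a b n y\<bar> \<le> K * (y - x)\<^sup>2"
proof -
  have "compact (poly (bump_poly c a b n) ` {a..b})"
    by (intro compact_continuous_image continuous_intros) auto
  then obtain B where B: "\<And>y. y \<in> {a..b} \<Longrightarrow> \<bar>poly (bump_poly c a b n) y\<bar> \<le> B"
    using compact_imp_bounded bounded_iff by (metis image_eqI real_norm_def)
  have B0: "B \<ge> 0" using B[of a] assms(2) by force
  \<comment> \<open>\<open>2 * n\<close> powers cancel the denominator of the bump, and the other
    two give \<open>q\<^sup>2\<close>, where \<open>q \<le> (b - a) * |y - x|\<close>.\<close>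
  define k where "k = 2 * n + 2"
  define K where "K = B * (fact k / c ^ k) * (b - a)\<^sup>2"
  have K0: "K \<ge> 0" unfolding K_def using B0 assms by (intro mult_nonneg_nonneg divide_nonneg_nonneg) auto
  have "\<bar>bump c a b n y\<bar> \<le> K * (y - x)\<^sup>2" for y
  proof (cases "a < y \<and> y < b")
    case True
    define q where "q = (y - a) * (b - y)"
    have q: "q > 0" using True by (simp add: q_def)
    have le: "q \<le> (b - a) * \<bar>y - x\<bar>"
      using assms(3)
    proof
      assume "x = a" thus ?thesis unfolding q_def using True by (simp add: mult.commute mult_right_mono)
    next
      assume "x = b" thus ?thesis unfolding q_def using True by (simp add: mult_right_mono)
    qed
    have "\<bar>bump c a b n y\<bar> = \<bar>poly (bump_poly c a b n) y\<bar> / q ^ (2 * n) * exp (- (c / q))"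
      using True q by (simp add: bump_def q_def[symmetric] abs_mult)
    also have "\<dots> \<le> B / q ^ (2 * n) * (fact k / c ^ k * q ^ k)"
      using True q B[of y] B0 exp_minus_inverse_le_power[OF assms(1) q, of k]
      by (intro mult_mono divide_right_mono) auto
    also have "\<dots> = B * (fact k / c ^ k) * q\<^sup>2"
      using q by (simp add: k_def power_add power2_eq_square del: fact_Suc)
    also have "\<dots> \<le> B * (fact k / c ^ k) * ((b - a) * \<bar>y - x\<bar>)\<^sup>2"
      using B0 assms(1) q le by (intro mult_left_mono power_mono mult_nonneg_nonneg divide_nonneg_nonneg) auto
    also have "\<dots> = K * (y - x)\<^sup>2" by (simp add: K_def power_mult_distrib)
    finally show ?thesis .
  next
    case False thus ?thesis using K0 by (auto simp: bump_def)
  qed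
  thus ?thesis using that by blast
qed

lemma bump_has_derivative:
  assumes "c > 0" "a < b"
  shows "(bump c a b n has_real_derivative bump c a b (Suc n) x) (at x)"
proof -
  consider "x < a \<or> b < x" | "x = a \<or> x = b" | "a < x" "x < b" by linarith
  thus ?thesis
  proof cases
    case 1
    hence "x \<in> - {a..b}" by auto
    have "((\<lambda>_. 0) has_real_derivative bump c a b (Suc n) x) (at x)"
      using 1 by (auto simp: bump_def)
    thus ?thesis
      by (rule has_field_derivative_transform_within_open[where S = "- {a..b}"])
         (use 1 in \<open>auto simp: bump_def\<close>)
  next
    case 2
    obtain K where "\<And>y. \<bar>bump c a b n y\<bar> \<le> K * (y - x)\<^sup>2"
      using bump_quadratic[OF assms 2] by blast
    moreover have "bump c a b n x = 0" "bump c a b (Suc n) x = 0" using 2 by (auto simp: bump_def)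
    ultimately show ?thesis using has_real_derivative_zero_if_quadratic[of "bump c a b n" x K] by simp
  next
    case 3
    define q where "q = [:-a, 1:] * [:b, -1:]"
    define p where "p = bump_poly c a b n"
    have q: "poly q y = (y - a) * (b - y)" for y unfolding q_def by (simp add: algebra_simps)
    have q0: "poly q x > 0" using 3 by (simp add: q)
    have bp: "bump_poly c a b (Suc n) = pderiv p * q\<^sup>2 - smult (2 * real n) (p * pderiv q * q) + smult c (p * pderiv q)"
      by (simp only: bump_poly.simps Let_def q_def p_def)
    let ?f = "\<lambda>y. poly p y / poly q y ^ (2 * n) * exp (- (c / poly q y))"
    let ?D = "bump c a b (Suc n) x"
    have D: "?D = (poly (pderiv p) x * poly q x ^ 2 - 2 * n * poly p x * poly (pderiv q) x * poly q x
              + c * poly p x * poly (pderiv q) x) / poly q x ^ (2 * n + 2) * exp (- (c / poly q x))"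
      using 3 unfolding bump_def bp q[symmetric] by (simp add: mult.assoc)
    define R where "R = poly q x ^ (2 * n)"
    have R0: "R > 0" unfolding R_def using q0 by simp
    have nz: "poly q x ^ (2 * n) \<noteq> 0" using q0 by simp
    have q_deriv: "(poly q has_real_derivative poly (pderiv q) x) (at x)" by (rule poly_DERIV)
    have dR: "((\<lambda>y. poly q y ^ (2 * n)) has_real_derivative 2 * n * (R / poly q x) * poly (pderiv q) x) (at x)"
    proof -
      have "real (2 * n) * (poly (pderiv q) x * poly q x ^ (2 * n - Suc 0)) = 2 * n * (R / poly q x) * poly (pderiv q) x"
        using q0 by (cases n) (auto simp: R_def)
      thus ?thesis using DERIV_power[OF q_deriv, of "2 * n"] by simp
    qed
    have dE: "((\<lambda>y. exp (- (c / poly q y))) has_real_derivative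
        exp (- (c / poly q x)) * (c * poly (pderiv q) x / (poly q x * poly q x))) (at x)"
      by (rule derivative_eq_intros q_deriv refl | use q0 in simp)+
    have "(?f has_real_derivative ?D) (at x)"
    proof (rule back_subst[of "\<lambda>d. (?f has_real_derivative d) (at x)"])
      show "(?f has_real_derivative (poly (pderiv p) x * R - poly p x * (2 * n * (R / poly q x) * poly (pderiv q) x)) / (R * R)
           * exp (- (c / poly q x)) + exp (- (c / poly q x)) * (c * poly (pderiv q) x / (poly q x * poly q x)) * (poly p x / R)) (at x)"
        using DERIV_mult[OF DERIV_divide[OF poly_DERIV[of p] dR nz] dE] unfolding R_def .
      have "?D = (poly (pderiv p) x * poly q x ^ 2 - 2 * n * poly p x * poly (pderiv q) x * poly q x
              + c * poly p x * poly (pderiv q) x) / (R * poly q x ^ 2) * exp (- (c / poly q x))"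
        unfolding D by (simp add: R_def power_add power2_eq_square)
      also have "\<dots> = (poly (pderiv p) x * R - poly p x * (2 * n * (R / poly q x) * poly (pderiv q) x)) / (R * R)
           * exp (- (c / poly q x)) + exp (- (c / poly q x)) * (c * poly (pderiv q) x / (poly q x * poly q x)) * (poly p x / R)"
        using R0 q0 by (simp add: divide_simps power2_eq_square) (simp add: algebra_simps)
      finally show "(poly (pderiv p) x * R - poly p x * (2 * n * (R / poly q x) * poly (pderiv q) x)) / (R * R)
           * exp (- (c / poly q x)) + exp (- (c / poly q x)) * (c * poly (pderiv q) x / (poly q x * poly q x)) * (poly p x / R) = ?D" ..
    qed
    thus ?thesis
      by (rule has_field_derivative_transform_within_open[where S = "{a<..<b}"])
         (use 3 in \<open>auto simp: bump_def p_def q\<close>)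
  qed
qed

lemma continuous_on_bump: "c > 0 \<Longrightarrow> a < b \<Longrightarrow> continuous_on S (bump c a b n)"
  by (meson DERIV_continuous bump_has_derivative continuous_at_imp_continuous_on)

lemma bump_eq_0: "x \<notin> {a..b} \<Longrightarrow> bump c a b n x = 0"
  by (auto simp: bump_def)

lemma bump_0: "bump c a b 0 x = (if a < x \<and> x < b then exp (- (c / ((x - a) * (b - x)))) else 0)"
  by (simp add: bump_def)

lemma smooth_cpt_supp_bump:
  assumes "c > 0" "0 < a" "a < b"
  shows "smooth_cpt_supp (bump c a b 0)"
  unfolding smooth_cpt_supp_def
proof (intro conjI exI[of _ "bump c a b"] exI[of _ "{a..b}"])
  show "\<forall>n. \<forall>x>0. (bump c a b n has_vector_derivative bump c a b (Suc n) x) (at x)"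
    using bump_has_derivative[OF assms(1,3)] by (simp add: has_real_derivative_iff_has_vector_derivative)
qed (use assms in \<open>auto simp: bump_eq_0\<close>)

text \<open>A function in \<open>smooth_cpt_supp\<close> is unconstrained at arguments
  \<open>\<le> 0\<close>. Extending it by zero from the positive axis gives a function that is
  differentiable on the whole line, to which the usual calculus applies.\<close>

lemma smooth_cpt_suppE:
  fixes f :: "real \<Rightarrow> 'a::real_normed_vector"
  assumes "smooth_cpt_supp f"
  obtains a b f0 f' where "0 < a" "a < b" "\<And>x. x > 0 \<Longrightarrow> f0 x = f x"
    "\<And>x. (f0 has_vector_derivative f' x) (at x)" "\<And>x. x > 0 \<Longrightarrow> (f has_vector_derivative f' x) (at x)"
    "continuous_on UNIV f0" "continuous_on UNIV f'"
    "\<And>x. x \<notin> {a..b} \<Longrightarrow> f0 x = 0" "\<And>x. x \<notin> {a..b} \<Longrightarrow> f' x = 0"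
proof -
  obtain D S where D: "D 0 = f" "\<And>n x. x > 0 \<Longrightarrow> (D n has_vector_derivative D (Suc n) x) (at x)"
    and S: "compact S" "S \<subseteq> {0<..}" "\<And>x. x \<in> {0<..} - S \<Longrightarrow> f x = 0"
    using assms unfolding smooth_cpt_supp_def by metis
  obtain a b where ab: "0 < a" "a < b" "S \<subseteq> {a..b}"
  proof (cases "S = {}")
    case True thus ?thesis using that[of 1 2] by auto
  next
    case False
    obtain s where s: "s \<in> S" "\<And>x. x \<in> S \<Longrightarrow> s \<le> x"
      using compact_attains_inf[OF S(1) False] by blast
    obtain u where u: "u \<in> S" "\<And>x. x \<in> S \<Longrightarrow> x \<le> u"
      using compact_attains_sup[OF S(1) False] by blast
    \<comment> \<open>The \<open>+ 1\<close> keeps \<open>a < b\<close> when the support is a single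
      point.\<close>
    show ?thesis using that[of s "u + 1"] s u S(2) by force
  qed
  define E where "E n x = (if x \<in> {a..b} then D n x else 0)" for n x
  \<comment> \<open>Off the interval the function vanishes on an open set, so all its derivatives
    vanish there as well.\<close>
  have out: "D n x = 0" if "x > 0" "x \<notin> {a..b}" for n x
    using that
  proof (induction n arbitrary: x)
    case 0 thus ?case using S(3) ab D(1) by blast
  next
    case (Suc n)
    have "((\<lambda>_. 0) has_vector_derivative D (Suc n) x) (at x)"
      by (rule has_vector_derivative_transform_within_open[where S = "{0<..} - {a..b}" and f = "D n"])
         (use D(2)[OF Suc.prems(1), of n] Suc in \<open>auto intro: open_Diff\<close>)
    thus ?case using has_vector_derivative_const vector_derivative_unique_at by blast
  qed
  hence E_pos: "E n x = D n x" if "x > 0" for n x using that by (auto simp: E_def)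
  have E_deriv: "(E n has_vector_derivative E (Suc n) x) (at x)" for n x
  proof (cases "x > 0")
    case True
    have "(E n has_vector_derivative D (Suc n) x) (at x)"
      by (rule has_vector_derivative_transform_within_open[where S = "{0<..}" and f = "D n"])
         (use D(2)[OF True, of n] True in \<open>auto simp: E_pos\<close>)
    thus ?thesis using True by (simp add: E_pos)
  next
    case False
    have "(E n has_vector_derivative 0) (at x)"
      by (rule has_vector_derivative_transform_within_open[where S = "{..<a}" and f = "\<lambda>_. 0"])
         (use False ab in \<open>auto simp: E_def\<close>)
    thus ?thesis using False ab by (simp add: E_def)
  qed
  have c: "continuous_on UNIV (E n)" for n
    using E_deriv by (intro continuous_at_imp_continuous_on ballI)
      (use has_vector_derivative_continuous in blast)
  show ?thesis
  proof (rule that[of a b "E 0" "E 1"])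
    show "(f has_vector_derivative E 1 x) (at x)" if "x > 0" for x
      using D(2)[OF that, of 0] D(1) E_pos[OF that] by simp
    show "(E 0 has_vector_derivative E 1 x) (at x)" for x using E_deriv[of 0 x] by simp
    show "E 0 x = f x" if "x > 0" for x using E_pos[OF that] D(1) by simp
  qed (use ab c in \<open>auto simp: E_def\<close>)
qed

section \<open>Null functions on the half line\<close>

lemma measurable_ident_lebesgue [measurable]: "(\<lambda>x::real. x) \<in> borel_measurable lebesgue"
  by (rule measurable_completion) simp

lemma measurable_ident_half_line [measurable]: "(\<lambda>x. x) \<in> borel_measurable half_line"
  by (rule measurable_restrict_space1) (rule measurable_ident_lebesgue)

lemma AE_half_line_iff: "(AE x in half_line. P x) \<longleftrightarrow> (AE x in lebesgue. 0 \<le> x \<longrightarrow> P x)"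
  by (subst AE_restrict_space_iff) auto

lemma integrable_half_line_iff:
  fixes f :: "real \<Rightarrow> 'a::{banach, second_countable_topology}"
  shows "integrable half_line f \<longleftrightarrow> integrable lebesgue (\<lambda>x. indicator {0..} x *\<^sub>R f x)"
  by (subst integrable_restrict_space) auto

lemma integral_half_line_eq:
  fixes f :: "real \<Rightarrow> 'a::{banach, second_countable_topology}"
  shows "(LINT x|half_line. f x) = (LINT x|lebesgue. indicator {0..} x *\<^sub>R f x)"
  by (subst integral_restrict_space) auto

text \<open>Use the positive and the negative part of \<open>g\<close> as densities. The hypothesis
  makes the two measures agree on all open half lines, hence everywhere, and uniqueness of densities
  makes the two parts equal almost everywhere. As at most one of them is nonzero at a point, both
  vanish.\<close>

lemma AE_eq_0_if_interval_integrals_0_lborel: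
  fixes g :: "real \<Rightarrow> real"
  assumes int: "integrable lborel g"
    and zero: "\<And>a b. a < b \<Longrightarrow> (LINT x|lborel. indicator {a<..<b} x * g x) = 0"
  shows "AE x in lborel. g x = 0"
proof -
  note [measurable] = borel_measurable_integrable[OF int]
  have half: "(LINT y|lborel. indicator {x<..} y * g y) = 0" for x
  proof (rule LIMSEQ_unique)
    show "(\<lambda>n. LINT y|lborel. indicator {x<..<x + real (Suc n)} y * g y) \<longlonglongrightarrow> (LINT y|lborel. indicator {x<..} y * g y)"
    proof (rule integral_dominated_convergence[where w = "\<lambda>y. \<bar>g y\<bar>"])
      show "AE y in lborel. (\<lambda>n. indicator {x<..<x + real (Suc n)} y * g y) \<longlonglongrightarrow> indicator {x<..} y * g y"
      proof (rule AE_I2, rule tendsto_mult_right)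
        fix y
        obtain N where N: "y < x + real N" using reals_Archimedean2[of "y - x"] by (auto simp: algebra_simps)
        show "(\<lambda>n. indicator {x<..<x + real (Suc n)} y) \<longlonglongrightarrow> (indicator {x<..} y :: real)"
        proof (rule tendsto_eventually)
          show "\<forall>\<^sub>F n in sequentially. indicator {x<..<x + real (Suc n)} y = (indicator {x<..} y :: real)"
            using eventually_ge_at_top[of N] by eventually_elim (use N in \<open>auto simp: indicator_def\<close>)
        qed
      qed
    qed (use int in \<open>auto simp: indicator_def\<close>)
    show "(\<lambda>n. LINT y|lborel. indicator {x<..<x + real (Suc n)} y * g y) \<longlonglongrightarrow> 0"
      using zero by simp
  qed
  \<comment> \<open>\<open>ennreal\<close> truncates negative values to \<open>0\<close>, so
    \<open>s = 1\<close> and \<open>s = -1\<close> produce the positive and the negative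
    part.\<close>
  have fin: "(\<integral>\<^sup>+y. ennreal (s * g y) * indicator {x<..} y \<partial>lborel) = ennreal (LINT y|lborel. max 0 (s * g y) * indicator {x<..} y)" for s x
  proof -
    have "integrable lborel (\<lambda>y. max 0 (s * g y) * indicator {x<..} y)"
      by (rule Bochner_Integration.integrable_bound[of _ "\<lambda>y. s * g y"]) (use int in \<open>auto simp: indicator_def\<close>)
    moreover have "(\<integral>\<^sup>+y. ennreal (s * g y) * indicator {x<..} y \<partial>lborel) = (\<integral>\<^sup>+y. ennreal (max 0 (s * g y) * indicator {x<..} y) \<partial>lborel)"
      by (intro nn_integral_cong) (auto simp: indicator_def max_def ennreal_neg)
    ultimately show ?thesis by (simp add: nn_integral_eq_integral)
  qed
  have "density lborel (\<lambda>x. ennreal (g x)) = density lborel (\<lambda>x. ennreal (- g x))"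
  proof (rule measure_eqI_lessThan)
    fix x
    have e: "emeasure (density lborel (\<lambda>x. ennreal (s * g x))) {x<..} = ennreal (LINT y|lborel. max 0 (s * g y) * indicator {x<..} y)" for s
      by (subst emeasure_density) (auto simp: fin)
    show "emeasure (density lborel (\<lambda>x. ennreal (g x))) {x<..} < \<infinity>" using e[of 1] by simp
    have i: "integrable lborel (\<lambda>y. max 0 (s * g y) * indicator {x<..} y)" for s
      by (rule Bochner_Integration.integrable_bound[of _ "\<lambda>y. s * g y"]) (use int in \<open>auto simp: indicator_def\<close>)
    have "(LINT y|lborel. max 0 (1 * g y) * indicator {x<..} y) - (LINT y|lborel. max 0 (-1 * g y) * indicator {x<..} y)
       = (LINT y|lborel. max 0 (1 * g y) * indicator {x<..} y - max 0 (-1 * g y) * indicator {x<..} y)"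
      by (rule Bochner_Integration.integral_diff[symmetric, OF i i])
    also have "\<dots> = (LINT y|lborel. indicator {x<..} y * g y)"
      by (rule Bochner_Integration.integral_cong) (auto simp: indicator_def max_def)
    finally have "(LINT y|lborel. max 0 (1 * g y) * indicator {x<..} y) = (LINT y|lborel. max 0 (-1 * g y) * indicator {x<..} y)"
      using half by simp
    thus "emeasure (density lborel (\<lambda>x. ennreal (g x))) {x<..} = emeasure (density lborel (\<lambda>x. ennreal (- g x))) {x<..}"
      using e[of 1] e[of "-1"] by simp
  qed auto
  hence "AE x in lborel. ennreal (g x) = ennreal (- g x)"
    by (intro sigma_finite_measure.density_unique[OF sigma_finite_lborel]) auto
  thus ?thesis
  proof eventually_elim
    case (elim x)
    thus ?case by (cases "g x \<ge> 0") (auto simp: ennreal_neg ennreal_eq_0_iff)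
  qed
qed

text \<open>A Lebesgue measurable function agrees almost everywhere with a Borel function, to which
  the previous lemma applies.\<close>

lemma AE_eq_0_if_interval_integrals_0:
  fixes g :: "real \<Rightarrow> real"
  assumes int: "integrable lebesgue g"
    and zero: "\<And>a b. a < b \<Longrightarrow> (LINT x|lebesgue. indicator {a<..<b} x * g x) = 0"
  shows "AE x in lebesgue. g x = 0"
proof -
  note gm [measurable] = borel_measurable_integrable[OF int]
  obtain h where h [measurable]: "h \<in> borel_measurable lborel" and eq: "AE x in lborel. g x = h x"
    using completion_ex_borel_measurable_real[OF gm] by blast
  have eq': "AE x in lebesgue. g x = h x" using eq by (rule AE_completion)
  have h' [measurable]: "h \<in> borel_measurable lebesgue" by (rule measurable_completion[OF h])
  have "integrable lebesgue h"
    using int eq' by (subst integrable_cong_AE[where g=g]) auto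
  hence hi: "integrable lborel h" by (simp add: integrable_completion)
  have "AE x in lborel. h x = 0"
  proof (rule AE_eq_0_if_interval_integrals_0_lborel[OF hi])
    fix a b :: real assume ab: "a < b"
    have "(LINT x|lborel. indicator {a<..<b} x * h x) = (LINT x|lebesgue. indicator {a<..<b} x * h x)"
      by (subst integral_completion) auto
    also have "\<dots> = (LINT x|lebesgue. indicator {a<..<b} x * g x)"
      by (rule integral_cong_AE) (use eq' in auto)
    finally show "(LINT x|lborel. indicator {a<..<b} x * h x) = 0" using zero[OF ab] by simp
  qed
  hence "AE x in lebesgue. h x = 0" by (rule AE_completion)
  with eq' show ?thesis by eventually_elim simp
qed

text \<open>Letting \<open>c\<close> tend to \<open>0\<close> turns the bumps into indicators of
  intervals, by dominated convergence, so the integrals of \<open>g\<close> over all intervals with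
  positive left end vanish. The previous lemma then applies to each component.\<close>

lemma AE_eq_0_if_bump_integrals_0:
  fixes g :: "real \<Rightarrow> 'a::euclidean_space"
  assumes loc: "\<And>Y. integrable half_line (\<lambda>x. indicator {..Y} x *\<^sub>R g x)"
    and zero: "\<And>c a b. c > 0 \<Longrightarrow> 0 < a \<Longrightarrow> a < b \<Longrightarrow> (LINT x|half_line. bump c a b 0 x *\<^sub>R g x) = 0"
  shows "AE x in half_line. g x = 0"
proof -
  have zero': "(LINT x|half_line. indicator {a<..<b} x *\<^sub>R g x) = 0" if ab: "0 < a" "a < b" for a b
  proof (rule LIMSEQ_unique)
    let ?G = "\<lambda>x. indicator {..b} x *\<^sub>R g x"
    have *: "(LINT x|half_line. indicator {a<..<b} x *\<^sub>R g x) = (LINT x|half_line. indicator {a<..<b} x *\<^sub>R ?G x)"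
      by (rule Bochner_Integration.integral_cong) (auto simp: indicator_def)
    have **: "(LINT x|half_line. bump c a b 0 x *\<^sub>R g x) = (LINT x|half_line. bump c a b 0 x *\<^sub>R ?G x)" for c
      by (rule Bochner_Integration.integral_cong) (auto simp: indicator_def bump_0)
    note [measurable] = borel_measurable_integrable[OF loc[of b]]
    show "(\<lambda>n. LINT x|half_line. bump (1 / real (Suc n)) a b 0 x *\<^sub>R g x) \<longlonglongrightarrow> (LINT x|half_line. indicator {a<..<b} x *\<^sub>R g x)"
      unfolding * **
    proof (rule integral_dominated_convergence[where w = "\<lambda>x. norm (?G x)"])
      show "AE x in half_line. (\<lambda>n. bump (1 / real (Suc n)) a b 0 x *\<^sub>R ?G x) \<longlonglongrightarrow> indicator {a<..<b} x *\<^sub>R ?G x"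
      proof (rule AE_I2, rule tendsto_scaleR)
        fix x
        have "(\<lambda>n. exp (- (1 / real (Suc n) / ((x - a) * (b - x))))) \<longlonglongrightarrow> exp (- (0 / ((x - a) * (b - x))))" if "a < x" "x < b"
          using that by (intro tendsto_exp tendsto_minus tendsto_divide tendsto_const LIMSEQ_Suc[OF lim_1_over_n]) auto
        thus "(\<lambda>n. bump (1 / real (Suc n)) a b 0 x) \<longlonglongrightarrow> indicator {a<..<b} x"
          by (auto simp: bump_0 indicator_def)
      qed auto
      have "bump (1 / real (Suc n)) a b 0 \<in> borel_measurable half_line" for n
        by (rule continuous_imp_measurable_on_sets_lebesgue[OF continuous_on_bump]) (use ab in auto)
      thus "(\<lambda>x. bump (1 / real (Suc n)) a b 0 x *\<^sub>R ?G x) \<in> borel_measurable half_line" for n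
        by measurable
      have le1: "\<bar>bump (1 / real (Suc n)) a b 0 x\<bar> \<le> 1" for n x by (auto simp: bump_0)
      show "AE x in half_line. norm (bump (1 / real (Suc n)) a b 0 x *\<^sub>R ?G x) \<le> norm (?G x)" for n
      proof (rule AE_I2)
        fix x
        show "norm (bump (1 / real (Suc n)) a b 0 x *\<^sub>R ?G x) \<le> norm (?G x)"
          using mult_right_mono[OF le1[of n x] norm_ge_zero[of "?G x"]]
          by (subst norm_scaleR) (simp only: mult_1)
      qed
      show "integrable half_line (\<lambda>x. norm (?G x))" by (rule integrable_norm[OF loc])
      show "(\<lambda>x. indicator {a<..<b} x *\<^sub>R ?G x) \<in> borel_measurable half_line" by measurable
    qed
    show "(\<lambda>n. LINT x|half_line. bump (1 / real (Suc n)) a b 0 x *\<^sub>R g x) \<longlonglongrightarrow> 0"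
      using zero ab by simp
  qed
  \<comment> \<open>The bumps only test intervals away from \<open>0\<close>, and \<open>g\<close>
    is only integrable on bounded sets. Hence the cut-off on both sides.\<close>
  have comp: "AE x in lebesgue. indicator {d<..<m} x * (g x \<bullet> e) = 0" if d: "d > 0" for d m e
  proof (rule AE_eq_0_if_interval_integrals_0)
    let ?h = "\<lambda>x. indicator {d<..<m} x * (g x \<bullet> e)"
    have "integrable lebesgue (\<lambda>x. indicator {0..} x *\<^sub>R (indicator {..m} x *\<^sub>R g x))"
      using loc[of "m"] by (simp only: integrable_half_line_iff)
    from integrable_inner_left[OF this, of e]
    have i: "integrable lebesgue (\<lambda>x. indicator {0..m} x * (g x \<bullet> e))"
      by (rule back_subst[of "integrable lebesgue"]) (auto simp: indicator_def)
    show hi: "integrable lebesgue ?h"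
    proof (rule Bochner_Integration.integrable_bound[OF i])
      note [measurable] = borel_measurable_integrable[OF i]
      have pos': "0 \<le> x" if "d < x" for x using d that by linarith
      have "?h = (\<lambda>x. indicator {d<..<m} x * (indicator {0..m} x * (g x \<bullet> e)))"
      proof
        fix x show "?h x = indicator {d<..<m} x * (indicator {0..m} x * (g x \<bullet> e))"
          using pos'[of x] by (cases "d < x") (simp_all add: indicator_def)
      qed
      also have "\<dots> \<in> borel_measurable lebesgue" by measurable
      finally show "?h \<in> borel_measurable lebesgue" .
      show "AE x in lebesgue. norm (?h x) \<le> norm (indicator {0..m} x * (g x \<bullet> e))"
      proof (rule AE_I2)
        fix x show "norm (?h x) \<le> norm (indicator {0..m} x * (g x \<bullet> e))"
          using pos'[of x] by (cases "d < x") (simp_all add: indicator_def)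
      qed
    qed
    fix a b :: real assume "a < b"
    define a' where "a' = max a (d)"
    define b' where "b' = min b (m)"
    have a': "a' > 0" unfolding a'_def by (simp add: max.strict_coboundedI2 d)
    have "(LINT x|lebesgue. indicator {a<..<b} x * ?h x) = (LINT x|lebesgue. (indicator {0..} x *\<^sub>R (indicator {a'<..<b'} x *\<^sub>R (indicator {..b'} x *\<^sub>R g x))) \<bullet> e)"
      using a' by (intro Bochner_Integration.integral_cong) (auto simp: indicator_def a'_def b'_def)
    also have "\<dots> = (LINT x|lebesgue. (indicator {0..} x *\<^sub>R (indicator {a'<..<b'} x *\<^sub>R (indicator {..b'} x *\<^sub>R g x)))) \<bullet> e"
    proof (rule integral_inner_left)
      assume "e \<noteq> 0"
      have "integrable half_line (\<lambda>x. indicator {a'<..<b'} x *\<^sub>R (indicator {..b'} x *\<^sub>R g x))"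
      proof (rule Bochner_Integration.integrable_bound[OF loc[of b']])
        note [measurable] = borel_measurable_integrable[OF loc[of b']]
        show "(\<lambda>x. indicator {a'<..<b'} x *\<^sub>R (indicator {..b'} x *\<^sub>R g x)) \<in> borel_measurable half_line"
          by (rule borel_measurable_scaleR) (auto intro: borel_measurable_indicator)
      qed (auto simp: indicator_def)
      thus "integrable lebesgue (\<lambda>x. indicator {0..} x *\<^sub>R (indicator {a'<..<b'} x *\<^sub>R (indicator {..b'} x *\<^sub>R g x)))"
        by (simp only: integrable_half_line_iff)
    qed
    also have "(LINT x|lebesgue. (indicator {0..} x *\<^sub>R (indicator {a'<..<b'} x *\<^sub>R (indicator {..b'} x *\<^sub>R g x)))) = (LINT x|half_line. indicator {a'<..<b'} x *\<^sub>R g x)"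
      by (subst integral_half_line_eq) (rule Bochner_Integration.integral_cong, auto simp: indicator_def)
    also have "\<dots> = 0"
    proof (cases "a' < b'")
      case True thus ?thesis using zero' a' by blast
    qed auto
    finally show "(LINT x|lebesgue. indicator {a<..<b} x * ?h x) = 0" by simp
  qed
  \<comment> \<open>The cut-offs from \<open>1 / Suc n\<close> to \<open>n\<close> exhaust the
    positive axis, and the point \<open>0\<close> is a null set.\<close>
  have "AE x in lebesgue. \<forall>n. \<forall>e\<in>Basis. indicator {1 / real (Suc n)<..<real n} x * (g x \<bullet> e) = 0"
  proof (subst AE_all_countable, intro allI AE_finite_allI)
    fix n :: nat and e :: 'a
    have "0 < 1 / real (Suc n)" by simp
    thus "AE x in lebesgue. indicator {1 / real (Suc n)<..<real n} x * (g x \<bullet> e) = 0" by (rule comp)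
  qed auto
  moreover have "AE x in lebesgue. x \<noteq> (0::real)"
    by (rule AE_completion) (rule AE_lborel_singleton)
  ultimately show ?thesis unfolding AE_half_line_iff
  proof eventually_elim
    case (elim x)
    show ?case
    proof
      assume "0 \<le> x"
      hence x: "x > 0" using elim(2) by simp
      obtain n where n: "x < real n" "1 / x < real n" using reals_Archimedean2[of "max x (1 / x)"] by auto
      have "1 < x * real n" using n(2) x by (simp add: divide_simps mult.commute)
      also have "\<dots> \<le> x * real (Suc n)" using x by simp
      finally have *: "1 / real (Suc n) < x" by (simp add: divide_simps mult.commute)
      have **: "g x \<bullet> e = 0" if "e \<in> Basis" for e
      proof -
        have "indicator {1 / real (Suc n)<..<real n} x * (g x \<bullet> e) = 0" using elim(1) that by blast
        moreover have "indicator {1 / real (Suc n)<..<real n} x = (1::real)" using * n(1) by (simp only: indicator_def greaterThanLessThan_iff simp_thms of_bool_eq)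
        ultimately show ?thesis by (simp only: mult_1)
      qed
      show "g x = 0" by (rule euclidean_eqI) (simp only: ** inner_zero_left)
    qed
  qed
qed

section \<open>Primitives and weak derivatives\<close>

definition loc_int :: "(real \<Rightarrow> 'a::euclidean_space) \<Rightarrow> bool"
  where "loc_int g \<longleftrightarrow> (\<forall>Y. integrable half_line (\<lambda>x. indicator {..Y} x *\<^sub>R g x))"

text \<open>The cut-off sits in the integrand and not in the measure, so that Fubini on
  \<open>half_line \<Otimes>\<^sub>M half_line\<close> applies to double integrals with
  \<open>prim\<close>.\<close>

definition prim :: "(real \<Rightarrow> 'a::euclidean_space) \<Rightarrow> real \<Rightarrow> 'a"
  where "prim g x = (LINT s|half_line. indicator {..x} s *\<^sub>R g s)"

lemma sigma_finite_half_line: "sigma_finite_measure half_line"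
proof (rule sigma_finite_measure_restrict_space)
  show "sigma_finite_measure (lebesgue :: real measure)"
  proof
    show "\<exists>A::real set set. countable A \<and> A \<subseteq> sets lebesgue \<and> \<Union>A = space lebesgue \<and> (\<forall>a\<in>A. emeasure lebesgue a \<noteq> \<infinity>)"
    proof (intro exI[of _ "range (\<lambda>n::nat. {- real n..real n})"] conjI ballI)
      show "\<Union>(range (\<lambda>n::nat. {- real n..real n})) = space lebesgue"
      proof (auto)
        fix x :: real
        obtain n where "\<bar>x\<bar> \<le> real n" using real_arch_simple by blast
        thus "\<exists>n. - real n \<le> x \<and> x \<le> real n" by (intro exI[of _ n]) auto
      qed
    qed auto
  qed
qed auto

interpretation half_pair: pair_sigma_finite half_line half_line
  using sigma_finite_half_line by (simp add: pair_sigma_finite_def)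

lemma (in pair_sigma_finite) integrable_product_bound:
  fixes F :: "'a \<times> 'b \<Rightarrow> 'c::{banach, second_countable_topology}"
  assumes [measurable]: "F \<in> borel_measurable (M1 \<Otimes>\<^sub>M M2)"
    and A: "integrable M1 A" and B: "integrable M2 B"
    and bound: "\<And>x y. x \<in> space M1 \<Longrightarrow> y \<in> space M2 \<Longrightarrow> norm (F (x, y)) \<le> A x * B y"
  shows "integrable (M1 \<Otimes>\<^sub>M M2) F"
proof (rule Bochner_Integration.integrable_bound)
  note [measurable] = borel_measurable_integrable[OF A] borel_measurable_integrable[OF B]
  show "integrable (M1 \<Otimes>\<^sub>M M2) (\<lambda>p. A (fst p) * B (snd p))"
  proof (rule Fubini_integrable)
    show "integrable M1 (\<lambda>x. LINT y|M2. norm (A (fst (x, y)) * B (snd (x, y))))"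
      using A by (simp add: abs_mult)
  qed (use A B in auto)
  show "AE p in M1 \<Otimes>\<^sub>M M2. norm (F p) \<le> norm (A (fst p) * B (snd p))"
    using bound by (intro AE_I2) (force simp: space_pair_measure)
qed fact

text \<open>The double integrals of this proof that are exchanged through this rule are dominated by
  a product of two integrable functions of one variable each, which settles integrability on the
  product.\<close>

lemma (in pair_sigma_finite) Fubini_product_bound:
  fixes F :: "'a \<Rightarrow> 'b \<Rightarrow> 'c::{banach, second_countable_topology}"
  assumes "(\<lambda>p. F (fst p) (snd p)) \<in> borel_measurable (M1 \<Otimes>\<^sub>M M2)"
    and "integrable M1 A" and "integrable M2 B"
    and "\<And>x y. x \<in> space M1 \<Longrightarrow> y \<in> space M2 \<Longrightarrow> norm (F x y) \<le> A x * B y"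
  shows "(LINT x|M1. LINT y|M2. F x y) = (LINT y|M2. LINT x|M1. F x y)"
proof -
  have "integrable (M1 \<Otimes>\<^sub>M M2) (\<lambda>p. F (fst p) (snd p))"
    by (rule integrable_product_bound[OF assms(1-3)]) (use assms(4) in auto)
  from Fubini_integral[of F] this show ?thesis by (simp add: case_prod_beta')
qed

lemma AE_half_line_pos: "AE x in half_line. x > 0"
proof -
  have "AE x in lebesgue. x \<noteq> (0::real)"
    by (rule AE_completion) (rule AE_lborel_singleton)
  thus ?thesis unfolding AE_half_line_iff by eventually_elim auto
qed

lemma measurable_half_line_continuous:
  fixes f :: "real \<Rightarrow> 'a::euclidean_space"
  assumes "continuous_on {0..} f"
  shows "f \<in> borel_measurable half_line"
  by (rule continuous_imp_measurable_on_sets_lebesgue[OF assms]) auto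

lemma measurable_half_line_AE_cong:
  fixes f g :: "real \<Rightarrow> 'a::euclidean_space"
  assumes "f \<in> borel_measurable half_line" "AE x in half_line. g x = f x"
  shows "g \<in> borel_measurable half_line"
proof -
  have 1: "(\<lambda>x. if x \<in> {0..} then f x else 0) \<in> borel_measurable lebesgue"
    using assms(1) by (rule borel_measurable_if_I) auto
  have "AE x in lebesgue. (if x \<in> {0..} then f x else 0) = (if x \<in> {0..} then g x else 0)"
    using assms(2) unfolding AE_half_line_iff by eventually_elim auto
  hence "(\<lambda>x. if x \<in> {0..} then g x else 0) \<in> borel_measurable lebesgue"
    by (rule borel_measurable_AE[OF 1])
  thus ?thesis by (rule borel_measurable_if_D)
qed

lemma loc_intD: "loc_int g \<Longrightarrow> integrable half_line (\<lambda>x. indicator {..Y} x *\<^sub>R g x)"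
  by (simp add: loc_int_def)

lemma loc_int_measurable:
  fixes g :: "real \<Rightarrow> 'a::euclidean_space"
  assumes "loc_int g" shows "g \<in> borel_measurable half_line"
proof (rule borel_measurable_LIMSEQ_metric)
  show "(\<lambda>x. indicator {..real n} x *\<^sub>R g x) \<in> borel_measurable half_line" for n
    using loc_intD[OF assms] by (rule borel_measurable_integrable)
  fix x
  obtain N where N: "x < real N" using reals_Archimedean2 by blast
  have "\<forall>\<^sub>F n in sequentially. indicator {..real n} x *\<^sub>R g x = g x"
    by (rule eventually_mono[OF eventually_ge_at_top[of N]]) (use N in \<open>auto simp: indicator_def\<close>)
  thus "(\<lambda>n. indicator {..real n} x *\<^sub>R g x) \<longlonglongrightarrow> g x" by (rule tendsto_eventually)
qed

lemma integrable_scaleR_loc_int: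
  fixes g :: "real \<Rightarrow> 'a::euclidean_space" and h :: "real \<Rightarrow> real"
  assumes "loc_int g" "continuous_on UNIV h" "\<And>x. x \<notin> {a..b} \<Longrightarrow> h x = 0"
  shows "integrable half_line (\<lambda>x. h x *\<^sub>R g x)"
proof -
  have "compact (h ` {a..b})" by (intro compact_continuous_image continuous_on_subset[OF assms(2)]) auto
  then obtain B where B: "\<And>x. x \<in> {a..b} \<Longrightarrow> \<bar>h x\<bar> \<le> B"
    using compact_imp_bounded bounded_iff by (metis image_eqI real_norm_def)
  note [measurable] = loc_int_measurable[OF assms(1)]
    measurable_half_line_continuous[OF continuous_on_subset[OF assms(2)], simplified]
  show ?thesis
  proof (rule Bochner_Integration.integrable_bound)
    show "integrable half_line (\<lambda>x. B *\<^sub>R (indicator {..b} x *\<^sub>R g x))"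
      using loc_intD[OF assms(1)] by (rule integrable_scaleR_right)
    show "AE x in half_line. norm (h x *\<^sub>R g x) \<le> norm (B *\<^sub>R (indicator {..b} x *\<^sub>R g x))"
    proof (rule AE_I2)
      fix x show "norm (h x *\<^sub>R g x) \<le> norm (B *\<^sub>R (indicator {..b} x *\<^sub>R g x))"
        using assms(3)[of x] B[of x] by (cases "x \<in> {a..b}") (auto intro!: mult_right_mono)
    qed
  qed measurable
qed

lemma loc_int_iff:
  fixes g :: "real \<Rightarrow> 'a::euclidean_space"
  shows "loc_int g \<longleftrightarrow> (\<forall>Y. integrable (lebesgue_on {0..Y}) g)"
proof -
  have "integrable half_line (\<lambda>x. indicator {..Y} x *\<^sub>R g x) \<longleftrightarrow> integrable (lebesgue_on {0..Y}) g" for Y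
    unfolding integrable_half_line_iff
    by (subst integrable_restrict_space) (auto intro!: arg_cong[where f="integrable lebesgue"] simp: indicator_def)
  thus ?thesis by (simp add: loc_int_def)
qed

lemma prim_eq:
  fixes g :: "real \<Rightarrow> 'a::euclidean_space"
  shows "prim g x = (LINT s|lebesgue_on {0..x}. g s)"
  unfolding prim_def integral_half_line_eq
  by (subst integral_restrict_space) (auto intro!: arg_cong[where f="integral\<^sup>L lebesgue"] simp: indicator_def)

lemma loc_int_continuous:
  fixes g :: "real \<Rightarrow> 'a::euclidean_space"
  assumes "continuous_on {0..} g" shows "loc_int g"
  unfolding loc_int_iff by (intro allI continuous_imp_integrable_real continuous_on_subset[OF assms]) auto

lemma loc_int_diff: "loc_int f \<Longrightarrow> loc_int g \<Longrightarrow> loc_int (\<lambda>x. f x - g x)"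
  unfolding loc_int_iff by (auto intro: Bochner_Integration.integrable_diff)

lemma loc_int_AE_cong:
  fixes f g :: "real \<Rightarrow> 'a::euclidean_space"
  assumes "loc_int f" "AE x in half_line. g x = f x"
  shows "loc_int g"
  unfolding loc_int_def
proof
  fix Y
  note [measurable] = loc_int_measurable[OF assms(1)] measurable_half_line_AE_cong[OF loc_int_measurable[OF assms(1)] assms(2)]
  show "integrable half_line (\<lambda>x. indicator {..Y} x *\<^sub>R g x)"
    by (subst integrable_cong_AE[where g = "\<lambda>x. indicator {..Y} x *\<^sub>R f x"])
       (use assms loc_intD in auto)
qed

lemma prim_AE_cong:
  fixes f g :: "real \<Rightarrow> 'a::euclidean_space"
  assumes "loc_int f" "AE x in half_line. g x = f x"
  shows "prim g x = prim f x"
proof -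
  note [measurable] = loc_int_measurable[OF assms(1)] measurable_half_line_AE_cong[OF loc_int_measurable[OF assms(1)] assms(2)]
  show ?thesis unfolding prim_def by (rule integral_cong_AE) (use assms(2) in auto)
qed

lemma continuous_on_prim:
  fixes g :: "real \<Rightarrow> 'a::euclidean_space"
  assumes "loc_int g" shows "continuous_on {0..} (prim g)"
proof -
  have "continuous_on {0..b} (prim g)" for b
    using indefinite_integral_continuous_real[of 0 b g] assms
    by (simp add: prim_eq[abs_def] loc_int_iff)
  hence "continuous_on {0..<b} (prim g)" for b by (rule continuous_on_subset[of "{0..b}"]) auto
  hence c: "continuous (at x within {0..<b}) (prim g)" if "x \<in> {0..<b}" for x b
    using that by (simp add: continuous_on_eq_continuous_within)
  show ?thesis unfolding continuous_on_eq_continuous_within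
  proof
    fix x :: real assume x: "x \<in> {0..}"
    have "at x within {0..<x+1} = at x within {0..}"
      by (rule at_within_nhd[where S="{..<x+1}"]) auto
    thus "continuous (at x within {0..}) (prim g)" using c[of x "x+1"] x by simp
  qed
qed

lemma prim_0: "prim g 0 = 0"
  unfolding prim_def integral_half_line_eq
proof (rule integral_eq_zero_AE)
  have "AE x in lebesgue. x \<noteq> (0::real)"
    by (rule AE_completion) (rule AE_lborel_singleton)
  thus "AE x in lebesgue. indicator {0..} x *\<^sub>R (indicator {..0} x *\<^sub>R g x) = 0"
    by eventually_elim (auto simp: indicator_def)
qed

lemma prim_has_vector_derivative:
  fixes g :: "real \<Rightarrow> 'a::euclidean_space"
  assumes g: "continuous_on {0..} g" and x: "x \<ge> 0"
  shows "(prim g has_vector_derivative g x) (at x within {0..})"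
proof -
  have eq: "prim g y = integral {0..y} g" for y
    unfolding prim_eq
    by (rule lebesgue_integral_eq_integral) (auto intro!: continuous_imp_integrable_real continuous_on_subset[OF g])
  have "((\<lambda>u. integral {0..u} g) has_vector_derivative g x) (at x within {0..x+1})"
    by (rule integral_has_vector_derivative) (use x in \<open>auto intro: continuous_on_subset[OF g]\<close>)
  moreover have "at x within {0..x+1} = at x within {0..}"
    by (rule at_within_nhd[where S="{..<x+1}"]) auto
  ultimately show ?thesis by (simp add: eq[abs_def])
qed

lemma integral_tail_deriv:
  fixes f f' :: "real \<Rightarrow> real"
  assumes d: "\<And>x. (f has_vector_derivative f' x) (at x)" and c: "continuous_on UNIV f'"
    and z: "\<And>x. x \<notin> {a..b} \<Longrightarrow> f x = 0" "\<And>x. x \<notin> {a..b} \<Longrightarrow> f' x = 0" and s: "s \<ge> 0"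
  shows "(LINT x|half_line. indicator {s..} x * f' x) = - f s"
proof -
  define Y where "Y = max s b + 1"
  have "(LINT x|half_line. indicator {s..} x * f' x) = (LINT x|lebesgue_on {s..Y}. f' x)"
    unfolding integral_half_line_eq using s z(2)
    by (subst integral_restrict_space)
       (auto intro!: Bochner_Integration.integral_cong simp: indicator_def Y_def, smt (verit))
  also have "\<dots> = integral {s..Y} f'"
    by (rule lebesgue_integral_eq_integral) (auto intro!: continuous_imp_integrable_real continuous_on_subset[OF c])
  also have "\<dots> = f Y - f s"
    by (rule integral_unique, rule fundamental_theorem_of_calculus)
       (auto simp: Y_def intro: has_vector_derivative_at_within d)
  also have "f Y = 0" by (rule z) (auto simp: Y_def)
  finally show ?thesis by simp
qed

text \<open>Integration by parts for a merely locally integrable \<open>g\<close>: after exchanging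
  the integrals, the inner one is that of \<open>f'\<close> over \<open>{s..}\<close>, which is
  \<open>- f s\<close> since \<open>f\<close> vanishes far to the right.\<close>

lemma integral_deriv_prim:
  fixes g :: "real \<Rightarrow> 'a::euclidean_space" and f f' :: "real \<Rightarrow> real"
  assumes g: "loc_int g"
    and f: "\<And>x. (f has_vector_derivative f' x) (at x)" "continuous_on UNIV f'"
    "\<And>x. x \<notin> {a..b} \<Longrightarrow> f x = 0" "\<And>x. x \<notin> {a..b} \<Longrightarrow> f' x = 0"
  shows "(LINT x|half_line. f' x *\<^sub>R prim g x) = - (LINT x|half_line. f x *\<^sub>R g x)"
proof -
  note [measurable] = loc_int_measurable[OF g]
    measurable_half_line_continuous[OF continuous_on_subset[OF f(2)], simplified]
  have i: "integrable half_line f'"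
    using integrable_scaleR_loc_int[of "\<lambda>_. 1::real" f' a b] f loc_int_continuous[of "\<lambda>_. 1::real"] by simp
  let ?F = "\<lambda>x s. (f' x * indicator {..x} s) *\<^sub>R g s"
  have "(LINT x|half_line. f' x *\<^sub>R prim g x) = (LINT x|half_line. LINT s|half_line. ?F x s)"
    unfolding prim_def by (intro Bochner_Integration.integral_cong refl) (simp add: scaleR_scaleR[symmetric] del: scaleR_scaleR)
  also have "\<dots> = (LINT s|half_line. LINT x|half_line. ?F x s)"
  proof (rule half_pair.Fubini_product_bound)
    have "(\<lambda>p. if snd p \<le> fst p then f' (fst p) *\<^sub>R g (snd p) else 0) \<in> borel_measurable (half_line \<Otimes>\<^sub>M half_line)"
      by measurable
    also have "(\<lambda>p. if snd p \<le> fst p then f' (fst p) *\<^sub>R g (snd p) else 0) = (\<lambda>p. ?F (fst p) (snd p))"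
      by (auto simp: indicator_def)
    finally show "(\<lambda>p. ?F (fst p) (snd p)) \<in> borel_measurable (half_line \<Otimes>\<^sub>M half_line)" .
    show "integrable half_line (\<lambda>x. norm (f' x))" using i by (rule integrable_norm)
    show "integrable half_line (\<lambda>x. norm (indicator {..b} x *\<^sub>R g x))" using loc_intD[OF g] by (rule integrable_norm)
    fix x s :: real
    show "norm (?F x s) \<le> norm (f' x) * norm (indicator {..b} s *\<^sub>R g s)"
      using f(4)[of x] by (cases "x \<in> {a..b}") (auto simp: indicator_def)
  qed
  also have "\<dots> = (LINT s|half_line. - (f s *\<^sub>R g s))"
  proof (rule Bochner_Integration.integral_cong[OF refl])
    fix s assume "s \<in> space half_line"
    hence s: "s \<ge> 0" by simp
    have "integrable half_line (\<lambda>x. f' x * indicator {..x} s)"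
    proof (rule Bochner_Integration.integrable_bound[OF i])
      have "(\<lambda>x. if s \<le> x then f' x else 0) \<in> borel_measurable half_line" by measurable
      thus "(\<lambda>x. f' x * indicator {..x} s) \<in> borel_measurable half_line"
        by (rule back_subst[of "\<lambda>h. h \<in> borel_measurable half_line"]) (auto simp: indicator_def)
    qed (auto simp: indicator_def)
    hence "(LINT x|half_line. ?F x s) = (LINT x|half_line. f' x * indicator {..x} s) *\<^sub>R g s"
      by (intro integral_scaleR_left) auto
    also have "(LINT x|half_line. f' x * indicator {..x} s) = (LINT x|half_line. indicator {s..} x * f' x)"
      by (intro Bochner_Integration.integral_cong) (auto simp: indicator_def)
    also have "\<dots> = - f s" by (rule integral_tail_deriv[OF f s])
    finally show "(LINT x|half_line. ?F x s) = - (f s *\<^sub>R g s)" by simp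
  qed
  finally show ?thesis by simp
qed


section \<open>The du Bois-Reymond lemma and weak derivatives\<close>

lemma integral_bump_pos:
  assumes "c > 0" "a < b"
  shows "integral {a..b} (bump c a b 0) > 0"
proof -
  have "integral {a..b} (bump c a b 0) \<ge> 0"
    by (rule Henstock_Kurzweil_Integration.integral_nonneg)
      (auto intro!: integrable_continuous_interval continuous_on_bump assms simp: bump_0)
  moreover have "integral {a..b} (bump c a b 0) \<noteq> 0"
  proof
    assume "integral {a..b} (bump c a b 0) = 0"
    hence "\<forall>x\<in>{a..b}. bump c a b 0 x = 0"
      by (subst (asm) integral_eq_0_iff[OF continuous_on_bump[OF assms]]) (use assms in \<open>auto simp: bump_0\<close>)
    moreover have "(a + b) / 2 \<in> {a..b}" "bump c a b 0 ((a + b) / 2) \<noteq> 0"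
      using assms by (auto simp: bump_0)
    ultimately show False by blast
  qed
  ultimately show ?thesis by simp
qed

lemma integral_bump_long:
  assumes "c > 0" "a < b" "0 < a" "b \<le> Y"
  shows "integral {0..Y} (bump c a b 0) = integral {a..b} (bump c a b 0)"
  by (rule integral_spike_set)
     (use assms in \<open>auto intro!: negligible_subset[of "{}"] simp: bump_0 split: if_splits\<close>)

text \<open>A test function has a compactly supported primitive exactly when its integral vanishes.
  Subtracting \<open>r\<close> times a fixed bump on the interval from \<open>1\<close> to
  \<open>2\<close> removes the integral.\<close>

lemma bump_diff_eq_deriv:
  assumes c: "c > 0" "0 < a" "a < b"
  defines "r \<equiv> integral {a..b} (bump c a b 0) / integral {1..2} (bump 1 1 2 0)"
  obtains \<psi> where "smooth_cpt_supp \<psi>"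
    "\<And>x. x > 0 \<Longrightarrow> (\<psi> has_vector_derivative (bump c a b 0 x - r * bump 1 1 2 0 x)) (at x)"
proof -
  define h where "h n x = bump c a b n x - r * bump 1 1 2 n x" for n x
  define \<psi> where "\<psi> x = integral {0..x} (h 0)" for x
  have ch: "continuous_on S (h n)" for S n
    unfolding h_def by (intro continuous_intros continuous_on_bump) (use c in auto)
  have d0: "(\<psi> has_vector_derivative h 0 x) (at x)" if "x > 0" for x
  proof -
    have "(\<psi> has_vector_derivative h 0 x) (at x within {0..x+1})"
      unfolding \<psi>_def by (rule integral_has_vector_derivative[OF ch]) (use that in auto)
    moreover have "at x within {0..x+1} = at x"
      by (rule at_within_interior) (use that in \<open>auto simp: interior_cbox[of 0 "x+1", simplified]\<close>)
    ultimately show ?thesis by simp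
  qed
  have dn: "(h n has_vector_derivative h (Suc n) x) (at x)" for n x
    unfolding h_def has_real_derivative_iff_has_vector_derivative[symmetric]
    by (intro DERIV_diff DERIV_cmult bump_has_derivative) (use c in auto)
  have "smooth_cpt_supp \<psi>" unfolding smooth_cpt_supp_def
  proof (intro conjI exI[of _ "\<lambda>n. case n of 0 \<Rightarrow> \<psi> | Suc m \<Rightarrow> h m"] exI[of _ "{min a 1..max b 2}"])
    show "\<forall>n. \<forall>x>0. ((case n of 0 \<Rightarrow> \<psi> | Suc m \<Rightarrow> h m) has_vector_derivative (case Suc n of 0 \<Rightarrow> \<psi> | Suc m \<Rightarrow> h m) x) (at x)"
      using d0 dn by (auto split: nat.split)
    show "\<forall>x\<in>{0<..} - {min a 1..max b 2}. \<psi> x = 0"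
    proof
      fix x assume x: "x \<in> {0<..} - {min a 1..max b 2}"
      show "\<psi> x = 0"
      proof (cases "x < min a 1")
        case True
        have "integral {0..x} (h 0) = integral {0..x} (\<lambda>_. 0)"
          by (rule Henstock_Kurzweil_Integration.integral_cong) (use True in \<open>auto simp: h_def bump_0\<close>)
        thus ?thesis by (simp add: \<psi>_def)
      next
        case False
        hence x': "b \<le> x" "2 \<le> x" using x by auto
        have "\<psi> x = integral {0..x} (bump c a b 0) - integral {0..x} (\<lambda>x. r * bump 1 1 2 0 x)"
          unfolding \<psi>_def h_def
          by (rule Henstock_Kurzweil_Integration.integral_diff)
             (auto intro!: integrable_continuous_interval continuous_intros continuous_on_bump c)
        also have "\<dots> = integral {a..b} (bump c a b 0) - r * integral {1..2} (bump 1 1 2 0)"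
          using x' c by (simp add: integral_bump_long)
        also have "\<dots> = 0" using integral_bump_pos[of 1 1 2] by (simp add: r_def)
        finally show ?thesis .
      qed
    qed
  qed (use c in auto)
  thus ?thesis using that[of \<psi>] d0 by (simp add: h_def)
qed

lemma integrable_bump_scaleR:
  fixes g :: "real \<Rightarrow> 'a::euclidean_space"
  assumes "loc_int g" "c > 0" "a < b"
  shows "integrable half_line (\<lambda>x. bump c a b 0 x *\<^sub>R g x)"
  by (rule integrable_scaleR_loc_int[OF assms(1) continuous_on_bump bump_eq_0]) (use assms in auto)

lemma integral_bump_half_line:
  assumes "c > 0" "a < b" "0 < a"
  shows "(LINT x|half_line. bump c a b 0 x) = integral {a..b} (bump c a b 0)"
proof -
  have "(LINT x|half_line. bump c a b 0 x) = (LINT x|lebesgue_on {a..b}. bump c a b 0 x)"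
    unfolding integral_half_line_eq using assms(3)
    by (subst integral_restrict_space) (auto intro!: Bochner_Integration.integral_cong simp: indicator_def bump_0)
  also have "\<dots> = integral {a..b} (bump c a b 0)"
    by (rule lebesgue_integral_eq_integral) (auto intro!: continuous_imp_integrable_real continuous_on_bump assms)
  finally show ?thesis .
qed

lemma deriv_AE_half_line:
  assumes "\<And>x. x > 0 \<Longrightarrow> (f has_vector_derivative f' x) (at x)"
  shows "AE x in half_line. deriv f x = f' x"
  using AE_half_line_pos
  by eventually_elim (use assms in \<open>auto intro!: DERIV_imp_deriv simp: has_real_derivative_iff_has_vector_derivative\<close>)

lemma integral_deriv_scaleR:
  fixes f f' :: "real \<Rightarrow> real" and g :: "real \<Rightarrow> 'a::euclidean_space"
  assumes d: "\<And>x. x > 0 \<Longrightarrow> (f has_vector_derivative f' x) (at x)"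
    and c: "continuous_on UNIV f'" and g: "g \<in> borel_measurable half_line"
  shows "(LINT x|half_line. deriv f x *\<^sub>R g x) = (LINT x|half_line. f' x *\<^sub>R g x)"
proof -
  have m [measurable]: "f' \<in> borel_measurable half_line"
    by (rule measurable_half_line_continuous[OF continuous_on_subset[OF c]]) auto
  have [measurable]: "deriv f \<in> borel_measurable half_line"
    by (rule measurable_half_line_AE_cong[OF m deriv_AE_half_line[OF d]])
  note g [measurable]
  show ?thesis
    by (rule integral_cong_AE, measurable) (use deriv_AE_half_line[OF d] in auto)
qed

text \<open>Every bump is a multiple of one fixed bump plus the derivative of a test function, and
  the derivative contributes nothing. So \<open>g\<close> and the constant \<open>k\<close> have the
  same integral against each bump.\<close>

lemma du_Bois_Reymond:
  fixes g :: "real \<Rightarrow> 'a::euclidean_space"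
  assumes loc: "loc_int g"
    and zero: "\<And>\<phi>::real \<Rightarrow> real. smooth_cpt_supp \<phi> \<Longrightarrow> (LINT x|half_line. deriv \<phi> x *\<^sub>R g x) = 0"
  obtains k where "AE x in half_line. g x = k"
proof -
  let ?\<theta> = "bump 1 1 2 0"
  define m0 where "m0 = integral {1..2} ?\<theta>"
  have m0: "m0 > 0" unfolding m0_def by (rule integral_bump_pos) auto
  \<comment> \<open>If \<open>g\<close> is constant almost everywhere, its value can only be this
    mean against the fixed bump.\<close>
  define k where "k = (1 / m0) *\<^sub>R (LINT x|half_line. ?\<theta> x *\<^sub>R g x)"
  have lk: "loc_int (\<lambda>_. k)" by (rule loc_int_continuous) auto
  have "AE x in half_line. g x - k = 0"
  proof (rule AE_eq_0_if_bump_integrals_0)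
    show "integrable half_line (\<lambda>x. indicator {..Y} x *\<^sub>R (g x - k))" for Y
      by (rule loc_intD[OF loc_int_diff[OF loc lk]])
    fix c a b :: real assume c: "c > 0" "0 < a" "a < b"
    let ?\<phi> = "bump c a b 0"
    define m where "m = integral {a..b} ?\<phi>"
    obtain \<psi> where \<psi>: "smooth_cpt_supp \<psi>"
      "\<And>x. x > 0 \<Longrightarrow> (\<psi> has_vector_derivative (?\<phi> x - m / m0 * ?\<theta> x)) (at x)"
      using bump_diff_eq_deriv[OF c] unfolding m_def m0_def by blast
    note i1 = integrable_bump_scaleR[OF loc c(1,3)]
    have i2': "integrable half_line (\<lambda>x. (m / m0) *\<^sub>R (?\<theta> x *\<^sub>R g x))"
      by (intro integrable_scaleR_right integrable_bump_scaleR[OF loc]) auto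
    have "0 = (LINT x|half_line. deriv \<psi> x *\<^sub>R g x)" using zero[OF \<psi>(1)] by simp
    also have "\<dots> = (LINT x|half_line. (?\<phi> x - m / m0 * ?\<theta> x) *\<^sub>R g x)"
      by (rule integral_deriv_scaleR[OF \<psi>(2) _ loc_int_measurable[OF loc]])
         (use m0 in \<open>auto intro!: continuous_intros continuous_on_bump c\<close>)
    also have "\<dots> = (LINT x|half_line. ?\<phi> x *\<^sub>R g x - (m / m0) *\<^sub>R (?\<theta> x *\<^sub>R g x))"
      by (simp add: scaleR_diff_left)
    also have "\<dots> = (LINT x|half_line. ?\<phi> x *\<^sub>R g x) - (m / m0) *\<^sub>R (LINT x|half_line. ?\<theta> x *\<^sub>R g x)"
      using Bochner_Integration.integral_diff[OF i1 i2'] by (simp only: integral_scaleR_right)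
    also have "(m / m0) *\<^sub>R (LINT x|half_line. ?\<theta> x *\<^sub>R g x) = m *\<^sub>R k" using m0 by (simp add: k_def)
    finally have eq: "(LINT x|half_line. ?\<phi> x *\<^sub>R g x) = m *\<^sub>R k" by simp
    have i3: "integrable half_line ?\<phi>"
      using integrable_scaleR_loc_int[of "\<lambda>_. 1::real" ?\<phi> a b] c bump_eq_0[of _ a b c 0] continuous_on_bump[of c a b UNIV 0]
        loc_int_continuous[of "\<lambda>_. 1::real"] by simp
    have "(LINT x|half_line. ?\<phi> x *\<^sub>R (g x - k)) = (LINT x|half_line. ?\<phi> x *\<^sub>R g x) - (LINT x|half_line. ?\<phi> x *\<^sub>R k)"
      unfolding scaleR_diff_right using i1 i3 by (intro Bochner_Integration.integral_diff) auto
    also have "(LINT x|half_line. ?\<phi> x *\<^sub>R k) = m *\<^sub>R k"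
      using i3 integral_bump_half_line[OF c(1,3,2)] by (simp add: m_def)
    finally show "(LINT x|half_line. ?\<phi> x *\<^sub>R (g x - k)) = 0" using eq by simp
  qed
  thus ?thesis using that[of k] by simp
qed

text \<open>Integration by parts through \<open>integral_deriv_prim\<close>. The constant
  \<open>c\<close> drops out because the derivative of a test function has integral
  \<open>- f0 0 = 0\<close>.\<close>

lemma has_weak_deriv_prim:
  assumes "loc_int v"
  shows "has_weak_deriv (\<lambda>x. c + prim v x) v"
  unfolding has_weak_deriv_def
proof (intro allI impI)
  fix \<phi> :: "real \<Rightarrow> real" assume "smooth_cpt_supp \<phi>"
  then obtain a b f0 f' where f: "0 < a" "a < b" "\<And>x. x > 0 \<Longrightarrow> f0 x = \<phi> x"
    "\<And>x. (f0 has_vector_derivative f' x) (at x)" "\<And>x. x > 0 \<Longrightarrow> (\<phi> has_vector_derivative f' x) (at x)"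
    "continuous_on UNIV f0" "continuous_on UNIV f'"
    "\<And>x. x \<notin> {a..b} \<Longrightarrow> f0 x = 0" "\<And>x. x \<notin> {a..b} \<Longrightarrow> f' x = 0"
    by (rule smooth_cpt_suppE) blast
  have cp: "continuous_on {0..} (prim v)" by (rule continuous_on_prim[OF assms])
  have lp: "loc_int (prim v)" by (rule loc_int_continuous[OF cp])
  have lc: "loc_int (\<lambda>_. c)" by (rule loc_int_continuous) auto
  note i = integrable_scaleR_loc_int[OF _ f(7,9)] integrable_scaleR_loc_int[OF _ f(6,8)]
  have i1: "integrable half_line f'"
    using i(1)[of "\<lambda>_. 1::real"] loc_int_continuous[of "\<lambda>_. 1::real"] by simp
  have AE: "AE x in half_line. \<phi> x = f0 x" using AE_half_line_pos by eventually_elim (simp add: f)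
  have m0: "f0 \<in> borel_measurable half_line"
    by (rule measurable_half_line_continuous[OF continuous_on_subset[OF f(6)]]) auto
  note [measurable] = m0 measurable_half_line_AE_cong[OF m0 AE] loc_int_measurable[OF assms]
  have "(LINT x|half_line. deriv \<phi> x *\<^sub>R (c + prim v x)) = (LINT x|half_line. f' x *\<^sub>R (c + prim v x))"
    by (rule integral_deriv_scaleR[OF f(5,7)])
       (auto intro!: measurable_half_line_continuous continuous_intros cp)
  also have "\<dots> = (LINT x|half_line. f' x *\<^sub>R c) + (LINT x|half_line. f' x *\<^sub>R prim v x)"
    unfolding scaleR_add_right by (rule Bochner_Integration.integral_add[OF i(1)[OF lc] i(1)[OF lp]])
  also have "(LINT x|half_line. f' x *\<^sub>R c) = (LINT x|half_line. f' x) *\<^sub>R c"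
    using i1 by simp
  also have "(LINT x|half_line. f' x) = (LINT x|half_line. indicator {0..} x * f' x)"
    by (rule Bochner_Integration.integral_cong) auto
  also have "\<dots> = - f0 0" by (rule integral_tail_deriv[OF f(4,7,8,9)]) auto
  also have "f0 0 = 0" using f(1) by (intro f(8)) auto
  also have "(LINT x|half_line. f' x *\<^sub>R prim v x) = - (LINT x|half_line. f0 x *\<^sub>R v x)"
    by (rule integral_deriv_prim[OF assms f(4,7,8,9)])
  also have "(LINT x|half_line. f0 x *\<^sub>R v x) = (LINT x|half_line. \<phi> x *\<^sub>R v x)"
    by (rule integral_cong_AE, measurable) (use AE in auto)
  finally show "(LINT x|half_line. deriv \<phi> x *\<^sub>R (c + prim v x)) = - (LINT x|half_line. \<phi> x *\<^sub>R v x)" by simp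
qed

lemma has_weak_deriv_AE_cong:
  assumes u: "loc_int u" "AE x in half_line. u' x = u x" and v: "loc_int v" "AE x in half_line. v' x = v x"
    and d: "has_weak_deriv u v"
  shows "has_weak_deriv u' v'"
  unfolding has_weak_deriv_def
proof (intro allI impI)
  fix \<phi> :: "real \<Rightarrow> real" assume \<phi>: "smooth_cpt_supp \<phi>"
  then obtain a b f0 f' where f: "0 < a" "a < b" "\<And>x. x > 0 \<Longrightarrow> f0 x = \<phi> x"
    "\<And>x. (f0 has_vector_derivative f' x) (at x)" "\<And>x. x > 0 \<Longrightarrow> (\<phi> has_vector_derivative f' x) (at x)"
    "continuous_on UNIV f0" "continuous_on UNIV f'"
    "\<And>x. x \<notin> {a..b} \<Longrightarrow> f0 x = 0" "\<And>x. x \<notin> {a..b} \<Longrightarrow> f' x = 0"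
    by (rule smooth_cpt_suppE) blast
  have AE: "AE x in half_line. \<phi> x = f0 x" using AE_half_line_pos by eventually_elim (simp add: f)
  have m0: "f0 \<in> borel_measurable half_line" "f' \<in> borel_measurable half_line"
    by (auto intro!: measurable_half_line_continuous continuous_on_subset[OF f(6)] continuous_on_subset[OF f(7)])
  note [measurable] = measurable_half_line_AE_cong[OF m0(1) AE] measurable_half_line_AE_cong[OF m0(2) deriv_AE_half_line[OF f(5)]]
    loc_int_measurable[OF u(1)] loc_int_measurable[OF v(1)]
    loc_int_measurable[OF loc_int_AE_cong[OF u]] loc_int_measurable[OF loc_int_AE_cong[OF v]]
  have "(LINT x|half_line. deriv \<phi> x *\<^sub>R u' x) = (LINT x|half_line. deriv \<phi> x *\<^sub>R u x)"
    by (rule integral_cong_AE, measurable) (use u in auto)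
  also have "\<dots> = - (LINT x|half_line. \<phi> x *\<^sub>R v x)" using d \<phi> unfolding has_weak_deriv_def by blast
  also have "(LINT x|half_line. \<phi> x *\<^sub>R v x) = (LINT x|half_line. \<phi> x *\<^sub>R v' x)"
    by (rule integral_cong_AE, measurable) (use v in auto)
  finally show "(LINT x|half_line. deriv \<phi> x *\<^sub>R u' x) = - (LINT x|half_line. \<phi> x *\<^sub>R v' x)" .
qed

text \<open>Testing with a bump eliminates \<open>u\<close> from the difference, and bumps determine
  a locally integrable function up to a null set.\<close>

lemma has_weak_deriv_unique:
  assumes v: "loc_int v" "loc_int v'" and d: "has_weak_deriv u v" "has_weak_deriv u v'"
  shows "AE x in half_line. v x = v' x"
proof -
  have "AE x in half_line. v x - v' x = 0"
  proof (rule AE_eq_0_if_bump_integrals_0)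
    show "integrable half_line (\<lambda>x. indicator {..Y} x *\<^sub>R (v x - v' x))" for Y
      by (rule loc_intD[OF loc_int_diff[OF v]])
    fix c a b :: real assume c: "c > 0" "0 < a" "a < b"
    have "(LINT x|half_line. bump c a b 0 x *\<^sub>R (v x - v' x)) =
      (LINT x|half_line. bump c a b 0 x *\<^sub>R v x) - (LINT x|half_line. bump c a b 0 x *\<^sub>R v' x)"
      unfolding scaleR_diff_right
      by (rule Bochner_Integration.integral_diff[OF integrable_bump_scaleR[OF v(1) c(1,3)] integrable_bump_scaleR[OF v(2) c(1,3)]])
    also have "\<dots> = 0"
    proof -
      have "(LINT x|half_line. deriv (bump c a b 0) x *\<^sub>R u x) = - (LINT x|half_line. bump c a b 0 x *\<^sub>R w x)"
        if "has_weak_deriv u w" for w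
        using that smooth_cpt_supp_bump[OF c] unfolding has_weak_deriv_def by blast
      from this[OF d(1)] this[OF d(2)] show ?thesis by simp
    qed
    finally show "(LINT x|half_line. bump c a b 0 x *\<^sub>R (v x - v' x)) = 0" .
  qed
  thus ?thesis by simp
qed

text \<open>\<open>u - prim v\<close> has weak derivative zero, so it is constant almost everywhere.
  The right-hand side is the continuous representative of \<open>u\<close>, with value
  \<open>c\<close> at \<open>0\<close>, from which traces are read off.\<close>

lemma has_weak_deriv_imp_prim:
  assumes u: "loc_int u" and v: "loc_int v" and d: "has_weak_deriv u v"
  obtains c where "AE x in half_line. u x = c + prim v x"
proof -
  have cp: "continuous_on {0..} (prim v)" by (rule continuous_on_prim[OF v])
  have lp: "loc_int (prim v)" by (rule loc_int_continuous[OF cp])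
  have d': "has_weak_deriv (prim v) v" using has_weak_deriv_prim[OF v, of 0] by simp
  obtain c where "AE x in half_line. u x - prim v x = c"
  proof (rule du_Bois_Reymond[OF loc_int_diff[OF u lp]])
    fix \<phi> :: "real \<Rightarrow> real" assume \<phi>: "smooth_cpt_supp \<phi>"
    then obtain a b f0 f' where f: "0 < a" "a < b" "\<And>x. x > 0 \<Longrightarrow> f0 x = \<phi> x"
      "\<And>x. (f0 has_vector_derivative f' x) (at x)" "\<And>x. x > 0 \<Longrightarrow> (\<phi> has_vector_derivative f' x) (at x)"
      "continuous_on UNIV f0" "continuous_on UNIV f'"
      "\<And>x. x \<notin> {a..b} \<Longrightarrow> f0 x = 0" "\<And>x. x \<notin> {a..b} \<Longrightarrow> f' x = 0"
      by (rule smooth_cpt_suppE) blast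
    have eq: "(LINT x|half_line. deriv \<phi> x *\<^sub>R h x) = (LINT x|half_line. f' x *\<^sub>R h x)"
      if "loc_int h" for h :: "real \<Rightarrow> complex^2"
      by (rule integral_deriv_scaleR) (use f loc_int_measurable[OF that] in auto)
    have "(LINT x|half_line. deriv \<phi> x *\<^sub>R (u x - prim v x)) =
      (LINT x|half_line. f' x *\<^sub>R u x) - (LINT x|half_line. f' x *\<^sub>R prim v x)"
      unfolding eq[OF loc_int_diff[OF u lp]]
      unfolding scaleR_diff_right
      by (rule Bochner_Integration.integral_diff[OF integrable_scaleR_loc_int[OF u f(7,9)] integrable_scaleR_loc_int[OF lp f(7,9)]])
    also have "\<dots> = (LINT x|half_line. deriv \<phi> x *\<^sub>R u x) - (LINT x|half_line. deriv \<phi> x *\<^sub>R prim v x)"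
      by (simp only: eq[OF u] eq[OF lp])
    also have "\<dots> = 0" using d d' \<phi> unfolding has_weak_deriv_def by simp
    finally show "(LINT x|half_line. deriv \<phi> x *\<^sub>R (u x - prim v x)) = 0" .
  qed
  hence "AE x in half_line. u x = c + prim v x" by eventually_elim (simp add: algebra_simps)
  thus ?thesis by (rule that)
qed

section \<open>Square-integrable functions on the half line\<close>

lemma norm_vector_scalar_mult: "norm (c *s x) = cmod c * norm (x :: complex^'n)"
proof -
  have "norm (c *s x) = sqrt (\<Sum>i\<in>UNIV. (cmod c)\<^sup>2 * (norm (x $ i))\<^sup>2)"
    by (simp add: norm_vec_def L2_set_def norm_mult power_mult_distrib)
  also have "\<dots> = cmod c * norm x"
    by (simp add: norm_vec_def L2_set_def sum_distrib_left[symmetric] real_sqrt_mult)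
  finally show ?thesis .
qed

lemma bounded_bilinear_vector_scalar_mult:
  "bounded_bilinear ((*s) :: complex \<Rightarrow> complex^'n \<Rightarrow> complex^'n)"
proof
  show "\<exists>K. \<forall>a b. norm ((a::complex) *s (b::complex^'n)) \<le> norm a * norm b * K"
    by (intro exI[of _ 1]) (simp add: norm_vector_scalar_mult)
qed (auto simp: vec_eq_iff algebra_simps)

lemma bounded_linear_matrix_vector_mult:
  "bounded_linear (\<lambda>x. (A::complex^'n^'m) *v x)"
proof (rule linear_conv_bounded_linear[THEN iffD1], rule linearI)
  show "A *v (x + y) = A *v x + A *v y" for x y by (rule matrix_vector_right_distrib)
  show "A *v (r *\<^sub>R x) = r *\<^sub>R (A *v x)" for r x
    by (simp add: vec_eq_iff matrix_vector_mult_def scaleR_sum_right)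
qed

lemmas bounded_linear_vsm_right = bounded_bilinear.bounded_linear_right[OF bounded_bilinear_vector_scalar_mult]
lemmas bounded_linear_vsm_left = bounded_bilinear.bounded_linear_left[OF bounded_bilinear_vector_scalar_mult]

lemma borel_measurable_vsm [measurable]:
  fixes f :: "'a \<Rightarrow> complex" and g :: "'a \<Rightarrow> complex^'n"
  assumes "f \<in> borel_measurable M" "g \<in> borel_measurable M"
  shows "(\<lambda>x. f x *s g x) \<in> borel_measurable M"
  using assms
  by (rule borel_measurable_continuous_Pair)
     (intro bounded_bilinear.continuous_on[OF bounded_bilinear_vector_scalar_mult] continuous_intros)

lemma L2_measurable: "u \<in> L2 \<Longrightarrow> u \<in> borel_measurable half_line"
  by (simp add: L2_def)

lemma L2_integrable: "u \<in> L2 \<Longrightarrow> integrable half_line (\<lambda>x. (norm (u x))\<^sup>2)"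
  by (simp add: L2_def)

lemma L2_I_bound:
  assumes "f \<in> L2" "u \<in> borel_measurable half_line" "AE x in half_line. norm (u x) \<le> C * norm (f x)"
  shows "u \<in> L2"
  unfolding L2_def
proof (intro CollectI conjI)
  show "integrable half_line (\<lambda>x. (norm (u x))\<^sup>2)"
  proof (rule Bochner_Integration.integrable_bound)
    show "integrable half_line (\<lambda>x. C\<^sup>2 * (norm (f x))\<^sup>2)" using L2_integrable[OF assms(1)] by simp
    show "(\<lambda>x. (norm (u x))\<^sup>2) \<in> borel_measurable half_line" using assms(2) by measurable
    show "AE x in half_line. norm ((norm (u x))\<^sup>2) \<le> norm (C\<^sup>2 * (norm (f x))\<^sup>2)"
      using assms(3)
    proof eventually_elim
      case (elim x)
      have "(norm (u x))\<^sup>2 \<le> (C * norm (f x))\<^sup>2" using elim by (intro power_mono) auto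
      thus ?case by (simp add: power_mult_distrib)
    qed
  qed
qed fact

lemma L2_add:
  assumes "u \<in> L2" "v \<in> L2" shows "(\<lambda>x. u x + v x) \<in> L2"
  unfolding L2_def
proof (intro CollectI conjI)
  note [measurable] = L2_measurable[OF assms(1)] L2_measurable[OF assms(2)]
  show "(\<lambda>x. u x + v x) \<in> borel_measurable half_line" by measurable
  show "integrable half_line (\<lambda>x. (norm (u x + v x))\<^sup>2)"
  proof (rule Bochner_Integration.integrable_bound)
    show "integrable half_line (\<lambda>x. 2 * (norm (u x))\<^sup>2 + 2 * (norm (v x))\<^sup>2)"
      using L2_integrable assms by auto
    show "AE x in half_line. norm ((norm (u x + v x))\<^sup>2) \<le> norm (2 * (norm (u x))\<^sup>2 + 2 * (norm (v x))\<^sup>2)"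
    proof (rule AE_I2)
      fix x
      have "(norm (u x + v x))\<^sup>2 \<le> (norm (u x) + norm (v x))\<^sup>2"
        by (intro power_mono norm_triangle_ineq) auto
      also have "\<dots> \<le> 2 * (norm (u x))\<^sup>2 + 2 * (norm (v x))\<^sup>2"
        using zero_le_power2[of "norm (u x) - norm (v x)"] by (simp add: power2_sum power2_diff)
      finally show "norm ((norm (u x + v x))\<^sup>2) \<le> norm (2 * (norm (u x))\<^sup>2 + 2 * (norm (v x))\<^sup>2)" by simp
    qed
  qed measurable
qed

lemma L2_bounded_linear:
  assumes "bounded_linear T" "u \<in> L2" shows "(\<lambda>x. T (u x)) \<in> L2"
proof -
  obtain K where K: "\<And>x. norm (T x) \<le> norm x * K" using bounded_linear.bounded[OF assms(1)] by blast
  show ?thesis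
  proof (rule L2_I_bound[OF assms(2)])
    show "(\<lambda>x. T (u x)) \<in> borel_measurable half_line"
      by (rule measurable_compose[OF L2_measurable[OF assms(2)]
            borel_measurable_continuous_onI[OF bounded_linear.continuous_on[OF assms(1) continuous_on_id]]])
  qed (use K in \<open>auto simp: mult.commute\<close>)
qed

lemma L2_scale: "u \<in> L2 \<Longrightarrow> (\<lambda>x. c *s u x) \<in> L2"
  by (rule L2_bounded_linear[OF bounded_linear_vsm_right])

lemma L2_diff:
  assumes "u \<in> L2" "v \<in> L2" shows "(\<lambda>x. u x - v x) \<in> L2"
proof -
  have "(\<lambda>x. u x - v x) = (\<lambda>x. u x + (-1) *s v x)" by (simp add: fun_eq_iff vec_eq_iff)
  thus ?thesis using L2_add[OF assms(1) L2_scale[OF assms(2), of "-1"]] by (simp only:)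
qed

lemma L2_AE_cong:
  assumes "u \<in> L2" "AE x in half_line. v x = u x" shows "v \<in> L2"
proof (rule L2_I_bound[OF assms(1)])
  show "v \<in> borel_measurable half_line" by (rule measurable_half_line_AE_cong[OF L2_measurable[OF assms(1)] assms(2)])
  show "AE x in half_line. norm (v x) \<le> 1 * norm (u x)" using assms(2) by eventually_elim simp
qed

section \<open>Exponential weights and Schur's test\<close>

lemma integrable_exp_half_line:
  assumes "\<kappa> > 0" shows "integrable half_line (\<lambda>z. exp (- \<kappa> * z))"
proof -
  have "(\<lambda>x. exp (- \<kappa> * x)) absolutely_integrable_on {0..}"
    using integrable_on_exp_minus_to_infinity[OF assms, of 0] by (intro nonnegative_absolutely_integrable_1) auto
  thus ?thesis by (simp add: integrable_half_line_iff set_integrable_def)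
qed

lemma L2_integrable_mult:
  assumes f: "f \<in> L2" and w: "w \<in> borel_measurable half_line" "integrable half_line (\<lambda>z. (w z)\<^sup>2)"
  shows "integrable half_line (\<lambda>z. (w z :: real) * norm (f z))"
proof (rule Bochner_Integration.integrable_bound)
  note [measurable] = L2_measurable[OF f] w(1)
  show "integrable half_line (\<lambda>z. (w z)\<^sup>2 + (norm (f z))\<^sup>2)" using w(2) L2_integrable[OF f] by auto
  show "AE z in half_line. norm (w z * norm (f z)) \<le> norm ((w z)\<^sup>2 + (norm (f z))\<^sup>2)"
  proof (rule AE_I2)
    fix z
    have "\<bar>w z\<bar> * norm (f z) \<le> (w z)\<^sup>2 + (norm (f z))\<^sup>2"
      using sum_squares_bound[of "\<bar>w z\<bar>" "norm (f z)"] mult_nonneg_nonneg[OF abs_ge_zero norm_ge_zero, of "w z" "f z"]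
      unfolding power2_abs by linarith
    thus "norm (w z * norm (f z)) \<le> norm ((w z)\<^sup>2 + (norm (f z))\<^sup>2)" by (simp add: abs_mult)
  qed
  show "(\<lambda>z. w z * norm (f z)) \<in> borel_measurable half_line" by measurable
qed

lemma L2_integrable_exp:
  assumes f: "f \<in> L2" and k: "\<kappa> > 0"
  shows "integrable half_line (\<lambda>z. exp (- \<kappa> * z) * norm (f z))"
proof (rule L2_integrable_mult[OF f])
  show "integrable half_line (\<lambda>z. (exp (- \<kappa> * z))\<^sup>2)"
    using integrable_exp_half_line[of "2 * \<kappa>"] k by (simp add: power2_eq_square exp_add[symmetric] mult_ac)
qed measurable

lemma exp_abs_le:
  fixes y z \<kappa> :: real
  assumes "\<kappa> > 0" "s \<le> y"
  shows "exp (- \<kappa> * \<bar>s - z\<bar>) \<le> exp (\<kappa> * y) * exp (- \<kappa> * z)"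
proof -
  have "\<kappa> * (z - y) \<le> \<kappa> * \<bar>s - z\<bar>" using assms by (intro mult_left_mono) auto
  thus ?thesis by (simp add: exp_add[symmetric] algebra_simps)
qed

lemma L2_integrable_exp_abs:
  assumes f: "f \<in> L2" and k: "\<kappa> > 0"
  shows "integrable half_line (\<lambda>z. exp (- \<kappa> * \<bar>y - z\<bar>) * norm (f z))"
proof (rule Bochner_Integration.integrable_bound)
  note [measurable] = L2_measurable[OF f]
  show "integrable half_line (\<lambda>z. exp (\<kappa> * y) * (exp (- \<kappa> * z) * norm (f z)))"
    using L2_integrable_exp[OF f k] by simp
  show "AE z in half_line. norm (exp (- \<kappa> * \<bar>y - z\<bar>) * norm (f z)) \<le> norm (exp (\<kappa> * y) * (exp (- \<kappa> * z) * norm (f z)))"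
  proof (rule AE_I2)
    fix z
    show "norm (exp (- \<kappa> * \<bar>y - z\<bar>) * norm (f z)) \<le> norm (exp (\<kappa> * y) * (exp (- \<kappa> * z) * norm (f z)))"
      using mult_right_mono[OF exp_abs_le[OF k order_refl, of y z] norm_ge_zero[of "f z"]]
      by (simp add: abs_mult mult.assoc)
  qed
  show "(\<lambda>z. exp (- \<kappa> * \<bar>y - z\<bar>) * norm (f z)) \<in> borel_measurable half_line" by measurable
qed

lemma L2_loc_int: assumes "f \<in> L2" shows "loc_int f"
  unfolding loc_int_def
proof
  fix Y
  note [measurable] = L2_measurable[OF assms]
  show "integrable half_line (\<lambda>x. indicator {..Y} x *\<^sub>R f x)"
  proof (rule Bochner_Integration.integrable_bound)
    show "integrable half_line (\<lambda>z. exp Y * (exp (- 1 * z) * norm (f z)))"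
      using L2_integrable_exp[OF assms, of 1] by simp
    show "AE x in half_line. norm (indicator {..Y} x *\<^sub>R f x) \<le> norm (exp Y * (exp (- 1 * x) * norm (f x)))"
    proof (rule AE_I2)
      fix x
      have "1 * norm (f x) \<le> exp (Y - x) * norm (f x)" if "x \<le> Y" using that by (intro mult_right_mono) auto
      thus "norm (indicator {..Y} x *\<^sub>R f x) \<le> norm (exp Y * (exp (- 1 * x) * norm (f x)))"
        by (auto simp: indicator_def exp_diff exp_minus field_simps)
    qed
  qed measurable
qed

text \<open>\<open>2 / \<kappa>\<close> is the integral over the full line; the cut at
  \<open>0\<close> removes \<open>exp (- \<kappa> * z) / \<kappa>\<close> from it.\<close>

lemma integral_exp_abs:
  fixes z \<kappa> :: real
  assumes k: "\<kappa> > 0" and z: "z \<ge> 0"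
  shows "integrable half_line (\<lambda>y. exp (- \<kappa> * \<bar>y - z\<bar>))"
    and "(LINT y|half_line. exp (- \<kappa> * \<bar>y - z\<bar>)) \<le> 2 / \<kappa>"
proof -
  show i: "integrable half_line (\<lambda>y. exp (- \<kappa> * \<bar>y - z\<bar>))"
  proof (rule Bochner_Integration.integrable_bound)
    show "integrable half_line (\<lambda>y. exp (\<kappa> * z) * exp (- \<kappa> * y))"
      using integrable_exp_half_line[OF k] by simp
    show "AE y in half_line. norm (exp (- \<kappa> * \<bar>y - z\<bar>)) \<le> norm (exp (\<kappa> * z) * exp (- \<kappa> * y))"
    proof (rule AE_I2)
      fix y
      show "norm (exp (- \<kappa> * \<bar>y - z\<bar>)) \<le> norm (exp (\<kappa> * z) * exp (- \<kappa> * y))"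
        using exp_abs_le[OF k order_refl, of z y] by (simp add: abs_minus_commute)
    qed
  qed measurable
  have 1: "((\<lambda>y. exp (- \<kappa> * \<bar>y - z\<bar>)) has_integral (exp 0 / \<kappa> - exp (- \<kappa> * z) / \<kappa>)) {0..z}"
  proof -
    have "((\<lambda>y. exp (\<kappa> * (y - z))) has_integral (exp (\<kappa> * (z - z)) / \<kappa> - exp (\<kappa> * (0 - z)) / \<kappa>)) {0..z}"
      by (rule fundamental_theorem_of_calculus)
         (use k z in \<open>auto intro!: derivative_eq_intros simp: has_real_derivative_iff_has_vector_derivative[symmetric]\<close>)
    hence "((\<lambda>y. exp (\<kappa> * (y - z))) has_integral (exp 0 / \<kappa> - exp (- \<kappa> * z) / \<kappa>)) {0..z}" by simp
    thus ?thesis by (rule has_integral_eq[rotated]) (auto simp: algebra_simps)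
  qed
  have 2: "((\<lambda>y. exp (- \<kappa> * \<bar>y - z\<bar>)) has_integral (exp (\<kappa> * z) * (exp (- \<kappa> * z) / \<kappa>))) {z..}"
  proof -
    have "((\<lambda>y. exp (\<kappa> * z) * exp (- \<kappa> * y)) has_integral (exp (\<kappa> * z) * (exp (- \<kappa> * z) / \<kappa>))) {z..}"
      by (rule has_integral_mult_right[OF has_integral_exp_minus_to_infinity[OF k]])
    thus ?thesis by (rule has_integral_eq[rotated]) (auto simp: exp_add[symmetric] algebra_simps)
  qed
  have "{0..z} \<inter> {z..} = {z}" using z by auto
  hence "((\<lambda>y. exp (- \<kappa> * \<bar>y - z\<bar>)) has_integral
     ((exp 0 / \<kappa> - exp (- \<kappa> * z) / \<kappa>) + exp (\<kappa> * z) * (exp (- \<kappa> * z) / \<kappa>))) ({0..z} \<union> {z..})"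
    by (intro has_integral_Un[OF 1 2]) simp
  also have "{0..z} \<union> {z..} = {0..}" using z by auto
  finally have "integral {0..} (\<lambda>y. exp (- \<kappa> * \<bar>y - z\<bar>)) = (exp 0 / \<kappa> - exp (- \<kappa> * z) / \<kappa>) + exp (\<kappa> * z) * (exp (- \<kappa> * z) / \<kappa>)"
    by (rule integral_unique)
  also have "\<dots> = 2 / \<kappa> - exp (- \<kappa> * z) / \<kappa>" using k by (simp add: exp_minus field_simps)
  also have "\<dots> \<le> 2 / \<kappa>" using k by simp
  finally show "(LINT y|half_line. exp (- \<kappa> * \<bar>y - z\<bar>)) \<le> 2 / \<kappa>"
    using lebesgue_integral_eq_integral[OF i] by simp
qed

text \<open>\<open>K\<close> bounds the total weight. Expanding the nonnegative integral of
  \<open>w * (K * g - I)\<^sup>2\<close>, where \<open>I\<close> is the integral of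
  \<open>w * g\<close>, gives the estimate.\<close>

lemma weighted_Cauchy_Schwarz:
  fixes w g :: "'a \<Rightarrow> real"
  assumes w: "integrable M w" "(LINT z|M. w z) \<le> K" "\<And>z. 0 \<le> w z" and K: "K > 0"
    and g: "integrable M (\<lambda>z. w z * g z)" "integrable M (\<lambda>z. w z * (g z)\<^sup>2)"
  shows "(LINT z|M. w z * g z)\<^sup>2 \<le> K * (LINT z|M. w z * (g z)\<^sup>2)"
proof -
  define I where "I = (LINT z|M. w z * g z)"
  define Q where "Q = (LINT z|M. w z * (g z)\<^sup>2)"
  have "0 \<le> (LINT z|M. w z * (K * g z - I)\<^sup>2)"
    by (rule Bochner_Integration.integral_nonneg) (use w(3) in simp)
  also have "\<dots> = (LINT z|M. K\<^sup>2 * (w z * (g z)\<^sup>2) - (2 * K * I) * (w z * g z) + I\<^sup>2 * w z)"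
    by (intro Bochner_Integration.integral_cong) (auto simp: power2_eq_square algebra_simps)
  also have "\<dots> = K\<^sup>2 * Q - (2 * K * I) * I + I\<^sup>2 * (LINT z|M. w z)"
    using w(1) g by (simp add: I_def Q_def)
  also have "\<dots> \<le> K\<^sup>2 * Q - (2 * K * I) * I + I\<^sup>2 * K"
    using w(2) by (intro add_left_mono mult_left_mono) auto
  also have "\<dots> = K * (K * Q - I\<^sup>2)" by (simp add: power2_eq_square algebra_simps)
  finally show ?thesis using K by (simp add: I_def Q_def zero_le_mult_iff)
qed

text \<open>The weight \<open>exp (- \<kappa> * |y - z|)\<close> has integral at most
  \<open>2 / \<kappa>\<close> in either variable. One bound enters through weighted Cauchy-Schwarz
  in \<open>z\<close>, the other through Fubini when the square is integrated over \<open>y\<close>;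
  their product is the square of \<open>2 / \<kappa>\<close>.\<close>

lemma Schur_test:
  assumes f: "f \<in> L2" and k: "\<kappa> > 0" and C: "C \<ge> 0" and u: "u \<in> borel_measurable half_line"
    and bound: "\<And>y. y \<ge> 0 \<Longrightarrow> norm (u y) \<le> C * (LINT z|half_line. exp (- \<kappa> * \<bar>y - z\<bar>) * norm (f z))"
  shows "u \<in> L2" and "l2norm u \<le> C * (2 / \<kappa>) * l2norm f"
proof -
  define K where "K = 2 / \<kappa>"
  have K: "K > 0" using k by (simp add: K_def)
  note [measurable] = L2_measurable[OF f] u
  note fi = L2_integrable[OF f]
  let ?F = "\<lambda>z y. exp (- \<kappa> * \<bar>y - z\<bar>) * (norm (f z))\<^sup>2"
  have int: "integrable half_line (\<lambda>y. exp (- \<kappa> * \<bar>y - z\<bar>))" if "z \<ge> 0" for z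
    using integral_exp_abs(1)[OF k that] .
  have Fm: "(\<lambda>p. ?F (fst p) (snd p)) \<in> borel_measurable (half_line \<Otimes>\<^sub>M half_line)" by measurable
  have Em: "(\<lambda>z. LINT y|half_line. exp (- \<kappa> * \<bar>y - z\<bar>)) \<in> borel_measurable half_line"
    by (rule sigma_finite_measure.borel_measurable_lebesgue_integral[OF sigma_finite_half_line]) measurable
  have Ei: "integrable half_line (\<lambda>z. (LINT y|half_line. exp (- \<kappa> * \<bar>y - z\<bar>)) * (norm (f z))\<^sup>2)"
  proof (rule Bochner_Integration.integrable_bound)
    show "integrable half_line (\<lambda>z. K * (norm (f z))\<^sup>2)" using fi by simp
    show "AE z in half_line. norm ((LINT y|half_line. exp (- \<kappa> * \<bar>y - z\<bar>)) * (norm (f z))\<^sup>2) \<le> norm (K * (norm (f z))\<^sup>2)"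
    proof (rule AE_I2)
      fix z assume "z \<in> space half_line"
      hence z: "z \<ge> 0" by simp
      have "0 \<le> (LINT y|half_line. exp (- \<kappa> * \<bar>y - z\<bar>))" by (rule Bochner_Integration.integral_nonneg) simp
      thus "norm ((LINT y|half_line. exp (- \<kappa> * \<bar>y - z\<bar>)) * (norm (f z))\<^sup>2) \<le> norm (K * (norm (f z))\<^sup>2)"
        using mult_right_mono[OF integral_exp_abs(2)[OF k z] zero_le_power2[of "norm (f z)"]] K
        unfolding K_def[symmetric] by (simp add: abs_mult)
    qed
  qed (use Em in measurable)
  have Fi: "integrable (half_line \<Otimes>\<^sub>M half_line) (\<lambda>p. ?F (fst p) (snd p))"
  proof (rule half_pair.Fubini_integrable[OF Fm])
    show "integrable half_line (\<lambda>x. LINT y|half_line. norm (?F (fst (x, y)) (snd (x, y))))"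
      using Ei by (simp add: abs_mult)
    show "AE x in half_line. integrable half_line (\<lambda>y. ?F (fst (x, y)) (snd (x, y)))"
    proof (rule AE_I2)
      fix x assume "x \<in> space half_line"
      thus "integrable half_line (\<lambda>y. ?F (fst (x, y)) (snd (x, y)))" using int[of x] by simp
    qed
  qed
  hence Fi': "integrable (half_line \<Otimes>\<^sub>M half_line) (case_prod ?F)" by (simp add: case_prod_beta')
  have Pi: "integrable half_line (\<lambda>y. LINT z|half_line. ?F z y)"
    by (rule half_pair.integrable_snd[OF Fi'])
  have Pb: "(LINT y|half_line. LINT z|half_line. ?F z y) \<le> K * (LINT z|half_line. (norm (f z))\<^sup>2)"
  proof -
    have "(LINT y|half_line. LINT z|half_line. ?F z y) = (LINT z|half_line. LINT y|half_line. ?F z y)"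
      by (rule half_pair.Fubini_integral[OF Fi'])
    also have "\<dots> = (LINT z|half_line. (LINT y|half_line. exp (- \<kappa> * \<bar>y - z\<bar>)) * (norm (f z))\<^sup>2)" by simp
    also have "\<dots> \<le> (LINT z|half_line. K * (norm (f z))\<^sup>2)"
    proof (rule integral_mono[OF Ei])
      fix z assume "z \<in> space half_line"
      thus "(LINT y|half_line. exp (- \<kappa> * \<bar>y - z\<bar>)) * (norm (f z))\<^sup>2 \<le> K * (norm (f z))\<^sup>2"
        unfolding K_def by (intro mult_right_mono integral_exp_abs(2)[OF k]) auto
    qed (use fi in simp)
    finally show ?thesis by simp
  qed
  have sqb: "(norm (u y))\<^sup>2 \<le> C\<^sup>2 * (K * (LINT z|half_line. ?F z y))" if ae: "integrable half_line (\<lambda>z. ?F z y)" and y: "y \<ge> 0" for y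
  proof -
    let ?S = "LINT z|half_line. exp (- \<kappa> * \<bar>y - z\<bar>) * norm (f z)"
    have "(norm (u y))\<^sup>2 \<le> (C * ?S)\<^sup>2" using bound[OF y] by (intro power_mono) auto
    also have "\<dots> = C\<^sup>2 * ?S\<^sup>2" by (simp add: power_mult_distrib)
    also have "?S\<^sup>2 \<le> K * (LINT z|half_line. ?F z y)"
    proof (rule weighted_Cauchy_Schwarz[OF _ _ _ K _ ae])
      show "integrable half_line (\<lambda>z. exp (- \<kappa> * \<bar>y - z\<bar>))"
        using int[OF y] by (simp add: abs_minus_commute)
      show "(LINT z|half_line. exp (- \<kappa> * \<bar>y - z\<bar>)) \<le> K"
        using integral_exp_abs(2)[OF k y] by (simp add: abs_minus_commute K_def)
      show "integrable half_line (\<lambda>z. exp (- \<kappa> * \<bar>y - z\<bar>) * norm (f z))"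
        by (rule L2_integrable_exp_abs[OF f k])
    qed auto
    finally show ?thesis by (simp add: mult_left_mono)
  qed
  have ae: "AE y in half_line. integrable half_line (\<lambda>z. ?F z y)"
  proof -
    have "AE y in half_line. integrable half_line (\<lambda>z. (\<lambda>(y, z). ?F z y) (y, z))"
      using half_pair.AE_integrable_snd[OF Fi'] by simp
    thus ?thesis by simp
  qed
  have AE: "AE y in half_line. (norm (u y))\<^sup>2 \<le> C\<^sup>2 * (K * (LINT z|half_line. ?F z y))"
    using ae AE_space by eventually_elim (use sqb in auto)
  have Pi': "integrable half_line (\<lambda>y. C\<^sup>2 * (K * (LINT z|half_line. ?F z y)))" using Pi by simp
  have ui: "integrable half_line (\<lambda>y. (norm (u y))\<^sup>2)"
    by (rule Bochner_Integration.integrable_bound[OF Pi'], measurable) (use AE in eventually_elim, auto)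
  thus "u \<in> L2" using u by (simp add: L2_def)
  have "(LINT y|half_line. (norm (u y))\<^sup>2) \<le> (LINT y|half_line. C\<^sup>2 * (K * (LINT z|half_line. ?F z y)))"
    by (rule integral_mono_AE[OF ui Pi' AE])
  also have "\<dots> = C\<^sup>2 * (K * (LINT y|half_line. LINT z|half_line. ?F z y))" by simp
  also have "\<dots> \<le> C\<^sup>2 * (K * (K * (LINT z|half_line. (norm (f z))\<^sup>2)))"
    using Pb K by (intro mult_left_mono) auto
  finally have "(LINT y|half_line. (norm (u y))\<^sup>2) \<le> (C * K)\<^sup>2 * (LINT z|half_line. (norm (f z))\<^sup>2)"
    by (simp add: power2_eq_square algebra_simps)
  hence "l2norm u \<le> sqrt ((C * K)\<^sup>2 * (LINT z|half_line. (norm (f z))\<^sup>2))"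
    unfolding l2norm_def by (rule real_sqrt_le_mono)
  also have "\<dots> = C * K * l2norm f" using C K by (simp add: l2norm_def real_sqrt_mult)
  finally show "l2norm u \<le> C * (2 / \<kappa>) * l2norm f" by (simp add: K_def)
qed

section \<open>The resolvent kernel\<close>

lemma continuous_AE_eq:
  fixes f g :: "real \<Rightarrow> 'a::euclidean_space"
  assumes f: "continuous_on {0..} f" and g: "continuous_on {0..} g"
    and ae: "AE x in half_line. f x = g x" and x: "x \<ge> 0"
  shows "f x = g x"
proof (rule ccontr)
  assume ne: "f x \<noteq> g x"
  have "continuous_on {0..} (\<lambda>y. norm (f y - g y))" by (intro continuous_intros f g)
  moreover have "norm (f x - g x) > 0" using ne by simp
  ultimately obtain \<delta> where \<delta>: "\<delta> > 0" "\<And>y. y \<ge> 0 \<Longrightarrow> \<bar>y - x\<bar> < \<delta> \<Longrightarrow> \<bar>norm (f y - g y) - norm (f x - g x)\<bar> < norm (f x - g x)"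
    using x unfolding continuous_on_iff dist_real_def by (metis atLeast_iff)
  \<comment> \<open>The interval lies to the right of \<open>x\<close>, so it stays in the half line
    even for \<open>x = 0\<close>; it has positive measure.\<close>
  have ne': "f y \<noteq> g y" if "y \<in> {x<..<x+\<delta>}" for y
    using \<delta>(2)[of y] that x by force
  have "AE y in lebesgue. indicator {x<..<x+\<delta>} y = (0::real)"
    using ae unfolding AE_half_line_iff
    by eventually_elim (use ne' x in \<open>force simp: indicator_def\<close>)
  hence "(LINT y|lebesgue. indicator {x<..<x+\<delta>} y) = (0::real)" by (rule integral_eq_zero_AE)
  thus False using \<delta>(1) by simp
qed

lemma trace0_eq:
  assumes "continuous_on {0..} w" "AE x in half_line. w x = u x"
  shows "trace0 u = w 0"
  unfolding trace0_def
proof (rule the_equality)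
  show "\<exists>w'. continuous_on {0..} w' \<and> (AE x in half_line. w' x = u x) \<and> w' 0 = w 0"
    using assms by blast
  fix c assume "\<exists>w'. continuous_on {0..} w' \<and> (AE x in half_line. w' x = u x) \<and> w' 0 = c"
  then obtain w' where w': "continuous_on {0..} w'" "AE x in half_line. w' x = u x" "w' 0 = c" by blast
  have "AE x in half_line. w' x = w x" using w'(2) assms(2) by eventually_elim simp
  from continuous_AE_eq[OF w'(1) assms(1) this, of 0] w'(3) show "c = w 0" by simp
qed

text \<open>Uniqueness of weak derivatives up to null sets makes the choice in \<open>wderiv\<close>
  harmless, but it also means that only almost everywhere equality can be expected.\<close>

lemma wderiv_eq:
  assumes "v \<in> L2" "has_weak_deriv u v"
  shows "wderiv u \<in> L2" "has_weak_deriv u (wderiv u)" "AE x in half_line. wderiv u x = v x"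
proof -
  have *: "wderiv u \<in> L2 \<and> has_weak_deriv u (wderiv u)"
    unfolding wderiv_def by (rule someI[of _ v]) (use assms in auto)
  thus "wderiv u \<in> L2" "has_weak_deriv u (wderiv u)" by auto
  show "AE x in half_line. wderiv u x = v x"
    by (rule has_weak_deriv_unique[OF L2_loc_int L2_loc_int]) (use * assms in auto)
qed

section \<open>Integral operators with exponentially decaying kernels\<close>

lemma integral_kernel_measurable:
  fixes k :: "real \<Rightarrow> real \<Rightarrow> complex" and f :: "real \<Rightarrow> complex^2"
  assumes "(\<lambda>p. k (fst p) (snd p)) \<in> borel_measurable (half_line \<Otimes>\<^sub>M half_line)"
    and f: "f \<in> L2"
  shows "(\<lambda>y. LINT z|half_line. k y z *s f z) \<in> borel_measurable half_line"
proof (rule sigma_finite_measure.borel_measurable_lebesgue_integral[OF sigma_finite_half_line])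
  note [measurable] = L2_measurable[OF f] assms(1)
  have "(\<lambda>p. k (fst p) (snd p) *s f (snd p)) \<in> borel_measurable (half_line \<Otimes>\<^sub>M half_line)" by measurable
  thus "(\<lambda>(y, z). k y z *s f z) \<in> borel_measurable (half_line \<Otimes>\<^sub>M half_line)" by (simp add: case_prod_beta')
qed

lemma kernel_section_measurable:
  fixes k :: "real \<Rightarrow> real \<Rightarrow> complex"
  assumes "(\<lambda>p. k (fst p) (snd p)) \<in> borel_measurable (half_line \<Otimes>\<^sub>M half_line)" "y \<ge> 0"
  shows "k y \<in> borel_measurable half_line" "(\<lambda>x. k x y) \<in> borel_measurable half_line"
proof -
  have "Pair y \<in> half_line \<rightarrow>\<^sub>M half_line \<Otimes>\<^sub>M half_line" using assms(2) by (intro measurable_Pair1') auto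
  from measurable_compose[OF this assms(1)] show "k y \<in> borel_measurable half_line" by simp
  have "(\<lambda>x. (x, y)) \<in> half_line \<rightarrow>\<^sub>M half_line \<Otimes>\<^sub>M half_line" using assms(2) by (intro measurable_Pair2') auto
  from measurable_compose[OF this assms(1)] show "(\<lambda>x. k x y) \<in> borel_measurable half_line" by simp
qed

lemma kernel_integrable:
  fixes k :: "real \<Rightarrow> real \<Rightarrow> complex" and f :: "real \<Rightarrow> complex^2"
  assumes m: "(\<lambda>p. k (fst p) (snd p)) \<in> borel_measurable (half_line \<Otimes>\<^sub>M half_line)"
    and b: "\<And>y z. y \<ge> 0 \<Longrightarrow> z \<ge> 0 \<Longrightarrow> cmod (k y z) \<le> C * exp (- \<kappa> * \<bar>y - z\<bar>)"
    and k: "\<kappa> > 0" and f: "f \<in> L2" and y: "y \<ge> 0"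
  shows "integrable half_line (\<lambda>z. k y z *s f z)"
    "norm (LINT z|half_line. k y z *s f z) \<le> C * (LINT z|half_line. exp (- \<kappa> * \<bar>y - z\<bar>) * norm (f z))"
proof -
  note [measurable] = L2_measurable[OF f] kernel_section_measurable[OF m y]
  have i: "integrable half_line (\<lambda>z. C * (exp (- \<kappa> * \<bar>y - z\<bar>) * norm (f z)))"
    using L2_integrable_exp_abs[OF f k] by simp
  have le: "norm (k y z *s f z) \<le> C * (exp (- \<kappa> * \<bar>y - z\<bar>) * norm (f z))" if "z \<ge> 0" for z
    using mult_right_mono[OF b[OF y that] norm_ge_zero[of "f z"]] by (simp add: norm_vector_scalar_mult mult.assoc)
  show 1: "integrable half_line (\<lambda>z. k y z *s f z)"
  proof (rule Bochner_Integration.integrable_bound[OF i])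
    show "AE z in half_line. norm (k y z *s f z) \<le> norm (C * (exp (- \<kappa> * \<bar>y - z\<bar>) * norm (f z)))"
      by (rule AE_I2) (use le in \<open>force intro: order_trans[OF _ abs_ge_self]\<close>)
    show "(\<lambda>z. k y z *s f z) \<in> borel_measurable half_line" by measurable
  qed
  have "norm (LINT z|half_line. k y z *s f z) \<le> (LINT z|half_line. norm (k y z *s f z))"
    by (rule integral_norm_bound)
  also have "\<dots> \<le> (LINT z|half_line. C * (exp (- \<kappa> * \<bar>y - z\<bar>) * norm (f z)))"
    using 1 i le by (intro integral_mono) auto
  finally show "norm (LINT z|half_line. k y z *s f z) \<le> C * (LINT z|half_line. exp (- \<kappa> * \<bar>y - z\<bar>) * norm (f z))"
    by simp
qed

text \<open>Fubini moves the integration over the first variable onto the kernel. Weak derivatives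
  of integral operators can thus be verified by integrating, without differentiating under the
  integral sign. The domination uses that \<open>s \<le> y\<close> is bounded.\<close>

lemma prim_kernel:
  fixes k :: "real \<Rightarrow> real \<Rightarrow> complex" and f :: "real \<Rightarrow> complex^2"
  assumes m: "(\<lambda>p. k (fst p) (snd p)) \<in> borel_measurable (half_line \<Otimes>\<^sub>M half_line)"
    and b: "\<And>y z. y \<ge> 0 \<Longrightarrow> z \<ge> 0 \<Longrightarrow> cmod (k y z) \<le> C * exp (- \<kappa> * \<bar>y - z\<bar>)"
    and k: "\<kappa> > 0" and C: "C \<ge> 0" and f: "f \<in> L2"
    and K: "\<And>z. z > 0 \<Longrightarrow> ((\<lambda>s. k s z) has_integral K z) {0..y}"
  shows "prim (\<lambda>s. LINT z|half_line. k s z *s f z) y = (LINT z|half_line. K z *s f z)"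
proof -
  note m [measurable] and L2_measurable[OF f, measurable]
  let ?F = "\<lambda>s z. (indicator {..y} s *\<^sub>R k s z) *s f z"
  have "prim (\<lambda>s. LINT z|half_line. k s z *s f z) y = (LINT s|half_line. LINT z|half_line. ?F s z)"
    unfolding prim_def
  proof (rule Bochner_Integration.integral_cong[OF refl])
    fix s
    show "indicator {..y} s *\<^sub>R (LINT z|half_line. k s z *s f z) = (LINT z|half_line. ?F s z)"
      by (cases "s \<le> y") auto
  qed
  also have "\<dots> = (LINT z|half_line. LINT s|half_line. ?F s z)"
  proof (rule half_pair.Fubini_product_bound)
    show "(\<lambda>p. ?F (fst p) (snd p)) \<in> borel_measurable (half_line \<Otimes>\<^sub>M half_line)" by measurable
    have i1: "integrable half_line (indicator {..y} :: real \<Rightarrow> real)"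
      using loc_intD[OF loc_int_continuous[of "\<lambda>_. 1::real"], of y] by simp
    show "integrable half_line (\<lambda>s. C * (exp (\<kappa> * y) * indicator {..y} s))"
      using i1 by (intro integrable_mult_right)
    show "integrable half_line (\<lambda>z. exp (- \<kappa> * z) * norm (f z))"
      by (rule L2_integrable_exp[OF f k])
    fix s z :: real assume "s \<in> space half_line" "z \<in> space half_line"
    hence sz: "s \<ge> 0" "z \<ge> 0" by auto
    show "norm (?F s z) \<le> C * (exp (\<kappa> * y) * indicator {..y} s) * (exp (- \<kappa> * z) * norm (f z))"
    proof (cases "s \<le> y")
      case True
      have "cmod (k s z) \<le> C * (exp (\<kappa> * y) * exp (- \<kappa> * z))"
        using b[OF sz] mult_left_mono[OF exp_abs_le[OF k True, of z] C] by linarith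
      from mult_right_mono[OF this norm_ge_zero[of "f z"]] show ?thesis
        using True by (simp add: norm_vector_scalar_mult mult_ac)
    qed (simp add: norm_vector_scalar_mult)
  qed
  also have "\<dots> = (LINT z|half_line. K z *s f z)"
  proof (rule integral_cong_AE)
    have eq: "(LINT s|half_line. ?F s z) = K z *s f z" if z: "z > 0" for z
    proof -
      have km: "(\<lambda>s. k s z) \<in> borel_measurable half_line"
        using kernel_section_measurable(2)[OF m, of z] z by simp
      note km [measurable]
      have li: "integrable half_line (\<lambda>s. indicator {..Y} s *\<^sub>R k s z)" for Y
      proof (rule Bochner_Integration.integrable_bound)
        have i1: "integrable half_line (indicator {..Y} :: real \<Rightarrow> real)"
          using loc_intD[OF loc_int_continuous[of "\<lambda>_. 1::real"], of Y] by simp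
        thus "integrable half_line (\<lambda>s. C * indicator {..Y} s)" by (intro integrable_mult_right)
        show "AE s in half_line. norm (indicator {..Y} s *\<^sub>R k s z) \<le> norm (C * indicator {..Y} s)"
        proof (rule AE_I2)
          fix s assume "s \<in> space half_line"
          hence "cmod (k s z) \<le> C * exp (- \<kappa> * \<bar>s - z\<bar>)" using b[of s z] z by simp
          also have "\<dots> \<le> C * 1" using C k by (intro mult_left_mono) auto
          finally show "norm (indicator {..Y} s *\<^sub>R k s z) \<le> norm (C * indicator {..Y} s)"
            using C by (auto simp: indicator_def)
        qed
        show "(\<lambda>s. indicator {..Y} s *\<^sub>R k s z) \<in> borel_measurable half_line" by measurable
      qed
      have "(LINT s|half_line. indicator {..y} s *\<^sub>R k s z) = prim (\<lambda>s. k s z) y" by (simp add: prim_def)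
      also have "\<dots> = integral {0..y} (\<lambda>s. k s z)"
        unfolding prim_eq
      proof (rule lebesgue_integral_eq_integral)
        have "loc_int (\<lambda>s. k s z)" using li by (simp add: loc_int_def)
        thus "integrable (lebesgue_on {0..y}) (\<lambda>s. k s z)" by (simp add: loc_int_iff)
      qed auto
      also have "\<dots> = K z" using K[OF z] by (rule integral_unique)
      finally have "(LINT s|half_line. indicator {..y} s *\<^sub>R k s z) = K z" .
      thus ?thesis using Bochner_Integration.integral_bounded_linear[OF bounded_linear_vsm_left li[of y], of "f z"] by simp
    qed
    show ae: "AE z in half_line. (LINT s|half_line. ?F s z) = K z *s f z"
      using AE_half_line_pos by eventually_elim (rule eq)
    have ms [measurable]: "(\<lambda>p. k (snd p) (fst p)) \<in> borel_measurable (half_line \<Otimes>\<^sub>M half_line)"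
      using measurable_compose[OF measurable_pair_swap'[of half_line half_line] m] by (simp add: case_prod_beta')
    have "(\<lambda>p. ?F (snd p) (fst p)) \<in> borel_measurable (half_line \<Otimes>\<^sub>M half_line)"
      by measurable
    hence "(\<lambda>(z, s). ?F s z) \<in> borel_measurable (half_line \<Otimes>\<^sub>M half_line)" by (simp add: case_prod_beta')
    from sigma_finite_measure.borel_measurable_lebesgue_integral[OF sigma_finite_half_line this]
    show meas: "(\<lambda>z. LINT s|half_line. ?F s z) \<in> borel_measurable half_line" .
    show "(\<lambda>z. K z *s f z) \<in> borel_measurable half_line"
      by (rule measurable_half_line_AE_cong[OF meas]) (use ae in eventually_elim, simp)
  qed
  finally show ?thesis .
qed

section \<open>Exponential kernels and the differential equation\<close>

lemma has_vector_derivative_exp_scale: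
  fixes c :: complex
  shows "((\<lambda>x::real. exp (c * of_real x)) has_vector_derivative c * exp (c * of_real x)) (at x within S)"
proof -
  have "((\<lambda>z. exp (c * z)) has_field_derivative c * exp (c * of_real x)) (at (of_real x))"
    by (auto intro!: derivative_eq_intros)
  from has_vector_derivative_real_field[OF this] show ?thesis .
qed

definition exp_ker :: "complex \<Rightarrow> real \<Rightarrow> real \<Rightarrow> complex"
  where "exp_ker m y z = exp (- m * of_real \<bar>y - z\<bar>)"

text \<open>The derivative of \<open>exp_ker\<close> in its first variable off the diagonal; on the
  diagonal \<open>sgn 0 = 0\<close> makes it zero.\<close>

definition exp_ker' :: "complex \<Rightarrow> real \<Rightarrow> real \<Rightarrow> complex"
  where "exp_ker' m y z = - m * of_real (sgn (y - z)) * exp_ker m y z"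

definition refl_ker :: "complex \<Rightarrow> real \<Rightarrow> real \<Rightarrow> complex"
  where "refl_ker m y z = exp (- m * of_real (y + z))"

lemma exp_ker_le: "s \<le> z \<Longrightarrow> exp_ker m s z = exp (- m * of_real z) * exp (m * of_real s)"
  unfolding exp_ker_def exp_add[symmetric] by (simp add: algebra_simps)

lemma exp_ker_ge: "z \<le> s \<Longrightarrow> exp_ker m s z = exp (m * of_real z) * exp (- m * of_real s)"
  unfolding exp_ker_def exp_add[symmetric] by (simp add: algebra_simps)

lemma refl_ker_eq: "refl_ker m s z = exp (- m * of_real z) * exp (- m * of_real s)"
  unfolding refl_ker_def exp_add[symmetric] by (simp add: algebra_simps)

lemma ker_measurable [measurable]:
  "(\<lambda>p. exp_ker m (fst p) (snd p)) \<in> borel_measurable (half_line \<Otimes>\<^sub>M half_line)"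
  "(\<lambda>p. exp_ker' m (fst p) (snd p)) \<in> borel_measurable (half_line \<Otimes>\<^sub>M half_line)"
  "(\<lambda>p. refl_ker m (fst p) (snd p)) \<in> borel_measurable (half_line \<Otimes>\<^sub>M half_line)"
  unfolding exp_ker'_def exp_ker_def refl_ker_def by measurable

lemma exp_ker_bound: "cmod (exp_ker m y z) \<le> 1 * exp (- Re m * \<bar>y - z\<bar>)"
  by (simp add: exp_ker_def)

lemma exp_ker'_bound: "cmod (exp_ker' m y z) \<le> cmod m * exp (- Re m * \<bar>y - z\<bar>)"
  by (simp add: exp_ker'_def exp_ker_def norm_mult sgn_real_def mult_nonneg_nonneg)

lemma refl_ker_bound:
  assumes "Re m > 0" "y \<ge> 0" "z \<ge> 0"
  shows "cmod (refl_ker m y z) \<le> 1 * exp (- Re m * \<bar>y - z\<bar>)"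
  using assms by (simp add: refl_ker_def mult_left_mono)

lemma exp_ker'_integral:
  assumes "y \<ge> 0"
  shows "((\<lambda>s. exp_ker' m s z) has_integral exp_ker m y z - exp_ker m 0 z) {0..y}"
proof (rule fundamental_theorem_of_calculus_interior_strong[where S="{z}"])
  show "continuous_on {0..y} (\<lambda>s. exp_ker m s z)" unfolding exp_ker_def by (intro continuous_intros)
  fix s assume s: "s \<in> {0<..<y} - {z}"
  show "((\<lambda>s. exp_ker m s z) has_vector_derivative exp_ker' m s z) (at s)"
  proof (cases "s < z")
    case True
    have d: "((\<lambda>s. exp (- m * of_real z) * exp (m * of_real s)) has_vector_derivative exp (- m * of_real z) * (m * exp (m * of_real s))) (at s)"
      by (intro has_vector_derivative_mult_right has_vector_derivative_exp_scale)
    have e: "exp (- m * of_real z) * (m * exp (m * of_real s)) = exp_ker' m s z"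
      using True by (simp add: exp_ker'_def exp_ker_le)
    show ?thesis
      by (rule has_vector_derivative_transform_within_open[OF d[unfolded e], of "{..<z}"])
         (use True in \<open>auto simp: exp_ker_le\<close>)
  next
    case False
    hence sz: "z < s" using s by auto
    have d: "((\<lambda>s. exp (m * of_real z) * exp (- m * of_real s)) has_vector_derivative exp (m * of_real z) * (- m * exp (- m * of_real s))) (at s)"
      by (intro has_vector_derivative_mult_right has_vector_derivative_exp_scale)
    have e: "exp (m * of_real z) * (- m * exp (- m * of_real s)) = exp_ker' m s z"
      using sz by (simp add: exp_ker'_def exp_ker_ge)
    show ?thesis
      by (rule has_vector_derivative_transform_within_open[OF d[unfolded e], of "{z<..}"])
         (use sz in \<open>auto simp: exp_ker_ge\<close>)
  qed
qed (use assms in auto)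

text \<open>\<open>exp_ker'\<close> drops by \<open>2 * m\<close> across the diagonal. Integrating
  the smooth part of the second derivative therefore gives the increment of \<open>exp_ker'\<close>
  plus that jump, which later becomes the source term.\<close>

lemma exp_ker_integral:
  assumes y: "y \<ge> 0" and z: "z > 0"
  shows "((\<lambda>s. m\<^sup>2 * exp_ker m s z) has_integral
    (if z < y then 2 * m else if z = y then m else 0) + exp_ker' m y z - exp_ker' m 0 z) {0..y}"
proof -
  \<comment> \<open>\<open>F\<close> is \<open>exp_ker'\<close> off the diagonal, raised by
    \<open>2 * m\<close> to the right of \<open>z\<close>. Both branches have the value
    \<open>m\<close> at \<open>z\<close>, so \<open>F\<close> is a continuous
    antiderivative.\<close>
  define F where "F s = (if s \<le> z then m * exp_ker m s z else 2 * m - m * exp_ker m s z)" for s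
  have "((\<lambda>s. m\<^sup>2 * exp_ker m s z) has_integral F y - F 0) {0..y}"
  proof (rule fundamental_theorem_of_calculus_interior_strong[where S="{z}"])
    have "continuous_on ({..z} \<union> {z..}) F" unfolding F_def
      by (rule continuous_on_If) (auto intro!: continuous_intros simp: exp_ker_def)
    moreover have "{..z} \<union> {z..} = UNIV" by auto
    ultimately show "continuous_on {0..y} F" using continuous_on_subset by (metis subset_UNIV)
    fix s assume s: "s \<in> {0<..<y} - {z}"
    show "(F has_vector_derivative m\<^sup>2 * exp_ker m s z) (at s)"
    proof (cases "s < z")
      case True
      have d: "((\<lambda>s. m * exp (- m * of_real z) * exp (m * of_real s)) has_vector_derivative m * exp (- m * of_real z) * (m * exp (m * of_real s))) (at s)"
        by (intro has_vector_derivative_mult_right has_vector_derivative_exp_scale)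
      have e: "m * exp (- m * of_real z) * (m * exp (m * of_real s)) = m\<^sup>2 * exp_ker m s z"
        using True by (simp add: exp_ker_le power2_eq_square)
      show ?thesis
        by (rule has_vector_derivative_transform_within_open[OF d[unfolded e], of "{..<z}"])
           (use True in \<open>auto simp: F_def exp_ker_le\<close>)
    next
      case False
      hence sz: "z < s" using s by auto
      have d: "((\<lambda>s. 2 * m - m * exp (m * of_real z) * exp (- m * of_real s)) has_vector_derivative 0 - m * exp (m * of_real z) * (- m * exp (- m * of_real s))) (at s)"
        by (intro has_vector_derivative_mult_right has_vector_derivative_exp_scale has_vector_derivative_diff has_vector_derivative_const)
      have e: "0 - m * exp (m * of_real z) * (- m * exp (- m * of_real s)) = m\<^sup>2 * exp_ker m s z"
        using sz by (simp add: exp_ker_ge power2_eq_square)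
      show ?thesis
        by (rule has_vector_derivative_transform_within_open[OF d[unfolded e], of "{z<..}"])
           (use sz in \<open>auto simp: F_def exp_ker_ge\<close>)
    qed
  qed (use y in auto)
  moreover have "F y - F 0 = (if z < y then 2 * m else if z = y then m else 0) + exp_ker' m y z - exp_ker' m 0 z"
    using z by (auto simp: F_def exp_ker_def exp_ker'_def)
  ultimately show ?thesis by simp
qed

lemma refl_ker_integral:
  assumes "y \<ge> 0"
  shows "((\<lambda>s. - m * refl_ker m s z) has_integral refl_ker m y z - refl_ker m 0 z) {0..y}"
proof (rule fundamental_theorem_of_calculus[OF assms])
  fix s
  have "((\<lambda>s. exp (- m * of_real z) * exp (- m * of_real s)) has_vector_derivative exp (- m * of_real z) * (- m * exp (- m * of_real s))) (at s within {0..y})"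
    by (intro has_vector_derivative_mult_right has_vector_derivative_exp_scale)
  thus "((\<lambda>s. refl_ker m s z) has_vector_derivative - m * refl_ker m s z) (at s within {0..y})"
    by (simp add: refl_ker_eq mult_ac)
qed

text \<open>\<open>V\<close> and \<open>W\<close> are the first and second derivative of
  \<open>U\<close>, stated in integrated form because \<open>g\<close> is merely square integrable.
  The term \<open>- (2 * m) *s g\<close> in \<open>W\<close> is the jump of \<open>exp_ker'\<close>.
  The part with \<open>h\<close> solves the homogeneous equation, so \<open>h\<close> is free to be
  adapted to a boundary condition. At \<open>0\<close> both kernels reduce to
  \<open>exp (- m * z)\<close>, whence the boundary values depend on the same two moments.\<close>

lemma exp_ker_solution:
  fixes m :: complex and g h :: "real \<Rightarrow> complex^2"
  assumes m: "Re m > 0" and g: "g \<in> L2" and h: "h \<in> L2"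
  defines "U \<equiv> \<lambda>y. (LINT z|half_line. exp_ker m y z *s g z) + (LINT z|half_line. refl_ker m y z *s h z)"
  defines "V \<equiv> \<lambda>y. (LINT z|half_line. exp_ker' m y z *s g z) + (- m) *s (LINT z|half_line. refl_ker m y z *s h z)"
  defines "W \<equiv> \<lambda>y. m\<^sup>2 *s U y - (2 * m) *s g y"
  shows "U \<in> L2" "V \<in> L2" "W \<in> L2"
    and "\<And>y. y \<ge> 0 \<Longrightarrow> U y = U 0 + prim V y"
    and "\<And>y. y \<ge> 0 \<Longrightarrow> V y = V 0 + prim W y"
    and "U 0 = (LINT z|half_line. exp (- m * of_real z) *s g z) + (LINT z|half_line. exp (- m * of_real z) *s h z)"
    and "V 0 = m *s ((LINT z|half_line. exp (- m * of_real z) *s g z) - (LINT z|half_line. exp (- m * of_real z) *s h z))"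
proof -
  let ?E = "\<lambda>y. LINT z|half_line. exp_ker m y z *s g z"
  let ?E' = "\<lambda>y. LINT z|half_line. exp_ker' m y z *s g z"
  let ?R = "\<lambda>y. LINT z|half_line. refl_ker m y z *s h z"
  note bE = exp_ker_bound[of m] and bE' = exp_ker'_bound[of m] and bR = refl_ker_bound[OF m]
  note kE = kernel_integrable[OF ker_measurable(1) bE m g]
  note kE' = kernel_integrable[OF ker_measurable(2) bE' m g]
  have kR: "integrable half_line (\<lambda>z. refl_ker m y z *s f z)"
    "norm (LINT z|half_line. refl_ker m y z *s f z) \<le> 1 * (LINT z|half_line. exp (- Re m * \<bar>y - z\<bar>) * norm (f z))"
    if "f \<in> L2" "y \<ge> 0" for f :: "real \<Rightarrow> complex^2" and y
    by (rule kernel_integrable[OF ker_measurable(3) bR m that]; assumption)+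
  have E: "?E \<in> L2"
    by (rule Schur_test(1)[OF g m _ integral_kernel_measurable[OF ker_measurable(1) g] kE(2)]) auto
  have E': "?E' \<in> L2"
    by (rule Schur_test(1)[OF g m _ integral_kernel_measurable[OF ker_measurable(2) g] kE'(2)]) auto
  have R: "?R \<in> L2"
    by (rule Schur_test(1)[OF h m _ integral_kernel_measurable[OF ker_measurable(3) h] kR(2)[OF h]]) auto
  show U: "U \<in> L2" unfolding U_def by (rule L2_add[OF E R])
  show V: "V \<in> L2" unfolding V_def by (rule L2_add[OF E' L2_scale[OF R]])
  show W: "W \<in> L2" unfolding W_def by (rule L2_diff[OF L2_scale[OF U] L2_scale[OF g]])
  have prim_add: "prim (\<lambda>x. u x + v x) y = prim u y + prim v y" if "u \<in> L2" "v \<in> L2" for u v y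
    unfolding prim_def scaleR_add_right
    by (rule Bochner_Integration.integral_add) (use that L2_loc_int loc_intD in blast)+
  have prim_scale: "prim (\<lambda>x. c *s u x) y = c *s prim u y" if "u \<in> L2" for u c y
  proof -
    have "prim (\<lambda>x. c *s u x) y = (LINT s|half_line. c *s (indicator {..y} s *\<^sub>R u s))"
      unfolding prim_def by (intro Bochner_Integration.integral_cong refl) (simp add: vec_eq_iff)
    also have "\<dots> = c *s prim u y" unfolding prim_def
      by (rule Bochner_Integration.integral_bounded_linear[OF bounded_linear_vsm_right loc_intD[OF L2_loc_int[OF that]]])
    finally show ?thesis .
  qed
  have int_diff: "(LINT z|half_line. (k z - k' z) *s f z) = (LINT z|half_line. k z *s f z) - (LINT z|half_line. k' z *s f z)"
    if "integrable half_line (\<lambda>z. k z *s f z)" "integrable half_line (\<lambda>z. k' z *s f z)" for k k' and f :: "real \<Rightarrow> complex^2"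
  proof -
    have "(\<lambda>z. (k z - k' z) *s f z) = (\<lambda>z. k z *s f z - k' z *s f z)" by (simp add: vec_eq_iff fun_eq_iff algebra_simps)
    thus ?thesis using Bochner_Integration.integral_diff[OF that] by (simp only:)
  qed
  have e1: "prim ?E' y = ?E y - ?E 0" if y: "y \<ge> 0" for y
  proof -
    have "prim ?E' y = (LINT z|half_line. (exp_ker m y z - exp_ker m 0 z) *s g z)"
      by (rule prim_kernel[OF ker_measurable(2) bE' m _ g exp_ker'_integral[OF y]]) auto
    also have "\<dots> = ?E y - ?E 0" by (rule int_diff[OF kE(1)[OF y] kE(1)]) auto
    finally show ?thesis .
  qed
  have r1: "prim (\<lambda>y. (- m) *s ?R y) y = ?R y - ?R 0" if y: "y \<ge> 0" for y
  proof -
    have eq: "(- m) *s ?R y = (LINT z|half_line. (- m * refl_ker m y z) *s h z)" if "y \<ge> 0" for y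
      using Bochner_Integration.integral_bounded_linear[OF bounded_linear_vsm_right kR(1)[OF h that], of "- m"]
      by (simp add: vector_smult_assoc)
    have AE: "AE y in half_line. (- m) *s ?R y = (LINT z|half_line. (- m * refl_ker m y z) *s h z)"
      using AE_half_line_pos by eventually_elim (rule eq, simp)
    have AE': "AE y in half_line. (LINT z|half_line. (- m * refl_ker m y z) *s h z) = (- m) *s ?R y"
      using AE by eventually_elim simp
    have "prim (\<lambda>y. (- m) *s ?R y) y = prim (\<lambda>y. LINT z|half_line. (- m * refl_ker m y z) *s h z) y"
      by (rule prim_AE_cong[OF _ AE]) (rule loc_int_AE_cong[OF L2_loc_int[OF L2_scale[OF R]] AE'])
    also have "\<dots> = (LINT z|half_line. (refl_ker m y z - refl_ker m 0 z) *s h z)"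
    proof (rule prim_kernel[OF _ _ m _ h refl_ker_integral[OF y], where C = "cmod m"])
      show "(\<lambda>p. - m * refl_ker m (fst p) (snd p)) \<in> borel_measurable (half_line \<Otimes>\<^sub>M half_line)" by measurable
      show "cmod (- m * refl_ker m y z) \<le> cmod m * exp (- Re m * \<bar>y - z\<bar>)" if "y \<ge> 0" "z \<ge> 0" for y z
        using mult_left_mono[OF bR[OF that], of "cmod m"] by (simp add: norm_mult)
    qed auto
    also have "\<dots> = ?R y - ?R 0" by (rule int_diff[OF kR(1)[OF h y] kR(1)[OF h]]) auto
    finally show ?thesis .
  qed
  have mR: "(\<lambda>y. (- m) *s ?R y) \<in> L2" by (rule L2_scale[OF R])
  show "U y = U 0 + prim V y" if y: "y \<ge> 0" for y
    unfolding V_def prim_add[OF E' mR] e1[OF y] r1[OF y] by (simp add: U_def)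
  have e2: "m\<^sup>2 *s prim ?E y = (2 * m) *s prim g y + ?E' y - ?E' 0" if y: "y \<ge> 0" for y
  proof -
    let ?j = "\<lambda>z. if z < y then 2 * m else if z = y then m else 0"
    have eq: "m\<^sup>2 *s ?E y = (LINT z|half_line. (m\<^sup>2 * exp_ker m y z) *s g z)" if "y \<ge> 0" for y
      using Bochner_Integration.integral_bounded_linear[OF bounded_linear_vsm_right kE(1)[OF that], of "m\<^sup>2"]
      by (simp add: vector_smult_assoc)
    have AE: "AE y in half_line. m\<^sup>2 *s ?E y = (LINT z|half_line. (m\<^sup>2 * exp_ker m y z) *s g z)"
      using AE_half_line_pos by eventually_elim (rule eq, simp)
    have AE': "AE y in half_line. (LINT z|half_line. (m\<^sup>2 * exp_ker m y z) *s g z) = m\<^sup>2 *s ?E y"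
      using AE by eventually_elim simp
    \<comment> \<open>The value \<open>m\<close> on the diagonal concerns a single point, so the
      jump term is \<open>2 * m\<close> times the integrand of \<open>prim g y\<close> almost
      everywhere.\<close>
    have jAE: "AE z in half_line. ?j z *s g z = (2 * m) *s (indicator {..y} z *\<^sub>R g z)"
    proof -
      have "AE z in lebesgue. z \<noteq> y" by (rule AE_completion) (rule AE_lborel_singleton)
      hence "AE z in half_line. z \<noteq> y" unfolding AE_half_line_iff by eventually_elim simp
      thus ?thesis by eventually_elim (auto simp: indicator_def)
    qed
    have ji': "integrable half_line (\<lambda>z. (2 * m) *s (indicator {..y} z *\<^sub>R g z))"
      by (rule integrable_bounded_linear[OF bounded_linear_vsm_right loc_intD[OF L2_loc_int[OF g]]])
    have jm: "(\<lambda>z. ?j z *s g z) \<in> borel_measurable half_line"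
      by (rule measurable_half_line_AE_cong[OF borel_measurable_integrable[OF ji'] jAE])
    have ji: "integrable half_line (\<lambda>z. ?j z *s g z)"
      using integrable_cong_AE[OF jm borel_measurable_integrable[OF ji'] jAE] ji' by simp
    have j: "(LINT z|half_line. ?j z *s g z) = (2 * m) *s prim g y"
      using integral_cong_AE[OF jm borel_measurable_integrable[OF ji'] jAE]
        Bochner_Integration.integral_bounded_linear[OF bounded_linear_vsm_right loc_intD[OF L2_loc_int[OF g], of y], of "2 * m"]
      by (simp add: prim_def)
    have "m\<^sup>2 *s prim ?E y = prim (\<lambda>y. m\<^sup>2 *s ?E y) y" by (rule prim_scale[OF E, symmetric])
    also have "\<dots> = prim (\<lambda>y. LINT z|half_line. (m\<^sup>2 * exp_ker m y z) *s g z) y"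
      by (rule prim_AE_cong[OF _ AE]) (rule loc_int_AE_cong[OF L2_loc_int[OF L2_scale[OF E]] AE'])
    also have "\<dots> = (LINT z|half_line. (?j z + exp_ker' m y z - exp_ker' m 0 z) *s g z)"
    proof (rule prim_kernel[OF _ _ m _ g, where C = "cmod (m\<^sup>2)"])
      show "(\<lambda>p. m\<^sup>2 * exp_ker m (fst p) (snd p)) \<in> borel_measurable (half_line \<Otimes>\<^sub>M half_line)" by measurable
      show "cmod (m\<^sup>2 * exp_ker m y z) \<le> cmod (m\<^sup>2) * exp (- Re m * \<bar>y - z\<bar>)" for y z
        using mult_left_mono[OF bE, of "cmod (m\<^sup>2)"] by (simp add: norm_mult)
      show "((\<lambda>s. m\<^sup>2 * exp_ker m s z) has_integral ?j z + exp_ker' m y z - exp_ker' m 0 z) {0..y}" if "z > 0" for z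
        by (rule exp_ker_integral[OF y that])
    qed auto
    also have "\<dots> = (LINT z|half_line. (?j z *s g z + exp_ker' m y z *s g z) - exp_ker' m 0 z *s g z)"
      by (intro Bochner_Integration.integral_cong refl) (simp add: vec_eq_iff algebra_simps)
    also have "\<dots> = (LINT z|half_line. ?j z *s g z) + ?E' y - ?E' 0"
      using ji kE'(1)[OF y] kE'(1)[of 0] by simp
    finally show ?thesis unfolding j .
  qed
  show "V y = V 0 + prim W y" if y: "y \<ge> 0" for y
  proof -
    have "prim W y = prim (\<lambda>x. m\<^sup>2 *s ?E x + (m\<^sup>2 *s ?R x + (- (2 * m)) *s g x)) y"
      unfolding W_def U_def by (intro arg_cong[where f="\<lambda>h. prim h y"]) (simp add: fun_eq_iff vec_eq_iff algebra_simps)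
    also have "\<dots> = m\<^sup>2 *s prim ?E y + (prim (\<lambda>x. (- m) *s ((- m) *s ?R x)) y + (- (2 * m)) *s prim g y)"
    proof -
      have s1: "(\<lambda>x. (- m) *s ((- m) *s ?R x)) = (\<lambda>x. m\<^sup>2 *s ?R x)" by (simp add: vector_smult_assoc power2_eq_square)
      show ?thesis
        unfolding s1 prim_add[OF L2_scale[OF E] L2_add[OF L2_scale[OF R] L2_scale[OF g]]]
          prim_add[OF L2_scale[OF R] L2_scale[OF g]] prim_scale[OF E] prim_scale[OF g] ..
    qed
    also have "prim (\<lambda>x. (- m) *s ((- m) *s ?R x)) y = (- m) *s (?R y - ?R 0)"
      unfolding prim_scale[OF mR] r1[OF y] ..
    finally show ?thesis unfolding e2[OF y] V_def by (simp add: vec_eq_iff algebra_simps)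
  qed
  have e0: "exp_ker m 0 z = exp (- m * of_real z)" if "z > 0" for z using that by (simp add: exp_ker_def)
  have e0': "exp_ker' m 0 z = m * exp (- m * of_real z)" if "z > 0" for z using that by (simp add: exp_ker'_def exp_ker_def)
  have i0: "integrable half_line (\<lambda>z. exp (- m * of_real z) *s g z)"
    using kR(1)[OF g, of 0] by (simp add: refl_ker_def)
  have cE: "?E 0 = (LINT z|half_line. exp (- m * of_real z) *s g z)"
  proof (rule integral_cong_AE[OF borel_measurable_integrable borel_measurable_integrable[OF i0]])
    show "integrable half_line (\<lambda>z. exp_ker m 0 z *s g z)" by (rule kE(1)) simp
  qed (use AE_half_line_pos in eventually_elim, simp add: e0)
  have cR: "?R 0 = (LINT z|half_line. exp (- m * of_real z) *s h z)"
    by (simp add: refl_ker_def)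
  have "?E' 0 = (LINT z|half_line. m *s (exp (- m * of_real z) *s g z))"
  proof (rule integral_cong_AE[OF borel_measurable_integrable
        borel_measurable_integrable[OF integrable_bounded_linear[OF bounded_linear_vsm_right i0]]])
    show "integrable half_line (\<lambda>z. exp_ker' m 0 z *s g z)" by (rule kE'(1)) simp
  qed (use AE_half_line_pos in eventually_elim, simp add: e0' vector_smult_assoc)
  also have "\<dots> = m *s (LINT z|half_line. exp (- m * of_real z) *s g z)"
    by (rule Bochner_Integration.integral_bounded_linear[OF bounded_linear_vsm_right i0])
  finally have cE': "?E' 0 = m *s (LINT z|half_line. exp (- m * of_real z) *s g z)" .
  show "U 0 = (LINT z|half_line. exp (- m * of_real z) *s g z) + (LINT z|half_line. exp (- m * of_real z) *s h z)"
    unfolding U_def cE cR ..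
  show "V 0 = m *s ((LINT z|half_line. exp (- m * of_real z) *s g z) - (LINT z|half_line. exp (- m * of_real z) *s h z))"
    unfolding V_def cE' cR by (simp add: vec_eq_iff algebra_simps)
qed

section \<open>The root mu and the matrices built from xi\<close>

lemma xi_norm_sq: "(xi_norm \<xi>)\<^sup>2 = (real_of_int (\<xi> $ 1))\<^sup>2 + (real_of_int (\<xi> $ 2))\<^sup>2"
  by (simp add: xi_norm_def norm_vec_def L2_set_def sum_2)

lemma xi_norm_pos: "\<xi> \<noteq> 0 \<Longrightarrow> xi_norm \<xi> > 0"
  by (auto simp: xi_norm_def vec_eq_iff forall_2)

lemma mu_squared:
  assumes "\<nu> > 0"
  shows "of_real \<nu> * (mu \<nu> \<xi> lam)\<^sup>2 = lam + of_real (\<nu> * (xi_norm \<xi>)\<^sup>2)"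
proof -
  have "\<nu> * (\<nu> powr (- (1/2)))\<^sup>2 = 1"
    using assms by (simp add: power2_eq_square powr_add[symmetric] powr_minus field_simps)
  hence "of_real \<nu> * (complex_of_real (\<nu> powr (- (1/2))))\<^sup>2 = 1"
    by (metis of_real_1 of_real_mult of_real_power)
  thus ?thesis by (simp add: mu_def power_mult_distrib mult.assoc[symmetric])
qed

text \<open>The principal root has nonnegative real part. Were it zero, the square
  \<open>lam + \<nu> * |xi|\<^sup>2\<close> would be a nonpositive real number and
  \<open>lam\<close> would lie on the cut.\<close>

lemma Re_mu_pos:
  assumes "\<nu> > 0" "lam \<notin> complex_of_real ` {.. - \<nu> * (xi_norm \<xi>)\<^sup>2}"
  shows "Re (mu \<nu> \<xi> lam) > 0"
proof -
  let ?w = "lam + of_real (\<nu> * (xi_norm \<xi>)\<^sup>2)"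
  have "Re (csqrt ?w) \<noteq> 0"
  proof
    assume 0: "Re (csqrt ?w) = 0"
    have "?w = (csqrt ?w)\<^sup>2" by simp
    also have "csqrt ?w = \<i> * of_real (Im (csqrt ?w))" using 0 by (simp add: complex_eq_iff)
    also have "(\<i> * of_real (Im (csqrt ?w)))\<^sup>2 = of_real (- (Im (csqrt ?w))\<^sup>2)" by (simp add: power_mult_distrib)
    finally have "lam = of_real (- (Im (csqrt ?w))\<^sup>2 - \<nu> * (xi_norm \<xi>)\<^sup>2)"
      by (metis add_diff_cancel_right' of_real_diff)
    moreover have "- (Im (csqrt ?w))\<^sup>2 - \<nu> * (xi_norm \<xi>)\<^sup>2 \<in> {.. - \<nu> * (xi_norm \<xi>)\<^sup>2}" by simp
    ultimately show False using assms(2) by blast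
  qed
  moreover have "Re (csqrt ?w) \<ge> 0" using csqrt_principal[of ?w] by auto
  ultimately show ?thesis using assms(1) by (simp add: mu_def)
qed

lemma mu_neq_xi_norm:
  assumes "\<nu> > 0" "lam \<noteq> 0" shows "mu \<nu> \<xi> lam \<noteq> of_real (xi_norm \<xi>)"
  using mu_squared[OF assms(1), of \<xi> lam] assms(2) by auto

definition Gker :: "real \<Rightarrow> int^2 \<Rightarrow> complex \<Rightarrow> real \<Rightarrow> real \<Rightarrow> complex^2^2"
  where "Gker \<nu> \<xi> lam y z = (let m = mu \<nu> \<xi> lam; a = of_real (xi_norm \<xi>) in
    \<chi> i j. (if i = j then 1 / (2 * of_real \<nu> * m) else 0) * (exp_ker m y z + refl_ker m y z)
      + (m + a) / (m * lam * a) * xi_perp_mat \<xi> $ i $ j * refl_ker m y z)"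

text \<open>This brings the kernel into the form of \<open>exp_ker_solution\<close>: the source is
  \<open>p *s f\<close>, and the reflected amplitude is the same vector plus a multiple of the
  component selected by \<open>xi_perp_mat\<close>.\<close>

lemma Gker_mult:
  defines "p \<equiv> \<lambda>\<nu> \<xi> lam. 1 / (2 * of_real \<nu> * mu \<nu> \<xi> lam)"
    and "q \<equiv> \<lambda>\<nu> \<xi> lam. (mu \<nu> \<xi> lam + of_real (xi_norm \<xi>)) / (mu \<nu> \<xi> lam * lam * of_real (xi_norm \<xi>))"
  shows "Gker \<nu> \<xi> lam y z *v f = exp_ker (mu \<nu> \<xi> lam) y z *s (p \<nu> \<xi> lam *s f)
    + refl_ker (mu \<nu> \<xi> lam) y z *s (p \<nu> \<xi> lam *s f + q \<nu> \<xi> lam *s (xi_perp_mat \<xi> *v f))"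
proof -
  have G: "Gker \<nu> \<xi> lam y z = (\<chi> i j. (if i = j then p \<nu> \<xi> lam else 0) * (exp_ker (mu \<nu> \<xi> lam) y z + refl_ker (mu \<nu> \<xi> lam) y z)
      + q \<nu> \<xi> lam * xi_perp_mat \<xi> $ i $ j * refl_ker (mu \<nu> \<xi> lam) y z)"
    by (simp only: Gker_def Let_def p_def q_def)
  show ?thesis
    unfolding G by (simp add: vec_eq_iff forall_2 matrix_vector_mult_def sum_2 algebra_simps)
qed

lemma xi_perp_mat_nth:
  "xi_perp_mat \<xi> $ 1 $ 1 = (of_int (\<xi>$2))\<^sup>2" "xi_perp_mat \<xi> $ 1 $ 2 = - of_int (\<xi>$1) * of_int (\<xi>$2)"
  "xi_perp_mat \<xi> $ 2 $ 1 = - of_int (\<xi>$1) * of_int (\<xi>$2)" "xi_perp_mat \<xi> $ 2 $ 2 = (of_int (\<xi>$1))\<^sup>2"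
  by (simp_all add: xi_perp_mat_def)

lemma xi_mat_nth: "xi_mat \<xi> $ i $ j = of_int (\<xi> $ i) * of_int (\<xi> $ j) / of_real (xi_norm \<xi>)"
  by (simp add: xi_mat_def scaleR_conv_of_real[where 'a=complex])

lemma xi_norm_sq_complex:
  "(complex_of_real (xi_norm \<xi>))\<^sup>2 = (of_int (\<xi> $ 1))\<^sup>2 + (of_int (\<xi> $ 2))\<^sup>2"
proof -
  have "complex_of_real ((xi_norm \<xi>)\<^sup>2) = of_real ((real_of_int (\<xi> $ 1))\<^sup>2 + (real_of_int (\<xi> $ 2))\<^sup>2)"
    by (simp only: xi_norm_sq)
  thus ?thesis by (simp only: of_real_power of_real_add of_real_of_int_eq)
qed

text \<open>Since \<open>\<nu> * (\<mu>\<^sup>2 - \<bar>\<xi>\<bar>\<^sup>2) = \<lambda>\<close>, multiplying the condition on \<open>c\<close> by \<open>\<mu> + \<bar>\<xi>\<bar>\<close> yields the coefficient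
  \<open>(\<mu> + \<bar>\<xi>\<bar>) / (\<mu> * \<lambda> * \<bar>\<xi>\<bar>)\<close> of the reflected part when \<open>b = 1 / (2 * \<nu> * \<mu>)\<close>.\<close>

lemma boundary_condition_refl:
  fixes F :: "complex^2"
  assumes xi: "\<xi> \<noteq> 0" and c: "c * (m - of_real (xi_norm \<xi>)) = 2 * b / of_real (xi_norm \<xi>)"
  defines "G \<equiv> b *s F" and "H \<equiv> b *s F + c *s (xi_perp_mat \<xi> *v F)"
  shows "- (m *s (G - H) + xi_norm \<xi> *\<^sub>R (G + H)) + xi_mat \<xi> *v (G + H) = 0"
proof -
  define A where "A = complex_of_real (xi_norm \<xi>)"
  have A: "A \<noteq> 0" using xi_norm_pos[OF xi] by (simp add: A_def)
  define x where "x = complex_of_int (\<xi> $ 1)"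
  define y where "y = complex_of_int (\<xi> $ 2)"
  have A2: "A\<^sup>2 = x\<^sup>2 + y\<^sup>2" unfolding A_def x_def y_def by (rule xi_norm_sq_complex)
  have c': "2 * b = c * (m - A) * A" using c A by (simp add: A_def field_simps)
  define P where "P = xi_perp_mat \<xi> *v F"
  have P1: "P $ 1 = y\<^sup>2 * F $ 1 - x * y * F $ 2" and P2: "P $ 2 = x\<^sup>2 * F $ 2 - x * y * F $ 1"
    by (simp_all add: P_def matrix_vector_mult_def sum_2 xi_perp_mat_nth x_def y_def)
  have GH: "(G + H) $ i = 2 * b * F $ i + c * P $ i" for i by (simp add: G_def H_def P_def)
  have XP: "x * P $ 1 + y * P $ 2 = 0" unfolding P1 P2 by (simp add: power2_eq_square algebra_simps)
  \<comment> \<open>The matrices \<open>xi * xi^T\<close> and \<open>xi_perp_mat\<close> add up to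
    \<open>|xi|\<^sup>2\<close> times the identity.\<close>
  have XF1: "x * (x * F $ 1 + y * F $ 2) = A\<^sup>2 * F $ 1 - P $ 1" unfolding P1 A2 by (simp add: power2_eq_square algebra_simps)
  have XF2: "y * (x * F $ 1 + y * F $ 2) = A\<^sup>2 * F $ 2 - P $ 2" unfolding P2 A2 by (simp add: power2_eq_square algebra_simps)
  have X: "(xi_mat \<xi> *v (G + H)) $ i = of_int (\<xi> $ i) * (2 * b * (x * F $ 1 + y * F $ 2)) / A" for i
  proof -
    have "(xi_mat \<xi> *v (G + H)) $ i = of_int (\<xi> $ i) * (x * (G + H) $ 1 + y * (G + H) $ 2) / A"
      by (simp only: matrix_vector_mult_def sum_2 xi_mat_nth vec_lambda_beta A_def x_def y_def)
         (simp add: add_divide_distrib algebra_simps)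
    also have "x * (G + H) $ 1 + y * (G + H) $ 2 = 2 * b * (x * F $ 1 + y * F $ 2) + c * (x * P $ 1 + y * P $ 2)"
      unfolding GH by (simp add: algebra_simps)
    finally show ?thesis using XP by simp
  qed
  have main: "- (m * (- (c * p)) + A * (2 * b * f + c * p)) + 2 * b * (A\<^sup>2 * f - p) / A = 0" for p f
  proof -
    have "2 * b * (A\<^sup>2 * f - p) / A = 2 * b * A * f - c * (m - A) * p"
      using A unfolding c' by (simp add: field_simps power2_eq_square)
    thus ?thesis by (simp add: algebra_simps)
  qed
  have GmH: "(G - H) $ i = - (c * P $ i)" for i by (simp add: G_def H_def P_def)
  show ?thesis
    unfolding vec_eq_iff forall_2
  proof
    have "(- (m *s (G - H) + xi_norm \<xi> *\<^sub>R (G + H)) + xi_mat \<xi> *v (G + H)) $ 1 =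
      - (m * (G - H) $ 1 + A * (G + H) $ 1) + (xi_mat \<xi> *v (G + H)) $ 1"
      by (simp add: scaleR_conv_of_real[where 'a=complex] A_def algebra_simps)
    also have "(xi_mat \<xi> *v (G + H)) $ 1 = 2 * b * (A\<^sup>2 * F $ 1 - P $ 1) / A"
      unfolding X XF1[symmetric] x_def by (simp add: mult_ac)
    finally show "(- (m *s (G - H) + xi_norm \<xi> *\<^sub>R (G + H)) + xi_mat \<xi> *v (G + H)) $ 1 = (0::complex^2) $ 1"
      unfolding GmH GH using main[of "P $ 1" "F $ 1"] by simp
    have "(- (m *s (G - H) + xi_norm \<xi> *\<^sub>R (G + H)) + xi_mat \<xi> *v (G + H)) $ 2 =
      - (m * (G - H) $ 2 + A * (G + H) $ 2) + (xi_mat \<xi> *v (G + H)) $ 2"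
      by (simp add: scaleR_conv_of_real[where 'a=complex] A_def algebra_simps)
    also have "(xi_mat \<xi> *v (G + H)) $ 2 = 2 * b * (A\<^sup>2 * F $ 2 - P $ 2) / A"
      unfolding X XF2[symmetric] y_def by (simp add: mult_ac)
    finally show "(- (m *s (G - H) + xi_norm \<xi> *\<^sub>R (G + H)) + xi_mat \<xi> *v (G + H)) $ 2 = (0::complex^2) $ 2"
      unfolding GmH GH using main[of "P $ 2" "F $ 2"] by simp
  qed
qed

lemma Gker_coeff:
  assumes nu: "\<nu> > 0" and xi: "\<xi> \<noteq> 0" and lam: "lam \<notin> complex_of_real ` {.. - \<nu> * (xi_norm \<xi>)\<^sup>2}" "lam \<noteq> 0"
  defines "m \<equiv> mu \<nu> \<xi> lam" and "A \<equiv> complex_of_real (xi_norm \<xi>)"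
  shows "(m + A) / (m * lam * A) * (m - A) = 2 * (1 / (2 * of_real \<nu> * m)) / A"
proof -
  have m0: "m \<noteq> 0" using Re_mu_pos[OF nu lam(1)] by (auto simp: m_def)
  have A0: "A \<noteq> 0" using xi_norm_pos[OF xi] by (simp add: A_def)
  have "lam = of_real \<nu> * ((m + A) * (m - A))"
    using mu_squared[OF nu, of \<xi> lam] by (simp add: m_def A_def power2_eq_square algebra_simps)
  hence l: "of_real \<nu> * ((m + A) * (m - A)) = lam" ..
  have "(m + A) / (m * lam * A) * (m - A) = ((m + A) * (m - A)) / (m * lam * A)" by simp
  also have "\<dots> = (of_real \<nu> * ((m + A) * (m - A))) / (of_real \<nu> * (m * lam * A))" using nu by simp
  also have "\<dots> = lam / (of_real \<nu> * (m * lam * A))" unfolding l ..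
  also have "\<dots> = 2 * (1 / (2 * of_real \<nu> * m)) / A" using m0 A0 lam(2) nu by (simp add: field_simps)
  finally show ?thesis .
qed

lemma integral_exp_linear:
  fixes f :: "real \<Rightarrow> complex^2"
  assumes m: "Re m > 0" and f: "f \<in> L2" and T: "bounded_linear T" and Ts: "\<And>c x. T (c *s x) = c *s T x"
  shows "(LINT z|half_line. exp (- m * of_real z) *s T (f z)) = T (LINT z|half_line. exp (- m * of_real z) *s f z)"
proof -
  have i0: "integrable half_line (\<lambda>z. exp (- m * of_real z) *s f z)"
    using kernel_integrable(1)[of "refl_ker m" 1 "Re m" f 0] refl_ker_bound[OF m] ker_measurable(3) m f
    by (simp add: refl_ker_def)
  show ?thesis using Bochner_Integration.integral_bounded_linear[OF T i0] by (simp add: Ts)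
qed

text \<open>\<open>exp_ker_solution\<close> is applied with source \<open>b *s f\<close> and
  reflected amplitude \<open>S (f z)\<close>. Since \<open>\<nu> * 2 * m * b = 1\<close>, the source
  term of the equation is exactly \<open>f\<close>, and \<open>S\<close> is the map for which
  \<open>boundary_condition_refl\<close> holds. The constant \<open>C\<close> comes from Schur's
  test and does not depend on \<open>f\<close>, as \<open>resolvent_set\<close> demands.\<close>

lemma resolvent_solution:
  assumes nu: "\<nu> > 0" and xi: "\<xi> \<noteq> 0" and lam: "lam \<notin> complex_of_real ` {.. - \<nu> * (xi_norm \<xi>)\<^sup>2}" "lam \<noteq> 0"
  obtains U C where
    "\<And>f. f \<in> L2 \<Longrightarrow> resolvent_eq \<nu> \<xi> lam f (U f)"
    "\<And>f. f \<in> L2 \<Longrightarrow> l2norm (U f) \<le> C * l2norm f"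
    "\<And>f y. f \<in> L2 \<Longrightarrow> y \<ge> 0 \<Longrightarrow> integrable half_line (\<lambda>z. Gker \<nu> \<xi> lam y z *v f z)"
    "\<And>f y. f \<in> L2 \<Longrightarrow> y \<ge> 0 \<Longrightarrow> U f y = (LINT z|half_line. Gker \<nu> \<xi> lam y z *v f z)"
proof -
  define m where "m = mu \<nu> \<xi> lam"
  define A where "A = complex_of_real (xi_norm \<xi>)"
  define b where "b = 1 / (2 * of_real \<nu> * m)"
  define c where "c = (m + A) / (m * lam * A)"
  define S where "S x = b *s x + c *s (xi_perp_mat \<xi> *v x)" for x :: "complex^2"
  define U where "U f y = (LINT z|half_line. exp_ker m y z *s (b *s f z)) + (LINT z|half_line. refl_ker m y z *s S (f z))" for f y
  have m: "Re m > 0" unfolding m_def by (rule Re_mu_pos[OF nu lam(1)])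
  hence m0: "m \<noteq> 0" by auto
  have m2: "of_real \<nu> * m\<^sup>2 = lam + of_real (\<nu> * (xi_norm \<xi>)\<^sup>2)" unfolding m_def by (rule mu_squared[OF nu])
  have cb: "c * (m - of_real (xi_norm \<xi>)) = 2 * b / of_real (xi_norm \<xi>)"
    using Gker_coeff[OF nu xi lam] unfolding b_def c_def m_def A_def .
  have S: "bounded_linear S" unfolding S_def
    by (intro bounded_linear_add bounded_linear_vsm_right
        bounded_linear_compose[OF bounded_linear_vsm_right bounded_linear_matrix_vector_mult])
  have Ss: "S (k *s x) = k *s S x" for k x
    by (simp add: S_def vec_eq_iff forall_2 matrix_vector_mult_def sum_2 algebra_simps)
  obtain B where B: "\<And>x. norm (S x) \<le> norm x * B" using bounded_linear.bounded[OF S] by blast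
  define C0 where "C0 = cmod b + \<bar>B\<bar>"
  have gS: "(\<lambda>z. b *s f z) \<in> L2" "(\<lambda>z. S (f z)) \<in> L2" if "f \<in> L2" for f
    using L2_scale[OF that] L2_bounded_linear[OF S that] by auto
  note k1 = kernel_integrable[OF ker_measurable(1) exp_ker_bound m]
  have k2: "integrable half_line (\<lambda>z. refl_ker m y z *s f z)"
    "norm (LINT z|half_line. refl_ker m y z *s f z) \<le> 1 * (LINT z|half_line. exp (- Re m * \<bar>y - z\<bar>) * norm (f z))"
    if "f \<in> L2" "y \<ge> 0" for f :: "real \<Rightarrow> complex^2" and y
    by (rule kernel_integrable[OF ker_measurable(3) refl_ker_bound[OF m] m that]; assumption)+
  have G: "Gker \<nu> \<xi> lam y z *v f z = exp_ker m y z *s (b *s f z) + refl_ker m y z *s S (f z)" for f y z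
    unfolding Gker_mult S_def b_def c_def m_def A_def ..
  have int: "integrable half_line (\<lambda>z. Gker \<nu> \<xi> lam y z *v f z)" if "f \<in> L2" "y \<ge> 0" for f y
    unfolding G by (intro Bochner_Integration.integrable_add k1(1) k2(1) gS that)
  have UG: "U f y = (LINT z|half_line. Gker \<nu> \<xi> lam y z *v f z)" if "f \<in> L2" "y \<ge> 0" for f y
    unfolding G U_def
    by (rule Bochner_Integration.integral_add[symmetric]) (intro k1(1) k2(1) gS that)+
  have bound: "l2norm (U f) \<le> C0 * (2 / Re m) * l2norm f" if f: "f \<in> L2" for f
  proof (rule Schur_test(2)[OF f m])
    show "C0 \<ge> 0" by (simp add: C0_def)
    show "U f \<in> borel_measurable half_line"
      unfolding U_def
      by (intro borel_measurable_add integral_kernel_measurable ker_measurable gS f)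
    fix y :: real assume y: "y \<ge> 0"
    let ?I = "LINT z|half_line. exp (- Re m * \<bar>y - z\<bar>) * norm (f z)"
    have iI: "integrable half_line (\<lambda>z. exp (- Re m * \<bar>y - z\<bar>) * norm (f z))" by (rule L2_integrable_exp_abs[OF f m])
    have "norm (U f y) \<le> (LINT z|half_line. exp (- Re m * \<bar>y - z\<bar>) * norm (b *s f z)) + (LINT z|half_line. exp (- Re m * \<bar>y - z\<bar>) * norm (S (f z)))"
      unfolding U_def using norm_triangle_mono[OF k1(2)[OF gS(1)[OF f] y] k2(2)[OF gS(2)[OF f] y]] by simp
    also have "\<dots> \<le> cmod b * ?I + \<bar>B\<bar> * ?I"
    proof (rule add_mono)
      show "(LINT z|half_line. exp (- Re m * \<bar>y - z\<bar>) * norm (b *s f z)) \<le> cmod b * ?I"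
        by (simp add: norm_vector_scalar_mult mult.left_commute)
      have "(LINT z|half_line. exp (- Re m * \<bar>y - z\<bar>) * norm (S (f z))) \<le> (LINT z|half_line. \<bar>B\<bar> * (exp (- Re m * \<bar>y - z\<bar>) * norm (f z)))"
      proof (rule integral_mono[OF L2_integrable_exp_abs[OF gS(2)[OF f] m]])
        fix z
        have "norm (S (f z)) \<le> \<bar>B\<bar> * norm (f z)"
          using B[of "f z"] mult_left_mono[OF abs_ge_self[of B] norm_ge_zero[of "f z"]] by (simp add: mult.commute)
        from mult_left_mono[OF this, of "exp (- Re m * \<bar>y - z\<bar>)"]
        show "exp (- Re m * \<bar>y - z\<bar>) * norm (S (f z)) \<le> \<bar>B\<bar> * (exp (- Re m * \<bar>y - z\<bar>) * norm (f z))"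
          by (simp add: mult_ac)
      qed (use iI in simp)
      thus "(LINT z|half_line. exp (- Re m * \<bar>y - z\<bar>) * norm (S (f z))) \<le> \<bar>B\<bar> * ?I" by simp
    qed
    also have "\<dots> = C0 * ?I" by (simp add: C0_def distrib_right)
    finally show "norm (U f y) \<le> C0 * ?I" .
  qed
  have sol: "resolvent_eq \<nu> \<xi> lam f (U f)" if f: "f \<in> L2" for f
  proof -
    define V where "V y = (LINT z|half_line. exp_ker' m y z *s (b *s f z)) + (- m) *s (LINT z|half_line. refl_ker m y z *s S (f z))" for y
    define W where "W y = m\<^sup>2 *s U f y - (2 * m) *s (b *s f y)" for y
    note sol = exp_ker_solution[OF m gS(1)[OF f] gS(2)[OF f], folded U_def V_def, folded W_def]
    define F where "F = (LINT z|half_line. exp (- m * of_real z) *s f z)"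
    have F1: "(LINT z|half_line. exp (- m * of_real z) *s (b *s f z)) = b *s F" unfolding F_def
      by (rule integral_exp_linear[OF m f bounded_linear_vsm_right]) (simp add: vector_smult_assoc mult.commute)
    have F2: "(LINT z|half_line. exp (- m * of_real z) *s S (f z)) = S F" unfolding F_def
      by (rule integral_exp_linear[OF m f S Ss])
    have U0: "U f 0 = b *s F + S F" using sol(6) unfolding F1 F2 .
    have V0: "V 0 = m *s (b *s F - S F)" using sol(7) unfolding F1 F2 .
    have lU: "loc_int (U f)" and lV: "loc_int V" and lW: "loc_int W" using sol(1-3) by (auto intro: L2_loc_int)
    have AU: "AE y in half_line. U f y = U f 0 + prim V y"
      by (rule AE_I2, rule sol(4)) simp
    have AU': "AE y in half_line. U f 0 + prim V y = U f y" using AU by eventually_elim (rule sym)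
    have AV: "AE y in half_line. V y = V 0 + prim W y"
      by (rule AE_I2, rule sol(5)) simp
    have pc: "continuous_on {0..} (\<lambda>y. v + prim w y)" if "loc_int w" for v and w :: "real \<Rightarrow> complex^2"
      by (intro continuous_intros continuous_on_prim that)
    have dU: "has_weak_deriv (U f) V"
      by (rule has_weak_deriv_AE_cong[OF loc_int_continuous[OF pc[OF lV]] AU lV _ has_weak_deriv_prim[OF lV]]) simp
    have dV: "has_weak_deriv V W"
      by (rule has_weak_deriv_AE_cong[OF loc_int_continuous[OF pc[OF lW]] AV lW _ has_weak_deriv_prim[OF lW]]) simp
    \<comment> \<open>\<open>wderiv (U f)\<close> is only a representative of \<open>V\<close>, so
      the second derivative has to be carried over to it before \<open>wderiv\<close> can be applied
      again.\<close>
    note w1 = wderiv_eq[OF sol(2) dU]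
    have dV': "has_weak_deriv (wderiv (U f)) W"
      by (rule has_weak_deriv_AE_cong[OF lV w1(3) lW _ dV]) simp
    note w2 = wderiv_eq[OF sol(3) dV']
    have t0: "trace0 (U f) = U f 0"
      using trace0_eq[OF pc[OF lV] AU'] by (simp add: prim_0)
    have t1: "trace0 (wderiv (U f)) = V 0"
    proof -
      have "AE y in half_line. V 0 + prim W y = wderiv (U f) y" using AV w1(3) by eventually_elim simp
      from trace0_eq[OF pc[OF lW] this] show ?thesis by (simp add: prim_0)
    qed
    have bc: "- (trace0 (wderiv (U f)) + xi_norm \<xi> *\<^sub>R trace0 (U f)) + xi_mat \<xi> *v trace0 (U f) = 0"
      unfolding t0 t1 U0 V0 S_def by (rule boundary_condition_refl[OF xi cb])
    have H2: "U f \<in> H2" unfolding H2_def using sol(1-3) dU dV by blast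
    have eq: "lam *s U f z - A_op \<nu> \<xi> (U f) z = f z" if "wderiv (wderiv (U f)) z = W z" for z
    proof -
      have bm: "complex_of_real \<nu> * (2 * m * b) = 1" using m0 nu by (simp add: b_def)
      have "(lam *s U f z - A_op \<nu> \<xi> (U f) z) $ i = f z $ i" for i
      proof -
        have "(lam *s U f z - A_op \<nu> \<xi> (U f) z) $ i = (lam + of_real (\<nu> * (xi_norm \<xi>)\<^sup>2)) * U f z $ i
           - of_real \<nu> * m\<^sup>2 * U f z $ i + (of_real \<nu> * (2 * m * b)) * f z $ i"
          unfolding A_op_def that W_def by (simp add: scaleR_conv_of_real[where 'a=complex] algebra_simps)
        thus ?thesis unfolding m2 bm by simp
      qed
      thus ?thesis by (simp add: vec_eq_iff)
    qed
    show ?thesis unfolding resolvent_eq_def A_dom_def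
      using H2 bc w2(3) by (auto elim!: eventually_mono intro: eq)
  qed
  show ?thesis by (rule that[of U "C0 * (2 / Re m)"]) (use sol bound int UG in auto)
qed

section \<open>Uniqueness for the resolvent equation\<close>

lemma L2_exp_growth_zero:
  assumes p: "p \<in> L2" and m: "Re m \<ge> 0" and e: "\<And>x. x \<ge> 0 \<Longrightarrow> p x = exp (m * of_real x) *s v"
  shows "v = 0"
proof (rule ccontr)
  assume "v \<noteq> 0"
  hence v: "(norm v)\<^sup>2 > 0" by simp
  \<comment> \<open>Because \<open>Re m \<ge> 0\<close>, the norm of \<open>p\<close> never falls
    below that of \<open>v\<close>; the interval from \<open>0\<close> to \<open>n\<close> alone
    then contributes more than the whole integral.\<close>
  obtain n where n: "(LINT x|half_line. (norm (p x))\<^sup>2) < real n * (norm v)\<^sup>2"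
    using reals_Archimedean3[OF v] by blast
  have ind: "(\<lambda>x. indicator {..real n} x * (norm v)\<^sup>2) = (\<lambda>x. indicator {..real n} x *\<^sub>R (norm v)\<^sup>2)" by simp
  have "real n * (norm v)\<^sup>2 = (LINT x|lebesgue_on {0..real n}. (norm v)\<^sup>2)"
    by (simp add: measure_restrict_space)
  also have "\<dots> = prim (\<lambda>_. (norm v)\<^sup>2) (real n)" by (simp add: prim_eq)
  also have "\<dots> \<le> (LINT x|half_line. (norm (p x))\<^sup>2)"
    unfolding prim_def
  proof (rule integral_mono)
    show "integrable half_line (\<lambda>x. indicator {..real n} x *\<^sub>R (norm v)\<^sup>2)"
      by (rule loc_intD[OF loc_int_continuous]) auto
    show "integrable half_line (\<lambda>x. (norm (p x))\<^sup>2)" by (rule L2_integrable[OF p])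
    fix x assume "x \<in> space half_line"
    hence x: "x \<ge> 0" by simp
    have "1 * norm v \<le> norm (p x)"
      unfolding e[OF x] norm_vector_scalar_mult using m x by (intro mult_right_mono) auto
    hence "(norm v)\<^sup>2 \<le> (norm (p x))\<^sup>2" by (intro power_mono) auto
    thus "indicator {..real n} x *\<^sub>R (norm v)\<^sup>2 \<le> (norm (p x))\<^sup>2" by (auto simp: indicator_def)
  qed
  finally show False using n by simp
qed

lemma ode_exp_unique:
  fixes p :: "real \<Rightarrow> complex^2"
  assumes d: "\<And>x. x \<ge> 0 \<Longrightarrow> (p has_vector_derivative m *s p x) (at x within {0..})" and x: "x \<ge> 0"
  shows "p x = exp (m * of_real x) *s p 0"
proof -
  have "\<exists>c. \<forall>x\<in>{0..}. exp (- m * of_real x) *s p x = c"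
  proof (rule has_vector_derivative_zero_constant)
    fix x :: real assume x: "x \<in> {0..}"
    have "((\<lambda>x. exp (- m * of_real x) *s p x) has_vector_derivative
      exp (- m * of_real x) *s (m *s p x) + (- m * exp (- m * of_real x)) *s p x) (at x within {0..})"
      using bounded_bilinear.has_vector_derivative[OF bounded_bilinear_vector_scalar_mult has_vector_derivative_exp_scale[of "- m" x] d[of x]] x by simp
    moreover have "exp (- m * of_real x) *s (m *s p x) + (- m * exp (- m * of_real x)) *s p x = 0"
      by (simp add: vec_eq_iff)
    ultimately show "((\<lambda>x. exp (- m * of_real x) *s p x) has_vector_derivative 0) (at x within {0..})" by (simp only:)
  qed auto
  then obtain c where c: "\<And>x. x \<ge> 0 \<Longrightarrow> exp (- m * of_real x) *s p x = c" by auto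
  have "exp (m * of_real x) *s (exp (- m * of_real x) *s p x) = exp (m * of_real x) *s p 0"
    using c[OF x] c[of 0] by simp
  thus ?thesis by (simp add: vector_smult_assoc exp_add[symmetric])
qed

text \<open>The scalar product of the condition with xi yields \<open>m * s = 0\<close> for the
  component \<open>s\<close> along xi. With \<open>s = 0\<close> the condition reads
  \<open>(m - |xi|) *s w = 0\<close>.\<close>

lemma boundary_condition_injective:
  fixes w :: "complex^2"
  assumes xi: "\<xi> \<noteq> 0" and m: "m \<noteq> 0" "m \<noteq> of_real (xi_norm \<xi>)"
    and bc: "- ((- m) *s w + xi_norm \<xi> *\<^sub>R w) + xi_mat \<xi> *v w = 0"
  shows "w = 0"
proof -
  define A where "A = complex_of_real (xi_norm \<xi>)"
  have A: "A \<noteq> 0" using xi_norm_pos[OF xi] by (simp add: A_def)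
  define x where "x = complex_of_int (\<xi> $ 1)"
  define y where "y = complex_of_int (\<xi> $ 2)"
  have A2: "x * x + y * y = A * A" using xi_norm_sq_complex[of \<xi>] by (simp add: A_def x_def y_def power2_eq_square)
  define s where "s = x * w $ 1 + y * w $ 2"
  have X: "(xi_mat \<xi> *v w) $ i = of_int (\<xi> $ i) * s / A" for i
    by (simp only: matrix_vector_mult_def sum_2 xi_mat_nth vec_lambda_beta A_def x_def y_def s_def)
       (simp add: add_divide_distrib algebra_simps)
  have c: "(m - A) * w $ i + of_int (\<xi> $ i) * s / A = 0" for i
  proof -
    have "(- ((- m) *s w + xi_norm \<xi> *\<^sub>R w) + xi_mat \<xi> *v w) $ i = (m - A) * w $ i + of_int (\<xi> $ i) * s / A"
      by (simp add: X scaleR_conv_of_real[where 'a=complex] A_def algebra_simps)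
    thus ?thesis by (simp only: bc zero_index)
  qed
  have "0 = x * ((m - A) * w $ 1 + x * s / A) + y * ((m - A) * w $ 2 + y * s / A)"
    using c[of 1] c[of 2] by (simp add: x_def y_def)
  also have "\<dots> = (m - A) * s + (x * x + y * y) * s / A"
    by (simp add: s_def add_divide_distrib algebra_simps)
  also have "\<dots> = m * s" unfolding A2 using A by (simp add: algebra_simps)
  finally have s: "s = 0" using m by simp
  have "w $ i = 0" for i using c[of i] m(2) s by (simp add: A_def)
  thus ?thesis by (simp add: vec_eq_iff)
qed

text \<open>The difference has a representative \<open>u\<close> with
  \<open>u'' = m\<^sup>2 *s u\<close> in the classical sense. Factoring the operator,
  \<open>q = u' + m *s u\<close> satisfies \<open>q' = m *s q\<close> and is square integrable, so
  it vanishes. What remains is \<open>u' = - m *s u\<close>, and the boundary condition forces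
  \<open>u 0 = 0\<close>.\<close>

lemma resolvent_eq_unique:
  assumes nu: "\<nu> > 0" and xi: "\<xi> \<noteq> 0" and lam: "lam \<notin> complex_of_real ` {.. - \<nu> * (xi_norm \<xi>)\<^sup>2}" "lam \<noteq> 0"
    and u1: "resolvent_eq \<nu> \<xi> lam f u1" and u2: "resolvent_eq \<nu> \<xi> lam f u2"
  shows "AE z in half_line. u1 z = u2 z"
proof -
  define m where "m = mu \<nu> \<xi> lam"
  have m: "Re m > 0" unfolding m_def by (rule Re_mu_pos[OF nu lam(1)])
  have m2: "of_real \<nu> * m\<^sup>2 = lam + of_real (\<nu> * (xi_norm \<xi>)\<^sup>2)" unfolding m_def by (rule mu_squared[OF nu])
  \<comment> \<open>\<open>c\<close> and \<open>d\<close> are the traces of \<open>u\<close> and of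
    its weak derivative, so the boundary condition becomes an identity between two
    constants.\<close>
  have rep: "\<exists>c d. u \<in> L2 \<and> wderiv u \<in> L2 \<and> wderiv (wderiv u) \<in> L2 \<and>
      (AE x in half_line. u x = c + prim (wderiv u) x) \<and> (AE x in half_line. wderiv u x = d + prim (wderiv (wderiv u)) x) \<and>
      - (d + xi_norm \<xi> *\<^sub>R c) + xi_mat \<xi> *v c = 0"
    if u: "resolvent_eq \<nu> \<xi> lam f u" for u
  proof -
    have H: "u \<in> H2" and bc: "- (trace0 (wderiv u) + xi_norm \<xi> *\<^sub>R trace0 u) + xi_mat \<xi> *v trace0 u = 0"
      using u by (auto simp: resolvent_eq_def A_dom_def)
    then obtain v w where vw: "u \<in> L2" "v \<in> L2" "w \<in> L2" "has_weak_deriv u v" "has_weak_deriv v w"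
      by (auto simp: H2_def)
    note w1 = wderiv_eq[OF vw(2,4)]
    have d': "has_weak_deriv (wderiv u) w"
      by (rule has_weak_deriv_AE_cong[OF L2_loc_int[OF vw(2)] w1(3) L2_loc_int[OF vw(3)] _ vw(5)]) simp
    note w2 = wderiv_eq[OF vw(3) d']
    obtain c where c: "AE x in half_line. u x = c + prim (wderiv u) x"
      by (rule has_weak_deriv_imp_prim[OF L2_loc_int[OF vw(1)] L2_loc_int[OF w1(1)] w1(2)])
    obtain d where d: "AE x in half_line. wderiv u x = d + prim (wderiv (wderiv u)) x"
      by (rule has_weak_deriv_imp_prim[OF L2_loc_int[OF w1(1)] L2_loc_int[OF w2(1)] w2(2)])
    have tc: "trace0 u = c"
      using trace0_eq[of "\<lambda>x. c + prim (wderiv u) x" u] c continuous_on_prim[OF L2_loc_int[OF w1(1)]]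
      by (simp add: prim_0 eq_commute continuous_on_add)
    have td: "trace0 (wderiv u) = d"
      using trace0_eq[of "\<lambda>x. d + prim (wderiv (wderiv u)) x" "wderiv u"] d continuous_on_prim[OF L2_loc_int[OF w2(1)]]
      by (simp add: prim_0 eq_commute continuous_on_add)
    show ?thesis using vw w1(1) w2(1) c d bc unfolding tc td by blast
  qed
  obtain c1 d1 where r1: "u1 \<in> L2" "wderiv u1 \<in> L2" "wderiv (wderiv u1) \<in> L2"
    "AE x in half_line. u1 x = c1 + prim (wderiv u1) x" "AE x in half_line. wderiv u1 x = d1 + prim (wderiv (wderiv u1)) x"
    "- (d1 + xi_norm \<xi> *\<^sub>R c1) + xi_mat \<xi> *v c1 = 0" using rep[OF u1] by blast
  obtain c2 d2 where r2: "u2 \<in> L2" "wderiv u2 \<in> L2" "wderiv (wderiv u2) \<in> L2"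
    "AE x in half_line. u2 x = c2 + prim (wderiv u2) x" "AE x in half_line. wderiv u2 x = d2 + prim (wderiv (wderiv u2)) x"
    "- (d2 + xi_norm \<xi> *\<^sub>R c2) + xi_mat \<xi> *v c2 = 0" using rep[OF u2] by blast
  have prim_diff: "prim (\<lambda>x. u x - v x) y = prim u y - prim v y" if "u \<in> L2" "v \<in> L2" for u v y
    unfolding prim_def scaleR_diff_right
    by (rule Bochner_Integration.integral_diff) (use that L2_loc_int loc_intD in blast)+
  define P where "P x = wderiv u1 x - wderiv u2 x" for x
  define u where "u x = (c1 - c2) + prim P x" for x
  \<comment> \<open>\<open>p\<close> is the continuous representative of \<open>P\<close>. It is
    built from the continuous function \<open>u\<close> rather than from second weak derivatives,
    which makes it classically differentiable.\<close>
  define p where "p x = (d1 - d2) + prim (\<lambda>x. m\<^sup>2 *s u x) x" for x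
  have PL: "P \<in> L2" unfolding P_def by (rule L2_diff[OF r1(2) r2(2)])
  have AEu: "AE x in half_line. u1 x - u2 x = u x"
    using r1(4) r2(4) by eventually_elim (simp add: u_def P_def[abs_def] prim_diff[OF r1(2) r2(2)])
  have cu: "continuous_on {0..} u" unfolding u_def by (intro continuous_intros continuous_on_prim L2_loc_int PL)
  have uL: "u \<in> L2"
    by (rule L2_AE_cong[OF L2_diff[OF r1(1) r2(1)]]) (use AEu in eventually_elim, simp)
  have AEQ: "AE x in half_line. m\<^sup>2 *s u x = wderiv (wderiv u1) x - wderiv (wderiv u2) x"
  proof -
    have "AE z in half_line. lam *s u1 z - A_op \<nu> \<xi> u1 z = f z" "AE z in half_line. lam *s u2 z - A_op \<nu> \<xi> u2 z = f z"
      using u1 u2 by (auto simp: resolvent_eq_def)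
    with AEu show ?thesis
    proof eventually_elim
      case (elim z)
      have "(m\<^sup>2 *s u z) $ i = (wderiv (wderiv u1) z - wderiv (wderiv u2) z) $ i" for i
      proof -
        have e: "(lam + of_real (\<nu> * (xi_norm \<xi>)\<^sup>2)) * v z $ i = f z $ i + of_real \<nu> * wderiv (wderiv v) z $ i"
          if "lam *s v z - A_op \<nu> \<xi> v z = f z" for v
          using arg_cong[OF that, of "\<lambda>x. x $ i"]
          by (simp add: A_op_def scaleR_conv_of_real[where 'a=complex] algebra_simps)
        have "of_real \<nu> * m\<^sup>2 * (u1 z $ i - u2 z $ i) = of_real \<nu> * (wderiv (wderiv u1) z $ i - wderiv (wderiv u2) z $ i)"
          using e[OF elim(2)] e[OF elim(3)] unfolding m2 by (simp add: algebra_simps)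
        hence "m\<^sup>2 * (u1 z $ i - u2 z $ i) = wderiv (wderiv u1) z $ i - wderiv (wderiv u2) z $ i"
          using nu by (simp add: mult.assoc)
        thus ?thesis using elim(1) by (metis vector_minus_component vector_smult_component)
      qed
      thus ?case by (simp add: vec_eq_iff)
    qed
  qed
  have cmu: "continuous_on {0..} (\<lambda>x. m\<^sup>2 *s u x)"
    by (rule bounded_linear.continuous_on[OF bounded_linear_vsm_right cu])
  have cp: "continuous_on {0..} p" unfolding p_def
    by (intro continuous_intros continuous_on_prim loc_int_continuous cmu)
  have AEP: "AE x in half_line. P x = p x"
  proof -
    have "prim (\<lambda>x. m\<^sup>2 *s u x) y = prim (wderiv (wderiv u1)) y - prim (wderiv (wderiv u2)) y" for y
      using prim_AE_cong[OF L2_loc_int[OF L2_diff[OF r1(3) r2(3)]] AEQ] prim_diff[OF r1(3) r2(3)] by simp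
    thus ?thesis using r1(5) r2(5) by (auto simp: P_def p_def elim: eventually_elim2)
  qed
  have AEP': "AE x in half_line. p x = P x" using AEP by eventually_elim simp
  have pL: "p \<in> L2" by (rule L2_AE_cong[OF PL AEP'])
  have u_eq: "u x = (c1 - c2) + prim p x" for x
    unfolding u_def by (subst prim_AE_cong[OF L2_loc_int[OF pL] AEP]) simp
  have du: "(u has_vector_derivative p x) (at x within {0..})" if "x \<ge> 0" for x
  proof -
    have "((\<lambda>x. (c1 - c2) + prim p x) has_vector_derivative 0 + p x) (at x within {0..})"
      by (intro has_vector_derivative_add has_vector_derivative_const prim_has_vector_derivative cp that)
    thus ?thesis by (simp add: u_eq[symmetric])
  qed
  have dp: "(p has_vector_derivative m\<^sup>2 *s u x) (at x within {0..})" if "x \<ge> 0" for x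
  proof -
    have "((\<lambda>x. (d1 - d2) + prim (\<lambda>x. m\<^sup>2 *s u x) x) has_vector_derivative 0 + m\<^sup>2 *s u x) (at x within {0..})"
      by (intro has_vector_derivative_add has_vector_derivative_const prim_has_vector_derivative cmu that)
    thus ?thesis by (simp add: p_def[symmetric])
  qed
  have dmu: "((\<lambda>x. m *s u x) has_vector_derivative m *s p x) (at x within {0..})" if "x \<ge> 0" for x
    by (rule bounded_linear.has_vector_derivative[OF bounded_linear_vsm_right du[OF that]])
  define q where "q x = p x + m *s u x" for x
  have "(q has_vector_derivative m *s q x) (at x within {0..})" if "x \<ge> 0" for x
  proof -
    have "(q has_vector_derivative m\<^sup>2 *s u x + m *s p x) (at x within {0..})"
      unfolding q_def by (intro has_vector_derivative_add dp dmu that)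
    moreover have "m\<^sup>2 *s u x + m *s p x = m *s q x" by (simp add: q_def vec_eq_iff power2_eq_square algebra_simps)
    ultimately show ?thesis by simp
  qed
  hence q: "q x = exp (m * of_real x) *s q 0" if "x \<ge> 0" for x using ode_exp_unique[of q m x] that by blast
  have "q 0 = 0"
    by (rule L2_exp_growth_zero[OF _ _ q]) (use m L2_add[OF pL L2_scale[OF uL]] in \<open>auto simp: q_def[abs_def]\<close>)
  hence "q x = 0" if "x \<ge> 0" for x using q[OF that] by (simp add: vec_eq_iff)
  hence pu: "p x = (- m) *s u x" if "x \<ge> 0" for x
    using that by (simp add: q_def vec_eq_iff eq_neg_iff_add_eq_0)
  have u0: "u 0 = c1 - c2" and p0: "p 0 = d1 - d2" by (simp_all add: u_def p_def prim_0)
  have "u 0 = 0"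
  proof (rule boundary_condition_injective[OF xi])
    show "m \<noteq> 0" using m by auto
    show "m \<noteq> of_real (xi_norm \<xi>)" unfolding m_def by (rule mu_neq_xi_norm[OF nu lam(2)])
    have "- ((- m) *s u 0 + xi_norm \<xi> *\<^sub>R u 0) + xi_mat \<xi> *v u 0 = - ((d1 - d2) + xi_norm \<xi> *\<^sub>R (c1 - c2)) + xi_mat \<xi> *v (c1 - c2)"
      using pu[of 0] unfolding u0 p0 by simp
    also have "\<dots> = (- (d1 + xi_norm \<xi> *\<^sub>R c1) + xi_mat \<xi> *v c1) - (- (d2 + xi_norm \<xi> *\<^sub>R c2) + xi_mat \<xi> *v c2)"
      by (simp add: matrix_vector_mult_diff_distrib algebra_simps)
    finally show "- ((- m) *s u 0 + xi_norm \<xi> *\<^sub>R u 0) + xi_mat \<xi> *v u 0 = 0" using r1(6) r2(6) by simp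
  qed
  hence "u x = 0" if "x \<ge> 0" for x
    using ode_exp_unique[of u "- m" x] du pu that by simp
  hence "AE x in half_line. u x = 0" by (intro AE_I2) simp
  with AEu show ?thesis by eventually_elim simp
qed

section \<open>Uniqueness of the continuous kernel\<close>

lemma continuous_on_Gker: "continuous_on S (\<lambda>(y, z). Gker \<nu> \<xi> lam y z)"
  unfolding Gker_def Let_def exp_ker_def refl_ker_def case_prod_beta'
  by (intro continuous_intros)

lemma integral_pos_kernel_ne:
  fixes D :: "real \<Rightarrow> complex"
  assumes c: "continuous_on {a..b} D" and ab: "a < b" and pos: "\<And>z. z \<in> {a..b} \<Longrightarrow> Re (w * D z) > 0"
  shows "integral {a..b} D \<noteq> 0"
proof
  assume 0: "integral {a..b} D = 0"
  have cw: "continuous_on {a..b} (\<lambda>z. Re (w * D z))" by (intro continuous_intros c)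
  have "integral {a..b} (\<lambda>z. Re (w * D z)) = Re (w * integral {a..b} D)"
    using integral_linear[OF integrable_continuous_interval[OF c]
      bounded_linear_compose[OF bounded_linear_Re bounded_linear_mult_right[of w]]]
    by (simp only: o_def)
  hence "integral {a..b} (\<lambda>z. Re (w * D z)) = 0" using 0 by simp
  hence "\<forall>z\<in>{a..b}. Re (w * D z) = 0"
    by (subst (asm) integral_eq_0_iff[OF cw]) (use pos ab in \<open>auto intro: less_imp_le\<close>)
  thus False using pos[of a] ab by auto
qed

lemma indicator_axis_L2: "(\<lambda>z. indicator {p..q} z *\<^sub>R axis j 1) \<in> L2"
  unfolding L2_def
proof (intro CollectI conjI)
  show "(\<lambda>z. indicator {p..q} z *\<^sub>R (axis j 1 :: complex^2)) \<in> borel_measurable half_line" by measurable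
  have i: "integrable half_line (\<lambda>z. indicator {..q} z *\<^sub>R (1::real))"
    by (rule loc_intD[OF loc_int_continuous]) auto
  show "integrable half_line (\<lambda>z. (norm (indicator {p..q} z *\<^sub>R (axis j 1 :: complex^2)))\<^sup>2)"
    by (rule Bochner_Integration.integrable_bound[OF i]) (measurable, auto simp: indicator_def norm_axis_1)
qed

text \<open>Suppose an entry differs at a point. Multiplied by the conjugate of its value there, the
  difference has positive real part on a small rectangle to the right of and above that point. The
  indicator of one side, times a unit vector, is then a function \<open>f\<close> on which the
  operators disagree on a set of positive measure.\<close>

lemma kernel_unique:
  assumes K: "continuous_on ({0..} \<times> {0..}) (\<lambda>(y, z). K y z)" "continuous_on ({0..} \<times> {0..}) (\<lambda>(y, z). K' y z)"
    and eq: "\<And>f. f \<in> L2 \<Longrightarrow> AE y in half_line. (LINT z|half_line. K y z *v f z) = (LINT z|half_line. K' y z *v f z)"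
    and yz: "y \<ge> 0" "z \<ge> 0"
  shows "K y z = (K' y z :: complex^2^2)"
proof (rule ccontr)
  assume "K y z \<noteq> K' y z"
  then obtain i j where ij: "K y z $ i $ j \<noteq> K' y z $ i $ j" by (auto simp: vec_eq_iff)
  define D where "D p = K (fst p) (snd p) $ i $ j - K' (fst p) (snd p) $ i $ j" for p
  have cD: "continuous_on ({0..} \<times> {0..}) D"
    unfolding D_def using K by (intro continuous_intros) (auto simp: case_prod_beta')
  define w where "w = cnj (D (y, z))"
  have "D (y, z) \<noteq> 0" using ij by (simp add: D_def)
  moreover have "w * D (y, z) = of_real ((cmod (D (y, z)))\<^sup>2)"
    unfolding w_def complex_norm_square by (rule mult.commute)
  ultimately have pos: "Re (w * D (y, z)) > 0" by (simp only: Re_complex_of_real) simp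
  have "continuous_on ({0..} \<times> {0..}) (\<lambda>p. Re (w * D p))" by (intro continuous_intros cD)
  then obtain d where d: "d > 0" "\<And>p. p \<in> {0..} \<times> {0..} \<Longrightarrow> dist p (y, z) < d \<Longrightarrow> dist (Re (w * D p)) (Re (w * D (y, z))) < Re (w * D (y, z))"
    using pos yz unfolding continuous_on_iff by (metis atLeast_iff mem_Sigma_iff)
  \<comment> \<open>The rectangle has sides \<open>e\<close> and \<open>e / 2\<close>, whose sum is
    below \<open>d\<close>.\<close>
  define e where "e = d / 2"
  have e: "e > 0" using d by (simp add: e_def)
  have pos': "Re (w * D (y', z')) > 0" if "y' \<in> {y..<y+e}" "z' \<in> {z..z+e/2}" for y' z'
  proof -
    have "dist (y', z') (y, z) \<le> dist y' y + dist z' z"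
      unfolding dist_Pair_Pair by (rule order_trans[OF sqrt_sum_squares_le_sum]) auto
    also have "\<dots> < d" using that e by (auto simp: dist_real_def e_def)
    finally have "dist (Re (w * D (y', z'))) (Re (w * D (y, z))) < Re (w * D (y, z))" using that yz by (intro d) auto
    thus ?thesis by (simp add: dist_real_def abs_less_iff)
  qed
  define f where "f x = indicator {z..z+e/2} x *\<^sub>R (axis j 1 :: complex^2)" for x :: real
  have sec: "continuous_on {z..z+e/2} (\<lambda>z'. L y' z')"
    if "continuous_on ({0..} \<times> {0..}) (\<lambda>(y, z). L y z)" "y' \<ge> 0" for L :: "real \<Rightarrow> real \<Rightarrow> complex^2^2" and y'
  proof -
    have "continuous_on {z..z+e/2} (\<lambda>z'. (y', z'))" by (intro continuous_intros)
    moreover have "(\<lambda>z'. (y', z')) ` {z..z+e/2} \<subseteq> {0..} \<times> {0..}" using that(2) yz by auto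
    ultimately have "continuous_on {z..z+e/2} (\<lambda>x. case (y', x) of (y, z) \<Rightarrow> L y z)"
      by (rule continuous_on_compose2[OF that(1)])
    thus ?thesis by simp
  qed
  have int: "(LINT x|half_line. L y' x *v f x) $ i = integral {z..z+e/2} (\<lambda>x. L y' x $ i $ j)"
    if "continuous_on ({0..} \<times> {0..}) (\<lambda>(y, z). L y z)" "y' \<ge> 0" for L :: "real \<Rightarrow> real \<Rightarrow> complex^2^2" and y'
  proof -
    have cs: "continuous_on {z..z+e/2} (\<lambda>x. column j (L y' x))"
      unfolding column_def using sec[OF that] by (intro continuous_intros)
    have "L y' x *v axis j 1 = column j (L y' x)" for x
      by (simp add: matrix_vector_mul_component vec_eq_iff column_def inner_axis matrix_vector_mult_def axis_def if_distrib cong: if_cong)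
    hence "(LINT x|half_line. L y' x *v f x) = (LINT x|half_line. indicator {z..z+e/2} x *\<^sub>R column j (L y' x))"
      by (intro Bochner_Integration.integral_cong refl) (auto simp: f_def indicator_def)
    also have "\<dots> = (LINT x|lebesgue_on {z..z+e/2}. column j (L y' x))"
      unfolding integral_half_line_eq using yz
      by (subst integral_restrict_space) (auto intro!: Bochner_Integration.integral_cong simp: indicator_def)
    also have "\<dots> = integral {z..z+e/2} (\<lambda>x. column j (L y' x))"
      by (rule lebesgue_integral_eq_integral) (auto intro!: continuous_imp_integrable_real cs)
    also have "\<dots> $ i = integral {z..z+e/2} (\<lambda>x. column j (L y' x) $ i)"
      using integral_linear[OF integrable_continuous_interval[OF cs] bounded_linear_vec_nth, of i] by (simp add: o_def)
    finally show ?thesis by (simp add: column_def)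
  qed
  have "AE y' in half_line. (LINT x|half_line. K y' x *v f x) = (LINT x|half_line. K' y' x *v f x)"
    by (rule eq) (unfold f_def, rule indicator_axis_L2)
  hence "AE y' in lebesgue. indicator {y..<y+e} y' = (0::real)"
    unfolding AE_half_line_iff
  proof eventually_elim
    case (elim y')
    show ?case
    proof (rule ccontr)
      assume "indicator {y..<y+e} y' \<noteq> (0::real)"
      hence y': "y' \<in> {y..<y+e}" by (auto simp: indicator_def split: if_splits)
      hence y0: "y' \<ge> 0" using yz by auto
      have c1: "continuous_on {z..z+e/2} (\<lambda>x. K y' x $ i $ j)" "continuous_on {z..z+e/2} (\<lambda>x. K' y' x $ i $ j)"
        using sec[OF K(1) y0] sec[OF K(2) y0] by (auto intro!: continuous_intros)
      have "integral {z..z+e/2} (\<lambda>x. D (y', x)) = integral {z..z+e/2} (\<lambda>x. K y' x $ i $ j) - integral {z..z+e/2} (\<lambda>x. K' y' x $ i $ j)"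
        unfolding D_def using c1 by (simp add: Henstock_Kurzweil_Integration.integral_diff integrable_continuous_interval)
      also have "\<dots> = 0" using elim y0 int[OF K(1) y0] int[OF K(2) y0] by simp
      finally have "integral {z..z+e/2} (\<lambda>x. D (y', x)) = 0" .
      moreover have "integral {z..z+e/2} (\<lambda>x. D (y', x)) \<noteq> 0"
        by (rule integral_pos_kernel_ne[where w = w])
           (use c1 e pos' y' in \<open>auto simp: D_def intro!: continuous_intros\<close>)
      ultimately show False by blast
    qed
  qed
  hence "(LINT y'|lebesgue. indicator {y..<y+e} y') = (0::real)" by (rule integral_eq_zero_AE)
  thus False using e by simp
qed

text \<open>Existence and uniqueness of solutions make \<open>Gker\<close> a resolvent kernel, so
  the choice in \<open>resolvent_kernel\<close> is not vacuous. The chosen kernel is continuous and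
  represents the same operator, and two such kernels agree on the closed quadrant.\<close>

lemma resolvent_kernel_eq:
  assumes nu: "\<nu> > 0" and xi: "\<xi> \<noteq> 0" and lam: "lam \<notin> complex_of_real ` {.. - \<nu> * (xi_norm \<xi>)\<^sup>2}" "lam \<noteq> 0"
    and yz: "y \<ge> 0" "z \<ge> 0"
  shows "resolvent_kernel \<nu> \<xi> lam y z = Gker \<nu> \<xi> lam y z"
proof -
  obtain U C where U: "\<And>f. f \<in> L2 \<Longrightarrow> resolvent_eq \<nu> \<xi> lam f (U f)"
    "\<And>f. f \<in> L2 \<Longrightarrow> l2norm (U f) \<le> C * l2norm f"
    "\<And>f y. f \<in> L2 \<Longrightarrow> y \<ge> 0 \<Longrightarrow> integrable half_line (\<lambda>z. Gker \<nu> \<xi> lam y z *v f z)"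
    "\<And>f y. f \<in> L2 \<Longrightarrow> y \<ge> 0 \<Longrightarrow> U f y = (LINT z|half_line. Gker \<nu> \<xi> lam y z *v f z)"
    using resolvent_solution[OF nu xi lam] by blast
  note unique = resolvent_eq_unique[OF nu xi lam]
  have "is_resolvent_kernel \<nu> \<xi> lam (Gker \<nu> \<xi> lam)"
    unfolding is_resolvent_kernel_def
  proof (intro conjI ballI allI impI)
    show "lam \<in> resolvent_set \<nu> \<xi>"
      unfolding resolvent_set_def using U(1,2) unique by (intro CollectI exI[of _ C] ballI exI[of _ "U _"]) blast
    show "continuous_on ({0..} \<times> {0..}) (\<lambda>(y, z). Gker \<nu> \<xi> lam y z)" by (rule continuous_on_Gker)
    fix f u assume f: "f \<in> L2" and u: "resolvent_eq \<nu> \<xi> lam f u"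
    show "AE y in half_line. integrable half_line (\<lambda>z. Gker \<nu> \<xi> lam y z *v f z) \<and> u y = (LINT z|half_line. Gker \<nu> \<xi> lam y z *v f z)"
      using unique[OF u U(1)[OF f]] AE_half_line_pos
      by eventually_elim (use U(3,4)[OF f] in auto)
  qed
  hence "is_resolvent_kernel \<nu> \<xi> lam (resolvent_kernel \<nu> \<xi> lam)"
    unfolding resolvent_kernel_def by (rule someI[of "is_resolvent_kernel \<nu> \<xi> lam"])
  hence K: "continuous_on ({0..} \<times> {0..}) (\<lambda>(y, z). resolvent_kernel \<nu> \<xi> lam y z)"
    and Kf: "\<And>f u. f \<in> L2 \<Longrightarrow> resolvent_eq \<nu> \<xi> lam f u \<Longrightarrow>
      (AE y in half_line. integrable half_line (\<lambda>z. resolvent_kernel \<nu> \<xi> lam y z *v f z) \<and>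
        u y = (LINT z|half_line. resolvent_kernel \<nu> \<xi> lam y z *v f z))"
    unfolding is_resolvent_kernel_def by blast+
  show ?thesis
  proof (rule kernel_unique[OF K continuous_on_Gker _ yz])
    fix f assume f: "f \<in> L2"
    show "AE y in half_line. (LINT z|half_line. resolvent_kernel \<nu> \<xi> lam y z *v f z) = (LINT z|half_line. Gker \<nu> \<xi> lam y z *v f z)"
      using Kf[OF f U(1)[OF f]] AE_half_line_pos
      by eventually_elim (use U(4)[OF f] in auto)
  qed
qed

section \<open>Deformation of the contour\<close>

definition slit_plane :: "real \<Rightarrow> complex set"
  where "slit_plane b = - complex_of_real ` {.. - b}"

lemma slit_plane_iff: "z \<in> slit_plane b \<longleftrightarrow> Im z \<noteq> 0 \<or> Re z > - b"
proof -
  have "z \<in> complex_of_real ` {.. - b} \<longleftrightarrow> Im z = 0 \<and> Re z \<le> - b"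
    by (auto simp: complex_eq_iff image_iff intro!: bexI[of _ "Re z"])
  thus ?thesis by (auto simp: slit_plane_def)
qed

lemma slit_plane_eq: "slit_plane b = (\<lambda>z. z + of_real b) -` (- \<real>\<^sub>\<le>\<^sub>0)"
  by (auto simp: slit_plane_iff complex_nonpos_Reals_iff)

lemma open_slit_plane: "open (slit_plane b)"
  unfolding slit_plane_eq
  by (rule continuous_open_vimage) (auto intro!: continuous_intros simp: open_Compl)

text \<open>A segment from \<open>0\<close> moves real parts towards \<open>0\<close>, which lies to
  the right of the cut because \<open>b > 0\<close>. Starlikeness supplies primitives of holomorphic
  functions.\<close>

lemma starlike_slit_plane: assumes "b > 0" shows "starlike (slit_plane b)"
  unfolding starlike_def
proof (intro bexI ballI subsetI)
  show "0 \<in> slit_plane b" using assms by (simp add: slit_plane_iff)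
  fix x z assume x: "x \<in> slit_plane b" and "z \<in> closed_segment 0 x"
  then obtain r where r: "0 \<le> r" "r \<le> 1" "z = r *\<^sub>R x" by (auto simp: closed_segment_def)
  show "z \<in> slit_plane b"
  proof (cases "r * Im x = 0")
    case True
    have "r * Re x > - b"
    proof (cases "r = 0 \<or> Re x \<ge> 0")
      case True
      hence "r * Re x \<ge> 0" using r by auto
      thus ?thesis using assms by linarith
    next
      case False
      hence "Re x > - b" using x True by (auto simp: slit_plane_iff)
      moreover have "1 * Re x \<le> r * Re x" using False r by (intro mult_right_mono_neg) auto
      ultimately show ?thesis by simp
    qed
    thus ?thesis by (simp add: r slit_plane_iff)
  qed (simp add: r slit_plane_iff)
qed

text \<open>The winding number is given by the increment of some continuous logarithm of the path.
  Any other continuous logarithm differs from it by a multiple of \<open>2 * pi * \<i>\<close> that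
  is constant along the path, so the increment is the same.\<close>

lemma has_contour_integral_inverse_log:
  fixes q0 :: "real \<Rightarrow> complex"
  assumes p: "valid_path p" "0 \<notin> path_image p"
    and q0: "continuous_on {0..1} q0" "\<And>t. t \<in> {0..1} \<Longrightarrow> p t = exp (q0 t)"
  shows "((\<lambda>z. 1 / z) has_contour_integral (q0 1 - q0 0)) p"
proof -
  obtain q where q: "path q" "pathfinish q - pathstart q = 2 * of_real pi * \<i> * winding_number p 0"
    "\<And>t. t \<in> {0..1} \<Longrightarrow> p t = 0 + exp (q t)"
    using winding_number_as_continuous_log[OF valid_path_imp_path[OF p(1)] p(2)] by blast
  \<comment> \<open>\<open>h\<close> is integer valued and continuous on the parameter interval,
    hence constant.\<close>
  define h where "h t = (q t - q0 t) / (2 * of_real pi * \<i>)" for t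
  have hI: "\<exists>n::int. h t = of_int n" if "t \<in> {0..1}" for t
  proof -
    have "exp (q t) = exp (q0 t)" using q(3)[OF that] q0(2)[OF that] by simp
    then obtain n :: int where "q t = q0 t + (of_int (2 * n) * pi) * \<i>" by (auto simp: exp_eq)
    hence "h t = of_int n" by (simp add: h_def field_simps)
    thus ?thesis by blast
  qed
  have "h constant_on {0..1}"
  proof (rule continuous_discrete_range_constant)
    show "continuous_on {0..1} h" unfolding h_def
      using q(1) q0(1) by (intro continuous_intros) (auto simp: path_def)
    fix x :: real assume x: "x \<in> {0..1}"
    show "\<exists>e>0. \<forall>y. y \<in> {0..1} \<and> h y \<noteq> h x \<longrightarrow> e \<le> norm (h y - h x)"
    proof (intro exI[of _ 1] conjI allI impI)
      fix y assume y: "y \<in> {0..1} \<and> h y \<noteq> h x"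
      obtain n k :: int where nk: "h x = of_int n" "h y = of_int k" using hI x y by blast
      hence "k \<noteq> n" using y by auto
      hence "1 \<le> \<bar>k - n\<bar>" by simp
      hence "(1::real) \<le> \<bar>of_int (k - n)\<bar>" by linarith
      also have "\<dots> = norm (h y - h x)" unfolding nk by (simp only: of_int_diff[symmetric] norm_of_int)
      finally show "1 \<le> norm (h y - h x)" .
    qed auto
  qed auto
  then obtain c where "\<And>t. t \<in> {0..1} \<Longrightarrow> h t = c" by (auto simp: constant_on_def)
  hence "h 0 = h 1" by simp
  hence "q 0 - q0 0 = q 1 - q0 1" by (simp add: h_def)
  hence "q 1 - q 0 = q0 1 - q0 0" by (simp add: algebra_simps)
  hence "2 * of_real pi * \<i> * winding_number p 0 = q0 1 - q0 0"
    using q(2) by (simp add: pathfinish_def pathstart_def)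
  thus ?thesis using has_contour_integral_winding_number[OF p] by simp
qed

text \<open>The residue of \<open>g z / z\<close> at \<open>0\<close> is absorbed into the logarithm along the path, so that
  integrals over long pieces of an admissible path only depend on the endpoints.\<close>

lemma admissible_path_integral:
  assumes b: "\<nu> * (xi_norm \<xi>)\<^sup>2 > 0" and \<gamma>: "admissible_path \<nu> \<xi> \<gamma>"
    and g: "g holomorphic_on slit_plane (\<nu> * (xi_norm \<xi>)\<^sup>2)"
  obtains Q where "\<And>z. z \<notin> \<real>\<^sub>\<le>\<^sub>0 \<Longrightarrow> (Q has_field_derivative g z / z) (at z)"
    "\<And>u v. u < v \<Longrightarrow> (\<lambda>z. g z / z) contour_integrable_on subpath u v \<gamma>"
    "\<forall>\<^sub>F (u, v) in at_bot \<times>\<^sub>F at_top. contour_integral (subpath u v \<gamma>) (\<lambda>z. g z / z) = Q (\<gamma> v) - Q (\<gamma> u)"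
proof -
  define S where "S = slit_plane (\<nu> * (xi_norm \<xi>)\<^sup>2)"
  have oS: "open S" unfolding S_def by (rule open_slit_plane)
  have g: "g holomorphic_on S" using g by (simp add: S_def)
  \<comment> \<open>Subtracting \<open>g 0 / z\<close> leaves a removable singularity at
    \<open>0\<close>, filled by the derivative of \<open>g\<close>. The subtracted term is the one
    handled by the logarithm.\<close>
  define f where "f z = (if z = 0 then deriv g 0 else g z / z - g 0 / z)" for z
  have "(\<lambda>z. if z = 0 then deriv g 0 else g z / z - g 0 / (z - 0)) holomorphic_on S"
    by (rule pole_theorem_open[OF g oS]) auto
  hence f: "f holomorphic_on S" unfolding f_def[abs_def] diff_0_right .
  have "\<exists>P. \<forall>z\<in>S. (P has_field_derivative f z) (at z)"
  proof (rule holomorphic_starlike_primitive[where k = "{}"])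
    show "continuous_on S f" using f by (rule holomorphic_on_imp_continuous_on)
    show "starlike S" unfolding S_def by (rule starlike_slit_plane[OF b])
    show "f field_differentiable at x" if "x \<in> S - {}" for x
      using f oS that by (auto intro: holomorphic_on_imp_differentiable_at)
  qed (use oS in auto)
  then obtain P where P: "\<And>z. z \<in> S \<Longrightarrow> (P has_field_derivative f z) (at z)" by blast
  obtain \<theta> where \<theta>: "continuous_on UNIV \<theta>" "\<And>s. \<gamma> s = of_real (cmod (\<gamma> s)) * cis (\<theta> s)"
    "\<forall>\<^sub>F s in at_bot. \<theta> s \<in> {- pi <..< - (pi/2)}" "\<forall>\<^sub>F s in at_top. \<theta> s \<in> {pi/2 <..< pi}"
    using \<gamma> unfolding admissible_path_def by blast
  have \<gamma>S: "\<gamma> s \<in> S" "\<gamma> s \<noteq> 0" for s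
  proof -
    have "range \<gamma> \<subseteq> - (complex_of_real ` {.. - \<nu> * (xi_norm \<xi>)\<^sup>2} \<union> {0})"
      using \<gamma> unfolding admissible_path_def by blast
    hence "\<gamma> s \<in> - (complex_of_real ` {.. - \<nu> * (xi_norm \<xi>)\<^sup>2} \<union> {0})" by (rule subsetD) (rule rangeI)
    thus "\<gamma> s \<in> S" "\<gamma> s \<noteq> 0" by (simp_all add: S_def slit_plane_def)
  qed
  have vp: "valid_path (subpath u v \<gamma>)" if "u < v" for u v
    using \<gamma> that unfolding admissible_path_def by blast
  \<comment> \<open>Only bounded pieces of the path are known to be valid, after rescaling to the
    unit interval; undoing the rescaling recovers continuity.\<close>
  have cg: "continuous_on {u..v} \<gamma>" if uv: "u < v" for u v
  proof -
    have "continuous_on ((\<lambda>s. (s - u) / (v - u)) ` {u..v}) (subpath u v \<gamma>)"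
      using valid_path_imp_path[OF vp[OF uv]] unfolding path_def
      by (rule continuous_on_subset) (use uv in \<open>auto simp: field_simps\<close>)
    moreover have "continuous_on {u..v} (\<lambda>s. (s - u) / (v - u))" using uv by (intro continuous_intros) auto
    ultimately have "continuous_on {u..v} (subpath u v \<gamma> \<circ> (\<lambda>s. (s - u) / (v - u)))" by (intro continuous_on_compose)
    moreover have "(subpath u v \<gamma> \<circ> (\<lambda>s. (s - u) / (v - u))) s = \<gamma> s" for s
      using uv by (simp add: subpath_def)
    ultimately show ?thesis by (simp add: o_def)
  qed
  define q0 where "q0 s = of_real (ln (cmod (\<gamma> s))) + \<i> * of_real (\<theta> s)" for s
  have eq0: "exp (q0 s) = \<gamma> s" for s
  proof -
    have "exp (complex_of_real (ln (cmod (\<gamma> s)))) = of_real (cmod (\<gamma> s))" using \<gamma>S(2)[of s] by (simp add: exp_of_real)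
    thus ?thesis by (simp only: q0_def exp_add cis_conv_exp[symmetric] \<theta>(2)[symmetric])
  qed
  \<comment> \<open>The integral contains the increment of the continuous logarithm
    \<open>q0\<close>, while \<open>Q\<close> uses the principal one. They need to agree only at the
    two endpoints, however often the path crosses the negative axis between the cut and
    \<open>0\<close>.\<close>
  define Q where "Q z = P z + g 0 * Ln z" for z
  have main: "((\<lambda>z. g z / z) has_contour_integral (P (\<gamma> v) - P (\<gamma> u) + g 0 * (q0 v - q0 u))) (subpath u v \<gamma>)"
    if uv: "u < v" for u v
  proof -
    have im: "path_image (subpath u v \<gamma>) \<subseteq> S - {0}"
      using \<gamma>S by (auto simp: path_image_subpath_gen)
    have 1: "(f has_contour_integral (P (\<gamma> v) - P (\<gamma> u))) (subpath u v \<gamma>)"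
      using contour_integral_primitive[of S P f, OF _ vp[OF uv]] P im
      by (auto intro: has_field_derivative_at_within)
    have cq: "continuous_on {u..v} q0"
      unfolding q0_def using cg[OF uv] \<gamma>S(2) by (intro continuous_intros continuous_on_subset[OF \<theta>(1)]) auto
    have 2: "((\<lambda>z. 1 / z) has_contour_integral ((q0 \<circ> (\<lambda>t. (v - u) * t + u)) 1 - (q0 \<circ> (\<lambda>t. (v - u) * t + u)) 0)) (subpath u v \<gamma>)"
    proof (rule has_contour_integral_inverse_log[OF vp[OF uv]])
      show "0 \<notin> path_image (subpath u v \<gamma>)" using im by auto
      have "(\<lambda>t. (v - u) * t + u) ` {0..1} \<subseteq> {u..v}"
      proof (clarsimp)
        fix t :: real assume t: "0 \<le> t" "t \<le> 1"
        have "0 \<le> (v - u) * t" "(v - u) * t \<le> (v - u) * 1" using uv t by (auto intro!: mult_nonneg_nonneg mult_left_mono)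
        thus "0 \<le> (v - u) * t \<and> (v - u) * t + u \<le> v" by simp
      qed
      thus "continuous_on {0..1} (q0 \<circ> (\<lambda>t. (v - u) * t + u))"
        by (intro continuous_on_compose continuous_intros continuous_on_subset[OF cq])
      show "subpath u v \<gamma> t = exp ((q0 \<circ> (\<lambda>t. (v - u) * t + u)) t)" for t
        by (simp add: subpath_def eq0)
    qed
    have "((\<lambda>z. f z + g 0 * (1 / z)) has_contour_integral (P (\<gamma> v) - P (\<gamma> u) + g 0 * (q0 v - q0 u))) (subpath u v \<gamma>)"
      using has_contour_integral_add[OF 1 has_contour_integral_lmul[OF 2, of "g 0"]] by simp
    thus ?thesis by (rule has_contour_integral_eq) (use im in \<open>auto simp: f_def\<close>)
  qed
  show ?thesis
  proof (rule that[of Q])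
    fix z :: complex assume z: "z \<notin> \<real>\<^sub>\<le>\<^sub>0"
    hence z0: "z \<noteq> 0" by auto
    have "z \<in> S" using z b by (auto simp: S_def slit_plane_iff complex_nonpos_Reals_iff)
    have "(Q has_field_derivative f z + g 0 * (1 / z)) (at z)" unfolding Q_def
      by (rule derivative_eq_intros P \<open>z \<in> S\<close> z refl | simp add: divide_inverse)+
    thus "(Q has_field_derivative g z / z) (at z)" using z0 by (simp add: f_def)
  next
    fix u v :: real assume "u < v"
    thus "(\<lambda>z. g z / z) contour_integrable_on subpath u v \<gamma>" using main unfolding contour_integrable_on_def by blast
  next
    \<comment> \<open>This is where the condition that the path passes \<open>0\<close> on the right
      enters: near both ends the continuous argument \<open>\<theta>\<close> is the principal one,
      so no multiple of the residue is picked up.\<close>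
    have Lnq: "Ln (\<gamma> s) = q0 s" if "- pi < \<theta> s" "\<theta> s \<le> pi" for s
      using Ln_exp[of "q0 s"] that unfolding eq0 by (simp add: q0_def)
    have "\<forall>\<^sub>F u in at_bot. u < 0 \<and> Ln (\<gamma> u) = q0 u"
      using \<theta>(3) eventually_gt_at_bot[of 0] eventually_le_at_bot[of "-1"]
      by eventually_elim (use Lnq pi_gt_zero in auto)
    moreover have "\<forall>\<^sub>F v in at_top. v > 0 \<and> Ln (\<gamma> v) = q0 v"
      using \<theta>(4) eventually_gt_at_top[of 0] by eventually_elim (use Lnq pi_gt_zero in \<open>auto intro: less_trans[of "- pi" 0]\<close>)
    ultimately show "\<forall>\<^sub>F (u, v) in at_bot \<times>\<^sub>F at_top. contour_integral (subpath u v \<gamma>) (\<lambda>z. g z / z) = Q (\<gamma> v) - Q (\<gamma> u)"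
      unfolding eventually_prod_filter
    proof (intro exI conjI allI impI)
      fix u v :: real assume "u < 0 \<and> Ln (\<gamma> u) = q0 u" "v > 0 \<and> Ln (\<gamma> v) = q0 v"
      thus "case (u, v) of (u, v) \<Rightarrow> contour_integral (subpath u v \<gamma>) (\<lambda>z. g z / z) = Q (\<gamma> v) - Q (\<gamma> u)"
        using contour_integral_unique[OF main[of u v]] by (simp add: Q_def algebra_simps)
    qed
  qed
qed

text \<open>In the regions \<open>\<sigma> * Im z \<ge> 1\<close> the primitive is almost constant far to the left: compare two
  points along horizontal rays and a vertical segment that is pushed to \<open>Re z = -\<infinity>\<close>.\<close>

lemma primitive_far_left:
  fixes Q f :: "complex \<Rightarrow> complex" and \<sigma> :: real
  assumes t: "t > 0" and B: "B \<ge> 0"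
    and Q: "\<And>z. \<sigma> * Im z \<ge> 1 \<Longrightarrow> (Q has_field_derivative f z) (at z)"
    and f: "\<And>z. \<sigma> * Im z \<ge> 1 \<Longrightarrow> cmod (f z) \<le> B * exp (t * Re z)"
    and z: "\<sigma> * Im z1 \<ge> 1" "\<sigma> * Im z2 \<ge> 1" and R: "Re z1 \<le> - R" "Re z2 \<le> - R"
  shows "cmod (Q z1 - Q z2) \<le> 2 * (B / t) * exp (- t * R)"
proof -
  have hor: "cmod (Q z - Q (Complex X (Im z))) \<le> (B / t) * exp (t * Re z)"
    if "X < Re z" "\<sigma> * Im z \<ge> 1" for z X
  proof -
    let ?q = "\<lambda>u. Q (of_real u + \<i> * of_real (Im z))"
    have d: "(?q has_vector_derivative f (of_real u + \<i> * of_real (Im z)) * 1) (at u)" for u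
    proof -
      have "((\<lambda>w. Q (w + \<i> * of_real (Im z))) has_field_derivative f (of_real u + \<i> * of_real (Im z)) * 1) (at (of_real u))"
        by (rule DERIV_chain2[OF Q]) (use that in \<open>auto intro!: derivative_eq_intros\<close>)
      from has_vector_derivative_real_field[OF this] show ?thesis .
    qed
    have "norm (?q (Re z) - ?q X) \<le> (B / t) * exp (t * Re z) - (B / t) * exp (t * X)"
    proof (rule differentiable_bound_general[OF that(1)])
      show "continuous_on {X..Re z} ?q"
        using d by (intro continuous_at_imp_continuous_on ballI) (use has_vector_derivative_continuous in blast)
      show "(?q has_vector_derivative f (of_real u + \<i> * of_real (Im z)) * 1) (at u)" for u by (rule d)
      show "((\<lambda>u. (B / t) * exp (t * u)) has_vector_derivative B * exp (t * u)) (at u)" for u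
        unfolding has_real_derivative_iff_has_vector_derivative[symmetric]
        by (rule derivative_eq_intros refl | use t in simp)+
      show "norm (f (of_real u + \<i> * of_real (Im z)) * 1) \<le> B * exp (t * u)" for u
        using f[of "of_real u + \<i> * of_real (Im z)"] that by simp
    qed (use t in \<open>auto intro!: continuous_intros\<close>)
    moreover have "of_real (Re z) + \<i> * of_real (Im z) = z" "of_real X + \<i> * of_real (Im z) = Complex X (Im z)"
      by (auto simp: complex_eq_iff)
    moreover have "0 \<le> (B / t) * exp (t * X)" using t B by simp
    ultimately show ?thesis by (simp add: order_trans)
  qed
  have ver: "cmod (Q (Complex X y2) - Q (Complex X y1)) \<le> B * exp (t * X) * (y2 - y1)"
    if "y1 < y2" "\<sigma> * y1 \<ge> 1" "\<sigma> * y2 \<ge> 1" for X y1 y2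
  proof -
    let ?q = "\<lambda>u. Q (of_real X + \<i> * of_real u)"
    have s1: "\<sigma> * u \<ge> 1" if "y1 \<le> u" "u \<le> y2" for u
    proof (cases "\<sigma> \<ge> 0")
      case True
      thus ?thesis using mult_left_mono[OF that(1), of \<sigma>] \<open>\<sigma> * y1 \<ge> 1\<close> by linarith
    next
      case False
      thus ?thesis using mult_left_mono_neg[OF that(2), of \<sigma>] \<open>\<sigma> * y2 \<ge> 1\<close> by linarith
    qed
    have d: "(?q has_vector_derivative f (of_real X + \<i> * of_real u) * \<i>) (at u)" if "y1 \<le> u" "u \<le> y2" for u
    proof -
      have "((\<lambda>w. Q (of_real X + \<i> * w)) has_field_derivative f (of_real X + \<i> * of_real u) * \<i>) (at (of_real u))"
        by (rule DERIV_chain2[OF Q]) (use s1[OF that] in \<open>auto intro!: derivative_eq_intros\<close>)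
      from has_vector_derivative_real_field[OF this] show ?thesis .
    qed
    have "norm (?q y2 - ?q y1) \<le> B * exp (t * X) * y2 - B * exp (t * X) * y1"
    proof (rule differentiable_bound_general[OF that(1)])
      show "continuous_on {y1..y2} ?q"
        using d by (intro continuous_at_imp_continuous_on ballI) (use has_vector_derivative_continuous in fastforce)
      show "(?q has_vector_derivative f (of_real X + \<i> * of_real u) * \<i>) (at u)" if "y1 < u" "u < y2" for u
        using d[of u] that by simp
      show "((\<lambda>u. B * exp (t * X) * u) has_vector_derivative B * exp (t * X)) (at u)" for u
        unfolding has_real_derivative_iff_has_vector_derivative[symmetric]
        by (rule derivative_eq_intros refl | simp)+
      show "norm (f (of_real X + \<i> * of_real u) * \<i>) \<le> B * exp (t * X)" if "y1 < u" "u < y2" for u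
        using f[of "of_real X + \<i> * of_real u"] s1[of u] that by (simp add: norm_mult)
    qed (auto intro!: continuous_intros)
    moreover have "of_real X + \<i> * of_real u = Complex X u" for u by (simp add: complex_eq_iff)
    ultimately show ?thesis by (simp add: algebra_simps)
  qed
  have ver': "cmod (Q (Complex X (Im z1)) - Q (Complex X (Im z2))) \<le> B * exp (t * X) * \<bar>Im z1 - Im z2\<bar>" for X
    using ver[of "Im z1" "Im z2" X] ver[of "Im z2" "Im z1" X] z
    by (cases "Im z1" "Im z2" rule: linorder_cases) (auto simp: norm_minus_commute)
  have est: "cmod (Q z1 - Q z2) \<le> 2 * (B / t) * exp (- t * R) + B * exp (t * X) * \<bar>Im z1 - Im z2\<bar>"
    if X: "X < Re z1" "X < Re z2" for X
  proof -
    have ex: "exp (t * Re z1) \<le> exp (- t * R)" "exp (t * Re z2) \<le> exp (- t * R)"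
      using R t mult_left_mono[of "Re z1" "- R" t] mult_left_mono[of "Re z2" "- R" t] by auto
    have Bt: "B / t \<ge> 0" using B t by simp
    have e: "(B / t) * exp (t * Re z1) \<le> (B / t) * exp (- t * R)" "(B / t) * exp (t * Re z2) \<le> (B / t) * exp (- t * R)"
      by (rule mult_left_mono[OF ex(1) Bt], rule mult_left_mono[OF ex(2) Bt])
    have "Q z1 - Q z2 = (Q z1 - Q (Complex X (Im z1))) + (Q (Complex X (Im z1)) - Q (Complex X (Im z2))) - (Q z2 - Q (Complex X (Im z2)))"
      by simp
    also have "cmod \<dots> \<le> cmod (Q z1 - Q (Complex X (Im z1))) + cmod (Q (Complex X (Im z1)) - Q (Complex X (Im z2))) + cmod (Q z2 - Q (Complex X (Im z2)))"
      by (intro order_trans[OF norm_triangle_ineq4] add_right_mono norm_triangle_ineq)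
    finally show ?thesis using hor[OF X(1) z(1)] hor[OF X(2) z(2)] ver'[of X] e by linarith
  qed
  show ?thesis
  proof (rule tendsto_lowerbound)
    have "((\<lambda>X. 2 * (B / t) * exp (- t * R) + B * exp (t * X) * \<bar>Im z1 - Im z2\<bar>) \<longlongrightarrow>
      2 * (B / t) * exp (- t * R) + B * 0 * \<bar>Im z1 - Im z2\<bar>) at_bot"
      by (intro tendsto_intros filterlim_compose[OF exp_at_bot] filterlim_tendsto_pos_mult_at_bot[OF tendsto_const t filterlim_ident])
    thus "((\<lambda>X. 2 * (B / t) * exp (- t * R) + B * exp (t * X) * \<bar>Im z1 - Im z2\<bar>) \<longlongrightarrow> 2 * (B / t) * exp (- t * R)) at_bot" by simp
    show "\<forall>\<^sub>F X in at_bot. cmod (Q z1 - Q z2) \<le> 2 * (B / t) * exp (- t * R) + B * exp (t * X) * \<bar>Im z1 - Im z2\<bar>"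
      using eventually_gt_at_bot[of "Re z1"] eventually_gt_at_bot[of "Re z2"]
      by eventually_elim (rule est)
  qed auto
qed

text \<open>\<open>\<beta>\<close> is a comparison curve whose ends enter the same two far-left
  regions as those of \<open>\<gamma>\<close>. Along both curves one primitive \<open>Q\<close>
  governs the increments, and \<open>Q\<close> hardly varies in those regions. The limit
  \<open>lim\<close> is required for every primitive because \<open>Q\<close> is provided by
  \<open>\<gamma>\<close>.\<close>

lemma improper_contour_integral_deform:
  fixes \<beta> :: "real \<Rightarrow> complex"
  assumes b: "\<nu> * (xi_norm \<xi>)\<^sup>2 > 0" and \<gamma>: "admissible_path \<nu> \<xi> \<gamma>" and t: "t > 0"
    and g: "g holomorphic_on slit_plane (\<nu> * (xi_norm \<xi>)\<^sup>2)"
    and B: "\<And>z. \<bar>Im z\<bar> \<ge> 1 \<Longrightarrow> cmod (g z / z) \<le> B * exp (t * Re z)"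
    and \<beta>: "filterlim (\<lambda>T. Re (\<beta> T)) at_bot at_top" "filterlim (\<lambda>T. Im (\<beta> T)) at_top at_top"
       "filterlim (\<lambda>T. Re (\<beta> (- T))) at_bot at_top" "filterlim (\<lambda>T. Im (\<beta> (- T))) at_bot at_top"
    and lim: "\<And>Q. (\<And>z. z \<notin> \<real>\<^sub>\<le>\<^sub>0 \<Longrightarrow> (Q has_field_derivative g z / z) (at z)) \<Longrightarrow>
      ((\<lambda>T. Q (\<beta> T) - Q (\<beta> (- T))) \<longlongrightarrow> L) at_top"
  shows "has_improper_contour_integral (\<lambda>z. g z / z) L \<gamma>"
proof -
  obtain Q where Q: "\<And>z. z \<notin> \<real>\<^sub>\<le>\<^sub>0 \<Longrightarrow> (Q has_field_derivative g z / z) (at z)"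
    "\<And>u v. u < v \<Longrightarrow> (\<lambda>z. g z / z) contour_integrable_on subpath u v \<gamma>"
    "\<forall>\<^sub>F (u, v) in at_bot \<times>\<^sub>F at_top. contour_integral (subpath u v \<gamma>) (\<lambda>z. g z / z) = Q (\<gamma> v) - Q (\<gamma> u)"
    using admissible_path_integral[OF b \<gamma> g] by blast
  have "0 \<le> cmod (g \<i> / \<i>)" by simp
  also have "\<dots> \<le> B * exp (t * Re \<i>)" by (rule B) simp
  finally have B0: "B \<ge> 0" by simp
  have far: "cmod (Q z1 - Q z2) \<le> 2 * (B / t) * exp (- t * R)"
    if "\<sigma> \<in> {1, -1}" "\<sigma> * Im z1 \<ge> 1" "\<sigma> * Im z2 \<ge> 1" "Re z1 \<le> - R" "Re z2 \<le> - R" for \<sigma> z1 z2 R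
  proof (rule primitive_far_left[OF t B0 _ _ that(2-5)])
    fix z assume z: "1 \<le> \<sigma> * Im z"
    show "(Q has_field_derivative g z / z) (at z)" using z by (intro Q(1)) (auto simp: complex_nonpos_Reals_iff)
    show "cmod (g z / z) \<le> B * exp (t * Re z)" using z that(1) by (intro B) auto
  qed
  have "((\<lambda>(u, v). contour_integral (subpath u v \<gamma>) (\<lambda>z. g z / z)) \<longlongrightarrow> L) (at_bot \<times>\<^sub>F at_top)"
  proof (rule tendstoI)
    fix e :: real assume e: "e > 0"
    have "((\<lambda>R. 2 * (B / t) * exp (- t * R)) \<longlongrightarrow> 2 * (B / t) * 0) at_top"
      by (intro tendsto_intros filterlim_compose[OF exp_at_bot] filterlim_tendsto_neg_mult_at_bot[OF tendsto_const _ filterlim_ident])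
         (use t in auto)
    hence "\<forall>\<^sub>F R in at_top. 2 * (B / t) * exp (- t * R) < e / 4" using e by (intro order_tendstoD) auto
    then obtain R where R: "2 * (B / t) * exp (- t * R) < e / 4" by (auto simp: eventually_at_top_linorder)
    have "\<forall>\<^sub>F T in at_top. dist (Q (\<beta> T) - Q (\<beta> (- T))) L < e / 4"
      using tendstoD[OF lim[OF Q(1)], of "e / 4"] e by simp
    moreover have "\<forall>\<^sub>F T in at_top. Re (\<beta> T) \<le> - R" "\<forall>\<^sub>F T in at_top. Re (\<beta> (- T)) \<le> - R"
      "\<forall>\<^sub>F T in at_top. Im (\<beta> T) \<ge> 1" "\<forall>\<^sub>F T in at_top. Im (\<beta> (- T)) \<le> -1"
      using \<beta> unfolding filterlim_at_top filterlim_at_bot by blast+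
    ultimately have "\<forall>\<^sub>F T in at_top. dist (Q (\<beta> T) - Q (\<beta> (- T))) L < e / 4 \<and> Re (\<beta> T) \<le> - R \<and> Re (\<beta> (- T)) \<le> - R \<and>
        Im (\<beta> T) \<ge> 1 \<and> Im (\<beta> (- T)) \<le> -1" by eventually_elim auto
    then obtain T where T: "dist (Q (\<beta> T) - Q (\<beta> (- T))) L < e / 4" "Re (\<beta> T) \<le> - R" "Re (\<beta> (- T)) \<le> - R"
        "Im (\<beta> T) \<ge> 1" "Im (\<beta> (- T)) \<le> -1"
      unfolding eventually_at_top_linorder by (meson order_refl)
    have "\<forall>\<^sub>F u in at_bot. Re (\<gamma> u) \<le> - R \<and> Im (\<gamma> u) \<le> -1"
    proof -
      have "filterlim (\<lambda>s. Re (\<gamma> s)) at_bot at_bot" "filterlim (\<lambda>s. Im (\<gamma> s)) at_bot at_bot"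
        using \<gamma> unfolding admissible_path_def by blast+
      thus ?thesis unfolding filterlim_at_bot by (intro eventually_conj) blast+
    qed
    moreover have "\<forall>\<^sub>F v in at_top. Re (\<gamma> v) \<le> - R \<and> Im (\<gamma> v) \<ge> 1"
    proof -
      have "filterlim (\<lambda>s. Re (\<gamma> s)) at_bot at_top" "filterlim (\<lambda>s. Im (\<gamma> s)) at_top at_top"
        using \<gamma> unfolding admissible_path_def by blast+
      thus ?thesis unfolding filterlim_at_bot filterlim_at_top by (intro eventually_conj) blast+
    qed
    ultimately have "\<forall>\<^sub>F (u, v) in at_bot \<times>\<^sub>F at_top. (Re (\<gamma> u) \<le> - R \<and> Im (\<gamma> u) \<le> -1) \<and> (Re (\<gamma> v) \<le> - R \<and> Im (\<gamma> v) \<ge> 1)"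
      unfolding eventually_prod_filter by (intro exI conjI) auto
    with Q(3) show "\<forall>\<^sub>F p in at_bot \<times>\<^sub>F at_top. dist (case p of (u, v) \<Rightarrow> contour_integral (subpath u v \<gamma>) (\<lambda>z. g z / z)) L < e"
    proof eventually_elim
      case (elim p)
      obtain u v where p: "p = (u, v)" by (cases p)
      have eq: "contour_integral (subpath u v \<gamma>) (\<lambda>z. g z / z) = Q (\<gamma> v) - Q (\<gamma> u)" using elim(1) by (simp add: p)
      have uv: "Re (\<gamma> u) \<le> - R" "Im (\<gamma> u) \<le> -1" "Re (\<gamma> v) \<le> - R" "Im (\<gamma> v) \<ge> 1" using elim(2) by (auto simp: p)
      have 1: "cmod (Q (\<gamma> v) - Q (\<beta> T)) < e / 4"
        using far[of 1 "\<gamma> v" "\<beta> T" R] uv T R by simp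
      have 2: "cmod (Q (\<gamma> u) - Q (\<beta> (- T))) < e / 4"
        using far[of "-1" "\<gamma> u" "\<beta> (- T)" R] uv T R by simp
      have 3: "cmod (Q (\<beta> T) - Q (\<beta> (- T)) - L) < e / 4" using T(1) by (simp add: dist_norm)
      have "Q (\<gamma> v) - Q (\<gamma> u) - L = (Q (\<gamma> v) - Q (\<beta> T)) - (Q (\<gamma> u) - Q (\<beta> (- T))) + (Q (\<beta> T) - Q (\<beta> (- T)) - L)" by simp
      also have "cmod \<dots> \<le> cmod (Q (\<gamma> v) - Q (\<beta> T)) + cmod (Q (\<gamma> u) - Q (\<beta> (- T))) + cmod (Q (\<beta> T) - Q (\<beta> (- T)) - L)"
        by (intro order_trans[OF norm_triangle_ineq] add_right_mono norm_triangle_ineq4)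
      also have "\<dots> < e" using 1 2 3 e by linarith
      finally show ?case by (simp add: p eq dist_norm)
    qed
  qed
  thus ?thesis unfolding has_improper_contour_integral_def using Q(2) by blast
qed

section \<open>Rules for improper contour integrals\<close>

lemma improper_contour_integral_eqI:
  assumes "has_improper_contour_integral f I \<gamma>"
  shows "improper_contour_integral \<gamma> f = I"
  unfolding improper_contour_integral_def
proof (rule the_equality[of _ I])
  fix J assume "has_improper_contour_integral f J \<gamma>"
  with assms show "J = I" unfolding has_improper_contour_integral_def
    by (intro tendsto_unique[of "at_bot \<times>\<^sub>F at_top"]) (auto simp: prod_filter_eq_bot)
qed fact

lemma has_improper_contour_integral_add:
  assumes "has_improper_contour_integral f I \<gamma>" "has_improper_contour_integral g J \<gamma>"
  shows "has_improper_contour_integral (\<lambda>z. f z + g z) (I + J) \<gamma>"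
  unfolding has_improper_contour_integral_def
proof (intro conjI allI impI)
  fix u v :: real assume uv: "u < v"
  show "(\<lambda>z. f z + g z) contour_integrable_on subpath u v \<gamma>"
    using assms uv unfolding has_improper_contour_integral_def by (intro contour_integrable_add) auto
next
  have "((\<lambda>p. (case p of (u, v) \<Rightarrow> contour_integral (subpath u v \<gamma>) f) + (case p of (u, v) \<Rightarrow> contour_integral (subpath u v \<gamma>) g)) \<longlongrightarrow> I + J) (at_bot \<times>\<^sub>F at_top)"
    using assms unfolding has_improper_contour_integral_def by (intro tendsto_add) auto
  moreover have "\<forall>\<^sub>F p in at_bot \<times>\<^sub>F at_top. (case p of (u, v) \<Rightarrow> contour_integral (subpath u v \<gamma>) f) + (case p of (u, v) \<Rightarrow> contour_integral (subpath u v \<gamma>) g)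
      = (case p of (u, v) \<Rightarrow> contour_integral (subpath u v \<gamma>) (\<lambda>z. f z + g z))"
    unfolding eventually_prod_filter
  proof (intro exI conjI allI impI)
    show "\<forall>\<^sub>F u in at_bot. u < (0::real)" by (rule eventually_gt_at_bot)
    show "\<forall>\<^sub>F v in at_top. (0::real) < v" by (rule eventually_gt_at_top)
    fix u v :: real assume "u < 0" "0 < v"
    hence "u < v" by simp
    thus "(case (u, v) of (u, v) \<Rightarrow> contour_integral (subpath u v \<gamma>) f) + (case (u, v) of (u, v) \<Rightarrow> contour_integral (subpath u v \<gamma>) g)
      = (case (u, v) of (u, v) \<Rightarrow> contour_integral (subpath u v \<gamma>) (\<lambda>z. f z + g z))"
      using assms unfolding has_improper_contour_integral_def by (auto simp: contour_integral_add)
  qed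
  ultimately show "((\<lambda>(u, v). contour_integral (subpath u v \<gamma>) (\<lambda>z. f z + g z)) \<longlongrightarrow> I + J) (at_bot \<times>\<^sub>F at_top)"
    using Lim_transform_eventually by blast
qed

lemma has_improper_contour_integral_cmul:
  assumes "has_improper_contour_integral f I \<gamma>"
  shows "has_improper_contour_integral (\<lambda>z. c * f z) (c * I) \<gamma>"
  unfolding has_improper_contour_integral_def
proof (intro conjI allI impI)
  fix u v :: real assume uv: "u < v"
  show "(\<lambda>z. c * f z) contour_integrable_on subpath u v \<gamma>"
    using assms uv unfolding has_improper_contour_integral_def by (intro contour_integrable_lmul) auto
next
  have "((\<lambda>p. c * (case p of (u, v) \<Rightarrow> contour_integral (subpath u v \<gamma>) f)) \<longlongrightarrow> c * I) (at_bot \<times>\<^sub>F at_top)"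
    using assms unfolding has_improper_contour_integral_def by (intro tendsto_intros) auto
  moreover have "\<forall>\<^sub>F p in at_bot \<times>\<^sub>F at_top. c * (case p of (u, v) \<Rightarrow> contour_integral (subpath u v \<gamma>) f)
      = (case p of (u, v) \<Rightarrow> contour_integral (subpath u v \<gamma>) (\<lambda>z. c * f z))"
    unfolding eventually_prod_filter
  proof (intro exI conjI allI impI)
    show "\<forall>\<^sub>F u in at_bot. u < (0::real)" by (rule eventually_gt_at_bot)
    show "\<forall>\<^sub>F v in at_top. (0::real) < v" by (rule eventually_gt_at_top)
    fix u v :: real assume "u < 0" "0 < v"
    hence "u < v" by simp
    thus "c * (case (u, v) of (u, v) \<Rightarrow> contour_integral (subpath u v \<gamma>) f)
      = (case (u, v) of (u, v) \<Rightarrow> contour_integral (subpath u v \<gamma>) (\<lambda>z. c * f z))"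
      using assms unfolding has_improper_contour_integral_def by (auto simp: contour_integral_lmul)
  qed
  ultimately show "((\<lambda>(u, v). contour_integral (subpath u v \<gamma>) (\<lambda>z. c * f z)) \<longlongrightarrow> c * I) (at_bot \<times>\<^sub>F at_top)"
    using Lim_transform_eventually by blast
qed

text \<open>Agreement on the path is all that can be asked for: \<open>resolvent_kernel\<close> is
  identified with a formula only off the cut and off \<open>0\<close>.\<close>

lemma has_improper_contour_integral_cong:
  assumes "has_improper_contour_integral f I \<gamma>" "\<And>s. f (\<gamma> s) = g (\<gamma> s)"
  shows "has_improper_contour_integral g I \<gamma>"
proof -
  have eq: "f z = g z" if "z \<in> path_image (subpath u v \<gamma>)" for z u v
    using that assms(2) by (auto simp: path_image_subpath_gen)
  have "f contour_integrable_on subpath u v \<gamma> \<Longrightarrow> g contour_integrable_on subpath u v \<gamma>" for u v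
    by (erule contour_integrable_eq) (rule eq)
  moreover have "contour_integral (subpath u v \<gamma>) f = contour_integral (subpath u v \<gamma>) g" for u v
    by (rule contour_integral_eq) (auto intro: eq)
  ultimately show ?thesis using assms(1) unfolding has_improper_contour_integral_def by auto
qed

section \<open>Gaussian integrals over the deformed contour\<close>

text \<open>For functions on \<open>borel\<close> these rules lead the measurability prover to the false goal
  \<open>(\<lambda>x. x) \<in> borel \<rightarrow>\<^sub>M lebesgue\<close>.\<close>

declare measurable_ident_lebesgue [measurable del] measurable_ident_half_line [measurable del]

lemma integrable_gauss:
  assumes "k > 0" shows "integrable lborel (\<lambda>s. exp (- (k * s\<^sup>2)) :: real)"
proof -
  define \<sigma> where "\<sigma> = 1 / sqrt (2 * k)"
  have \<sigma>: "\<sigma> > 0" "2 * \<sigma>\<^sup>2 = 1 / k" using assms by (auto simp: \<sigma>_def power_divide)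
  have "integrable lborel (\<lambda>s. sqrt (2 * pi * \<sigma>\<^sup>2) * normal_density 0 \<sigma> s)"
    using \<sigma> by (intro integrable_mult_right integrable_normal_density)
  moreover have "sqrt (2 * pi * \<sigma>\<^sup>2) * normal_density 0 \<sigma> s = exp (- (k * s\<^sup>2))" for s
    using \<sigma> by (simp add: normal_density_def mult.commute)
  ultimately show ?thesis by simp
qed

text \<open>After rescaling this is the characteristic function of the standard normal
  distribution.\<close>

lemma gauss_fourier:
  assumes k: "k > 0"
  shows "(LINT s|lborel. exp (of_real (- (k * s\<^sup>2)) + \<i> * of_real (w * s))) = complex_of_real (sqrt (pi / k) * exp (- (w\<^sup>2 / (4 * k))))"
proof -
  \<comment> \<open>Chosen so that \<open>k * (r * x)\<^sup>2 = x\<^sup>2 / 2\<close>.\<close>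
  define r where "r = 1 / sqrt (2 * k)"
  have r: "r > 0" "r\<^sup>2 = 1 / (2 * k)" using k by (auto simp: r_def power_divide)
  have "(LINT s|lborel. exp (of_real (- (k * s\<^sup>2)) + \<i> * of_real (w * s)))
     = \<bar>r\<bar> *\<^sub>R (LINT x|lborel. exp (of_real (- (k * (0 + r * x)\<^sup>2)) + \<i> * of_real (w * (0 + r * x))))"
    by (rule lborel_integral_real_affine) (use r in simp)
  also have "(LINT x|lborel. exp (of_real (- (k * (0 + r * x)\<^sup>2)) + \<i> * of_real (w * (0 + r * x))))
     = (LINT x|lborel. sqrt (2 * pi) *\<^sub>R (std_normal_density x *\<^sub>R iexp ((w * r) * x)))"
  proof (rule Bochner_Integration.integral_cong[OF refl])
    fix x
    have e: "k * (0 + r * x)\<^sup>2 = x\<^sup>2 / 2" using k r by (simp add: power_mult_distrib)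
    show "exp (of_real (- (k * (0 + r * x)\<^sup>2)) + \<i> * of_real (w * (0 + r * x))) = sqrt (2 * pi) *\<^sub>R (std_normal_density x *\<^sub>R iexp ((w * r) * x))"
      unfolding e exp_add exp_of_real
      by (simp add: std_normal_density_def scaleR_conv_of_real[where 'a=complex] mult_ac exp_of_real[symmetric])
  qed
  also have "\<dots> = sqrt (2 * pi) *\<^sub>R char std_normal_distribution (w * r)"
  proof -
    have "char std_normal_distribution (w * r) = (LINT x|lborel. std_normal_density x *\<^sub>R iexp ((w * r) * x))"
      unfolding char_def by (subst integral_density) auto
    thus ?thesis by (simp only: integral_scaleR_right)
  qed
  also have "char std_normal_distribution (w * r) = of_real (exp (- ((w * r)\<^sup>2) / 2))"
    by (simp add: char_std_normal_distribution)
  also have "(w * r)\<^sup>2 / 2 = w\<^sup>2 / (4 * k)" using r by (simp add: power_mult_distrib)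
  hence "- ((w * r)\<^sup>2) / 2 = - (w\<^sup>2 / (4 * k))" by simp
  also have "\<bar>r\<bar> *\<^sub>R sqrt (2 * pi) *\<^sub>R complex_of_real (exp (- (w\<^sup>2 / (4 * k)))) = of_real ((r * sqrt (2 * pi)) * exp (- (w\<^sup>2 / (4 * k))))"
    using r by (simp add: scaleR_conv_of_real[where 'a=complex])
  also have "r * sqrt (2 * pi) = sqrt (pi / k)"
    using k by (simp add: r_def real_sqrt_divide[symmetric] real_sqrt_mult[symmetric] flip: real_sqrt_divide)
  finally show ?thesis .
qed

text \<open>With \<open>\<lambda> = \<nu> * (\<mu>\<^sup>2 - a\<^sup>2)\<close> the integrand \<open>exp (\<lambda> * t - \<mu> * d)\<close> is Gaussian on the line \<open>Re \<mu> = a + 1\<close>,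
  which passes to the right of the pole \<open>\<mu> = a\<close>.\<close>

definition line_exp :: "real \<Rightarrow> real \<Rightarrow> real \<Rightarrow> real \<Rightarrow> real \<Rightarrow> complex"
  where "line_exp \<nu> a t d s = exp (of_real (\<nu> * t) * ((of_real (a + 1) + \<i> * of_real s)\<^sup>2 - (of_real a)\<^sup>2) - (of_real (a + 1) + \<i> * of_real s) * of_real d)"

definition heat_ker :: "real \<Rightarrow> real \<Rightarrow> real \<Rightarrow> real \<Rightarrow> real"
  where "heat_ker \<nu> a t d = exp (- (d\<^sup>2 / (4 * \<nu> * t))) * exp (- \<nu> * a\<^sup>2 * t) / sqrt (4 * pi * \<nu> * t)"

text \<open>This is \<open>sqrt pi / 2\<close> times the complementary error function.\<close>

definition gauss_tail :: "real \<Rightarrow> real"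
  where "gauss_tail v = (LINT s|lborel. indicator {v..} s * exp (- s\<^sup>2))"

text \<open>In terms of the complementary error function, \<open>exp (- a * x) / a * erfc ((x - 2 *
  a * \<nu> * t) / sqrt (4 * \<nu> * t))\<close>.\<close>

definition refl_part :: "real \<Rightarrow> real \<Rightarrow> real \<Rightarrow> real \<Rightarrow> real"
  where "refl_part \<nu> a t x = 2 / a * exp (- a * x) * gauss_tail ((x - 2 * a * \<nu> * t) / sqrt (4 * \<nu> * t)) / sqrt pi"

lemma line_exp_eq:
  "line_exp \<nu> a t d s = of_real (exp (\<nu> * t * ((a + 1)\<^sup>2 - a\<^sup>2) - (a + 1) * d)) * exp (of_real (- (\<nu> * t * s\<^sup>2)) + \<i> * of_real ((2 * \<nu> * t * (a + 1) - d) * s))"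
  unfolding line_exp_def exp_of_real[symmetric] exp_add[symmetric]
  by (rule arg_cong[where f=exp]) (simp add: power2_eq_square algebra_simps)

lemma line_exp_shift: "line_exp \<nu> a t (x + r) s = line_exp \<nu> a t x s * exp (- (of_real (a + 1) + \<i> * of_real s) * of_real r)"
  unfolding line_exp_def exp_add[symmetric] by (rule arg_cong[where f=exp]) (simp add: algebra_simps)

lemma norm_line_exp: "cmod (line_exp \<nu> a t d s) = exp (\<nu> * t * ((a + 1)\<^sup>2 - a\<^sup>2) - (a + 1) * d) * exp (- (\<nu> * t * s\<^sup>2))"
  unfolding line_exp_eq by (simp add: norm_mult exp_add)

lemma continuous_on_line_exp [continuous_intros]: "continuous_on S (line_exp \<nu> a t d)"
  unfolding line_exp_def by (intro continuous_intros)

lemma line_exp_measurable [measurable]: "line_exp \<nu> a t d \<in> borel_measurable borel"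
  by (rule borel_measurable_continuous_onI) (rule continuous_on_line_exp)

lemma integrable_line_exp:
  assumes "\<nu> > 0" "t > 0" shows "integrable lborel (line_exp \<nu> a t d)"
proof (rule Bochner_Integration.integrable_bound)
  show "integrable lborel (\<lambda>s. exp (\<nu> * t * ((a + 1)\<^sup>2 - a\<^sup>2) - (a + 1) * d) * exp (- (\<nu> * t * s\<^sup>2)))"
    using integrable_gauss[of "\<nu> * t"] assms by (intro integrable_mult_right) simp
qed (auto simp: norm_line_exp)

text \<open>Completing the square cancels the offset \<open>a + 1\<close>: the value does not
  remember the line of integration.\<close>

lemma integral_line_exp:
  assumes nu: "\<nu> > 0" and t: "t > 0"
  shows "(LINT s|lborel. line_exp \<nu> a t d s) = of_real (2 * pi * heat_ker \<nu> a t d)"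
proof -
  \<comment> \<open>The frequency of the oscillation along the line, as separated in
    \<open>line_exp_eq\<close>.\<close>
  define w where "w = 2 * \<nu> * t * (a + 1) - d"
  have k: "\<nu> * t > 0" using assms by simp
  have "(LINT s|lborel. line_exp \<nu> a t d s) = of_real (exp (\<nu> * t * ((a + 1)\<^sup>2 - a\<^sup>2) - (a + 1) * d)) * of_real (sqrt (pi / (\<nu> * t)) * exp (- (w\<^sup>2 / (4 * (\<nu> * t)))))"
    unfolding line_exp_eq w_def[symmetric] using gauss_fourier[OF k, of w] by simp
  also have "\<dots> = of_real (sqrt (pi / (\<nu> * t)) * (exp (\<nu> * t * ((a + 1)\<^sup>2 - a\<^sup>2) - (a + 1) * d) * exp (- (w\<^sup>2 / (4 * (\<nu> * t))))))"
    by simp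
  also have "exp (\<nu> * t * ((a + 1)\<^sup>2 - a\<^sup>2) - (a + 1) * d) * exp (- (w\<^sup>2 / (4 * (\<nu> * t)))) = exp (- (d\<^sup>2 / (4 * \<nu> * t))) * exp (- \<nu> * a\<^sup>2 * t)"
    unfolding exp_add[symmetric] w_def using nu t
    by (intro arg_cong[where f=exp]) (simp add: field_simps power2_eq_square)
  also have "sqrt (pi / (\<nu> * t)) = 2 * pi / sqrt (4 * pi * \<nu> * t)"
  proof -
    have "sqrt (pi / (\<nu> * t)) * sqrt (4 * pi * \<nu> * t) = sqrt ((2 * pi)\<^sup>2)"
      unfolding real_sqrt_mult[symmetric] using nu t by (intro arg_cong[where f=sqrt]) (simp add: power2_eq_square)
    also have "\<dots> = 2 * pi" unfolding real_sqrt_abs by simp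
    finally show ?thesis using nu t by (simp add: field_simps)
  qed
  finally show ?thesis by (simp add: heat_ker_def mult_ac)
qed

lemma integrable_exp_lborel: "integrable lborel (\<lambda>r. indicator {0..} r * exp (- r) :: real)"
proof -
  have "integrable (completion lborel) (\<lambda>r. indicator {0..} r * exp (- r) :: real)"
    using integrable_exp_half_line[of 1] by (simp add: integrable_half_line_iff)
  thus ?thesis by (subst (asm) integrable_completion) auto
qed

text \<open>The case needed is \<open>w = mu - a\<close> on the line \<open>Re mu = a + 1\<close>,
  so \<open>Re w = 1\<close> is the distance from the line to the pole.\<close>

lemma integral_exp_decay:
  fixes w :: complex
  assumes w: "Re w = 1"
  shows "(LINT r|lborel. indicator {0..} r *\<^sub>R exp (- w * of_real r)) = 1 / w"
proof (rule tendsto_unique[OF trivial_limit_at_top_linorder])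
  have w0: "w \<noteq> 0" using w by auto
  show "((\<lambda>T. LINT r|lborel. indicator {0..T} r *\<^sub>R exp (- w * of_real r)) \<longlongrightarrow> (LINT r|lborel. indicator {0..} r *\<^sub>R exp (- w * of_real r))) at_top"
  proof (rule integral_dominated_convergence_at_top[where w = "\<lambda>r. indicator {0..} r * exp (- r)"])
    show "integrable lborel (\<lambda>r. indicator {0..} r * exp (- r) :: real)" by (rule integrable_exp_lborel)
    show "\<forall>\<^sub>F T in at_top. AE r in lborel. norm (indicator {0..T} r *\<^sub>R exp (- w * of_real r)) \<le> indicator {0..} r * exp (- r)"
      using w by (auto simp: indicator_def)
    show "AE r in lborel. ((\<lambda>T. indicator {0..T} r *\<^sub>R exp (- w * of_real r)) \<longlongrightarrow> indicator {0..} r *\<^sub>R exp (- w * of_real r)) at_top"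
    proof (rule AE_I2, rule tendsto_eventually)
      fix r :: real
      show "\<forall>\<^sub>F T in at_top. indicator {0..T} r *\<^sub>R exp (- w * of_real r) = indicator {0..} r *\<^sub>R exp (- w * of_real r)"
        using eventually_ge_at_top[of r] by eventually_elim (auto simp: indicator_def)
    qed
  qed measurable
  have "((\<lambda>T. (1 - exp (- w * of_real T)) / w) \<longlongrightarrow> (1 - 0) / w) at_top"
  proof (intro tendsto_intros w0)
    show "((\<lambda>T. exp (- w * of_real T)) \<longlongrightarrow> 0) at_top"
    proof (rule tendsto_norm_zero_cancel)
      have "((\<lambda>T::real. exp (- T)) \<longlongrightarrow> 0) at_top" by real_asymp
      thus "((\<lambda>T. norm (exp (- w * of_real T))) \<longlongrightarrow> 0) at_top" using w by simp
    qed
  qed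
  moreover have "\<forall>\<^sub>F T in at_top. (1 - exp (- w * of_real T)) / w = (LINT r|lborel. indicator {0..T} r *\<^sub>R exp (- w * of_real r))"
    using eventually_ge_at_top[of 0]
  proof eventually_elim
    case (elim T)
    have "has_bochner_integral lborel (\<lambda>r. indicator {0..T} r *\<^sub>R exp (- w * of_real r)) ((- 1 / w) * exp (- w * of_real T) - (- 1 / w) * exp (- w * of_real 0))"
    proof (rule has_bochner_integral_FTC_Icc[OF elim])
      fix r :: real
      have "((\<lambda>x::real. (- 1 / w) * exp (- w * of_real x)) has_vector_derivative (- 1 / w) * (- w * exp (- w * of_real r))) (at r within {0..T})"
        by (intro has_vector_derivative_mult_right has_vector_derivative_exp_scale)
      thus "((\<lambda>x::real. (- 1 / w) * exp (- w * of_real x)) has_vector_derivative exp (- w * of_real r)) (at r within {0..T})"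
        using w0 by simp
    qed (intro continuous_intros)
    from has_bochner_integral_integral_eq[OF this] show ?case using w0 by (simp add: field_simps)
  qed
  ultimately show "((\<lambda>T. LINT r|lborel. indicator {0..T} r *\<^sub>R exp (- w * of_real r)) \<longlongrightarrow> 1 / w) at_top"
    using Lim_transform_eventually by fastforce
qed

text \<open>Completing the square in \<open>r\<close> shows that the growing weight
  \<open>exp (a * r)\<close> only translates the Gaussian and leaves a factor
  \<open>exp (- a * x)\<close>. Integrating over \<open>r \<ge> 0\<close> then gives a Gaussian
  tail.\<close>

lemma heat_ker_tail_integral:
  assumes nu: "\<nu> > 0" and a: "a > 0" and t: "t > 0"
  shows "2 / a * (LINT r|lborel. indicator {0..} r * (exp (a * r) * heat_ker \<nu> a t (x + r))) = refl_part \<nu> a t x"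
proof -
  define k where "k = sqrt (4 * \<nu> * t)"
  have k: "k > 0" "k\<^sup>2 = 4 * \<nu> * t" using nu t by (auto simp: k_def)
  \<comment> \<open>The image of \<open>r = 0\<close> under the substitution
    \<open>r = k * s - v * k\<close>, which normalises the Gaussian.\<close>
  define v where "v = (x - 2 * a * \<nu> * t) / k"
  have vk: "v * k = x - 2 * a * \<nu> * t" using k by (simp add: v_def)
  have kp: "sqrt (4 * pi * \<nu> * t) = k * sqrt pi" by (simp add: k_def real_sqrt_mult[symmetric] mult_ac)
  have e: "exp (a * r) * heat_ker \<nu> a t (x + r) = exp (- a * x) / (k * sqrt pi) * exp (- ((x + r - 2 * a * \<nu> * t) / k)\<^sup>2)" for r
  proof -
    have "exp (a * r) * (exp (- ((x + r)\<^sup>2 / (4 * \<nu> * t))) * exp (- \<nu> * a\<^sup>2 * t)) = exp (- a * x) * exp (- ((x + r - 2 * a * \<nu> * t) / k)\<^sup>2)"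
      unfolding exp_add[symmetric] power_divide k(2) using nu t
      by (intro arg_cong[where f=exp]) (simp add: field_simps power2_eq_square)
    thus ?thesis unfolding heat_ker_def kp by (simp add: mult_ac)
  qed
  have "(LINT r|lborel. indicator {0..} r * (exp (a * r) * heat_ker \<nu> a t (x + r)))
     = (LINT r|lborel. exp (- a * x) / (k * sqrt pi) * (indicator {0..} r * exp (- ((x + r - 2 * a * \<nu> * t) / k)\<^sup>2)))"
    unfolding e by (simp add: mult_ac)
  also have "\<dots> = exp (- a * x) / (k * sqrt pi) * (LINT r|lborel. indicator {0..} r * exp (- ((x + r - 2 * a * \<nu> * t) / k)\<^sup>2))"
    by simp
  also have "(LINT r|lborel. indicator {0..} r * exp (- ((x + r - 2 * a * \<nu> * t) / k)\<^sup>2))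
     = \<bar>k\<bar> *\<^sub>R (LINT s|lborel. indicator {0..} (- (v * k) + k * s) * exp (- ((x + (- (v * k) + k * s) - 2 * a * \<nu> * t) / k)\<^sup>2))"
    by (rule lborel_integral_real_affine) (use k in simp)
  also have "(LINT s|lborel. indicator {0..} (- (v * k) + k * s) * exp (- ((x + (- (v * k) + k * s) - 2 * a * \<nu> * t) / k)\<^sup>2)) = gauss_tail v"
    unfolding gauss_tail_def
  proof (rule Bochner_Integration.integral_cong[OF refl])
    fix s
    have 1: "indicator {0..} (- (v * k) + k * s) = (indicator {v..} s :: real)"
      using k by (auto simp: indicator_def mult.commute)
    have 2: "(x + (- (v * k) + k * s) - 2 * a * \<nu> * t) / k = s"
      unfolding vk using k by simp
    show "indicator {0..} (- (v * k) + k * s) * exp (- ((x + (- (v * k) + k * s) - 2 * a * \<nu> * t) / k)\<^sup>2) = indicator {v..} s * exp (- s\<^sup>2)"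
      unfolding 1 2 ..
  qed
  finally show ?thesis unfolding refl_part_def k_def[symmetric] v_def[symmetric] using k by simp
qed

text \<open>\<open>1 + \<i> * s\<close> is \<open>mu - a\<close> on the line. In
  \<open>exp (- (mu - a) * r)\<close> the factor \<open>exp (- mu * r)\<close> shifts
  \<open>x\<close> to \<open>x + r\<close>, and \<open>exp (a * r)\<close> becomes the weight of the
  superposition.\<close>

lemma integral_line_exp_pole:
  assumes nu: "\<nu> > 0" and a: "a > 0" and t: "t > 0"
  shows "integrable lborel (\<lambda>s. line_exp \<nu> a t x s / (1 + \<i> * of_real s))"
    and "(LINT s|lborel. line_exp \<nu> a t x s / (1 + \<i> * of_real s)) = of_real (pi * a * refl_part \<nu> a t x)"
proof -
  have ge: "1 \<le> cmod (1 + \<i> * of_real s)" for s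
    using complex_Re_le_cmod[of "1 + \<i> * of_real s"] by simp
  have ne: "1 + \<i> * of_real s \<noteq> 0" for s using ge[of s] by auto
  show "integrable lborel (\<lambda>s. line_exp \<nu> a t x s / (1 + \<i> * of_real s))"
  proof (rule Bochner_Integration.integrable_bound[OF integrable_line_exp[OF nu t]])
    show "AE s in lborel. norm (line_exp \<nu> a t x s / (1 + \<i> * of_real s)) \<le> norm (line_exp \<nu> a t x s)"
    proof (rule AE_I2)
      fix s
      have "cmod (line_exp \<nu> a t x s) / cmod (1 + \<i> * of_real s) \<le> cmod (line_exp \<nu> a t x s) / 1"
        using ge[of s] by (intro divide_left_mono) auto
      thus "norm (line_exp \<nu> a t x s / (1 + \<i> * of_real s)) \<le> norm (line_exp \<nu> a t x s)" by (simp add: norm_divide)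
    qed
  qed measurable
  define C where "C = exp (\<nu> * t * ((a + 1)\<^sup>2 - a\<^sup>2) - (a + 1) * x)"
  \<comment> \<open>Written in this way, \<open>?F\<close> is a weighted heat integrand in
    \<open>s\<close> for fixed \<open>r\<close>; the identity \<open>F\<close> below presents it as
    an exponential in \<open>r\<close> for fixed \<open>s\<close>. The second form also gives the
    product bound for Fubini.\<close>
  let ?F = "\<lambda>s r. indicator {0..} r *\<^sub>R (of_real (exp (a * r)) * line_exp \<nu> a t (x + r) s)"
  have F: "?F s r = line_exp \<nu> a t x s * (indicator {0..} r *\<^sub>R exp (- (1 + \<i> * of_real s) * of_real r))" for s r
  proof -
    have "of_real (exp (a * r)) * exp (- (of_real (a + 1) + \<i> * of_real s) * of_real r) = exp (- (1 + \<i> * of_real s) * of_real r)"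
      unfolding exp_of_real[symmetric] exp_add[symmetric] by (rule arg_cong[where f=exp]) (simp add: algebra_simps)
    thus ?thesis unfolding line_exp_shift by (simp add: mult_ac)
  qed
  have "(LINT s|lborel. line_exp \<nu> a t x s / (1 + \<i> * of_real s)) = (LINT s|lborel. LINT r|lborel. ?F s r)"
  proof (rule Bochner_Integration.integral_cong[OF refl])
    fix s
    have "(LINT r|lborel. ?F s r) = line_exp \<nu> a t x s * (LINT r|lborel. indicator {0..} r *\<^sub>R exp (- (1 + \<i> * of_real s) * of_real r))"
      unfolding F by (rule integral_mult_right_zero)
    also have "(LINT r|lborel. indicator {0..} r *\<^sub>R exp (- (1 + \<i> * of_real s) * of_real r)) = 1 / (1 + \<i> * of_real s)"
      by (rule integral_exp_decay) simp
    finally show "line_exp \<nu> a t x s / (1 + \<i> * of_real s) = (LINT r|lborel. ?F s r)" by simp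
  qed
  also have "\<dots> = (LINT r|lborel. LINT s|lborel. ?F s r)"
  proof (rule pair_sigma_finite.Fubini_product_bound[OF lborel_pair.pair_sigma_finite_axioms])
    show "(\<lambda>p. ?F (fst p) (snd p)) \<in> borel_measurable (lborel \<Otimes>\<^sub>M lborel)"
      unfolding F by measurable
    show "integrable lborel (\<lambda>s. C * exp (- (\<nu> * t * s\<^sup>2)))"
      using integrable_gauss[of "\<nu> * t"] nu t by (intro integrable_mult_right) simp
    show "integrable lborel (\<lambda>r. indicator {0..} r * exp (- r) :: real)" by (rule integrable_exp_lborel)
    show "norm (?F s r) \<le> C * exp (- (\<nu> * t * s\<^sup>2)) * (indicator {0..} r * exp (- r))" for s r
      unfolding F norm_mult norm_line_exp C_def[symmetric] by (simp add: indicator_def)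
  qed
  also have "\<dots> = (LINT r|lborel. of_real (2 * pi * (indicator {0..} r * (exp (a * r) * heat_ker \<nu> a t (x + r)))))"
  proof (rule Bochner_Integration.integral_cong[OF refl])
    fix r
    have "(LINT s|lborel. ?F s r) = indicator {0..} r *\<^sub>R (of_real (exp (a * r)) * (LINT s|lborel. line_exp \<nu> a t (x + r) s))"
      by simp
    also have "\<dots> = of_real (2 * pi * (indicator {0..} r * (exp (a * r) * heat_ker \<nu> a t (x + r))))"
      unfolding integral_line_exp[OF nu t] by (simp add: indicator_def)
    finally show "(LINT s|lborel. ?F s r) = of_real (2 * pi * (indicator {0..} r * (exp (a * r) * heat_ker \<nu> a t (x + r))))" .
  qed
  also have "\<dots> = of_real (2 * pi * (LINT r|lborel. indicator {0..} r * (exp (a * r) * heat_ker \<nu> a t (x + r))))"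
    by (subst integral_complex_of_real) simp
  also have "2 * pi * (LINT r|lborel. indicator {0..} r * (exp (a * r) * heat_ker \<nu> a t (x + r))) = pi * a * refl_part \<nu> a t x"
    unfolding heat_ker_tail_integral[OF nu a t, symmetric] using a by simp
  finally show "(LINT s|lborel. line_exp \<nu> a t x s / (1 + \<i> * of_real s)) = of_real (pi * a * refl_part \<nu> a t x)" .
qed

text \<open>The image of the line \<open>Re mu = a + 1\<close> under
  \<open>lam = \<nu> * (mu\<^sup>2 - a\<^sup>2)\<close>. It crosses the real axis at
  \<open>\<nu> * (2 * a + 1)\<close>, to the right of \<open>0\<close>, and opens to the
  left.\<close>

definition parabola :: "real \<Rightarrow> real \<Rightarrow> real \<Rightarrow> complex"
  where "parabola \<nu> a s = of_real \<nu> * (of_real (a + 1) + \<i> * of_real s)\<^sup>2 - of_real (\<nu> * a\<^sup>2)"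

lemma parabola_Re_Im:
  "Re (parabola \<nu> a s) = \<nu> * ((a + 1)\<^sup>2 - s\<^sup>2) - \<nu> * a\<^sup>2" "Im (parabola \<nu> a s) = 2 * \<nu> * (a + 1) * s"
  by (simp_all add: parabola_def power2_eq_square algebra_simps)

lemma parabola_not_nonpos:
  assumes "\<nu> > 0" "a > 0" shows "parabola \<nu> a s \<notin> \<real>\<^sub>\<le>\<^sub>0"
proof
  assume "parabola \<nu> a s \<in> \<real>\<^sub>\<le>\<^sub>0"
  hence "Re (parabola \<nu> a s) \<le> 0" "Im (parabola \<nu> a s) = 0" by (auto simp: complex_nonpos_Reals_iff)
  hence "s = 0" "\<nu> * ((a + 1)\<^sup>2 - s\<^sup>2) - \<nu> * a\<^sup>2 \<le> 0" using assms by (auto simp: parabola_Re_Im)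
  moreover have "\<nu> * ((a + 1)\<^sup>2 - 0\<^sup>2) - \<nu> * a\<^sup>2 = \<nu> * (2 * a + 1)" by (simp add: power2_eq_square algebra_simps)
  moreover have "\<nu> * (2 * a + 1) > 0" using assms by simp
  ultimately show False by simp
qed

lemma parabola_limits:
  assumes "\<nu> > 0" "a > 0"
  shows "filterlim (\<lambda>T. Re (parabola \<nu> a T)) at_bot at_top" "filterlim (\<lambda>T. Im (parabola \<nu> a T)) at_top at_top"
    "filterlim (\<lambda>T. Re (parabola \<nu> a (- T))) at_bot at_top" "filterlim (\<lambda>T. Im (parabola \<nu> a (- T))) at_bot at_top"
  unfolding parabola_Re_Im using assms by real_asymp+

lemma parabola_deriv:
  "(parabola \<nu> a has_vector_derivative 2 * of_real \<nu> * \<i> * (of_real (a + 1) + \<i> * of_real s)) (at s within S)"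
proof -
  have "((\<lambda>z. of_real \<nu> * (of_real (a + 1) + \<i> * z)\<^sup>2 - of_real (\<nu> * a\<^sup>2)) has_field_derivative
      2 * of_real \<nu> * \<i> * (of_real (a + 1) + \<i> * of_real s)) (at (of_real s))"
    by (auto intro!: derivative_eq_intros simp: algebra_simps)
  from has_vector_derivative_real_field[OF this] show ?thesis by (simp add: parabola_def[abs_def])
qed

text \<open>The parabola serves as the comparison curve. The function \<open>k\<close> is the
  integrand pulled back to \<open>s\<close>, including the derivative of the parabola, so increments
  of a primitive between \<open>- T\<close> and \<open>T\<close> are integrals of \<open>k\<close>;
  their limit exists because \<open>k\<close> is integrable.\<close>

lemma improper_contour_integral_parabola:
  assumes nu: "\<nu> > 0" and xi: "\<xi> \<noteq> 0" and \<gamma>: "admissible_path \<nu> \<xi> \<gamma>" and t: "t > 0"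
    and g: "g holomorphic_on slit_plane (\<nu> * (xi_norm \<xi>)\<^sup>2)"
    and B: "\<And>z. \<bar>Im z\<bar> \<ge> 1 \<Longrightarrow> cmod (g z / z) \<le> B * exp (t * Re z)"
    and k: "\<And>s. (2 * of_real \<nu> * \<i> * (of_real (xi_norm \<xi> + 1) + \<i> * of_real s)) * (g (parabola \<nu> (xi_norm \<xi>) s) / parabola \<nu> (xi_norm \<xi>) s) = k s"
    and kc: "continuous_on UNIV k" and ki: "integrable lborel k"
  shows "has_improper_contour_integral (\<lambda>z. g z / z) (LINT s|lborel. k s) \<gamma>"
proof (rule improper_contour_integral_deform[OF _ \<gamma> t g B])
  let ?a = "xi_norm \<xi>"
  have a: "?a > 0" by (rule xi_norm_pos[OF xi])
  show "\<nu> * ?a\<^sup>2 > 0" using nu a by simp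
  note parabola_limits[OF nu a]
  show "filterlim (\<lambda>T. Re (parabola \<nu> ?a T)) at_bot at_top" "filterlim (\<lambda>T. Im (parabola \<nu> ?a T)) at_top at_top"
    "filterlim (\<lambda>T. Re (parabola \<nu> ?a (- T))) at_bot at_top" "filterlim (\<lambda>T. Im (parabola \<nu> ?a (- T))) at_bot at_top"
    by (rule parabola_limits[OF nu a])+
  fix Q assume Q: "\<And>z. z \<notin> \<real>\<^sub>\<le>\<^sub>0 \<Longrightarrow> (Q has_field_derivative g z / z) (at z)"
  have "((\<lambda>T. LINT s|lborel. indicator {-T..T} s *\<^sub>R k s) \<longlongrightarrow> (LINT s|lborel. k s)) at_top"
  proof (rule integral_dominated_convergence_at_top[where w = "\<lambda>s. norm (k s)"])
    show "integrable lborel (\<lambda>s. norm (k s))" using ki by (rule integrable_norm)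
    show "\<forall>\<^sub>F T in at_top. AE s in lborel. norm (indicator {- T..T} s *\<^sub>R k s) \<le> norm (k s)"
      by (auto simp: indicator_def)
    show "AE s in lborel. ((\<lambda>T. indicator {- T..T} s *\<^sub>R k s) \<longlongrightarrow> k s) at_top"
    proof (rule AE_I2, rule tendsto_eventually)
      fix s :: real
      show "\<forall>\<^sub>F T in at_top. indicator {- T..T} s *\<^sub>R k s = k s"
        using eventually_ge_at_top[of "\<bar>s\<bar>"] by eventually_elim (auto simp: indicator_def)
    qed
    note [measurable] = borel_measurable_integrable[OF ki]
    show "k \<in> borel_measurable lborel" "(\<lambda>s. indicator {- T..T} s *\<^sub>R k s) \<in> borel_measurable lborel" for T
      by measurable
  qed
  moreover have "\<forall>\<^sub>F T in at_top. (LINT s|lborel. indicator {-T..T} s *\<^sub>R k s) = Q (parabola \<nu> ?a T) - Q (parabola \<nu> ?a (- T))"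
    using eventually_ge_at_top[of 0]
  proof eventually_elim
    case (elim T)
    have "has_bochner_integral lborel (\<lambda>s. indicator {-T..T} s *\<^sub>R k s) ((Q \<circ> parabola \<nu> ?a) T - (Q \<circ> parabola \<nu> ?a) (- T))"
    proof (rule has_bochner_integral_FTC_Icc)
      show "- T \<le> T" using elim by simp
      show "continuous_on {- T..T} k" by (rule continuous_on_subset[OF kc]) simp
      show "((Q \<circ> parabola \<nu> ?a) has_vector_derivative k s) (at s within {- T..T})" for s
        unfolding k[symmetric]
        by (rule field_vector_diff_chain_within[OF parabola_deriv has_field_derivative_at_within[OF Q[OF parabola_not_nonpos[OF nu a]]]])
    qed
    from has_bochner_integral_integral_eq[OF this] show ?case by simp
  qed
  ultimately show "((\<lambda>T. Q (parabola \<nu> ?a T) - Q (parabola \<nu> ?a (- T))) \<longlongrightarrow> (LINT s|lborel. k s)) at_top"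
    by (rule Lim_transform_eventually)
qed

section \<open>The root mu on the parabola and away from the real axis\<close>

lemma slit_plane_mu: "lam \<in> slit_plane (\<nu> * (xi_norm \<xi>)\<^sup>2) \<longleftrightarrow> lam \<notin> complex_of_real ` {.. - \<nu> * (xi_norm \<xi>)\<^sup>2}"
  by (simp add: slit_plane_def)

lemma mu_holomorphic:
  "mu \<nu> \<xi> holomorphic_on slit_plane (\<nu> * (xi_norm \<xi>)\<^sup>2)"
  unfolding mu_def[abs_def]
  by (intro holomorphic_intros) (auto simp: slit_plane_eq)

text \<open>Both sides have the same square, and both have positive real part.\<close>

lemma mu_parabola:
  assumes nu: "\<nu> > 0" and xi: "\<xi> \<noteq> 0"
  shows "mu \<nu> \<xi> (parabola \<nu> (xi_norm \<xi>) s) = of_real (xi_norm \<xi> + 1) + \<i> * of_real s"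
proof -
  let ?z = "parabola \<nu> (xi_norm \<xi>) s" and ?w = "complex_of_real (xi_norm \<xi> + 1) + \<i> * of_real s"
  have a: "xi_norm \<xi> > 0" by (rule xi_norm_pos[OF xi])
  have "?z \<in> slit_plane (\<nu> * (xi_norm \<xi>)\<^sup>2)"
    using parabola_not_nonpos[OF nu a, of s] nu a by (auto simp: slit_plane_iff complex_nonpos_Reals_iff intro: less_trans[of _ 0])
  hence m: "Re (mu \<nu> \<xi> ?z) > 0" using Re_mu_pos[OF nu] slit_plane_mu by blast
  have "of_real \<nu> * (mu \<nu> \<xi> ?z)\<^sup>2 = of_real \<nu> * ?w\<^sup>2"
    unfolding mu_squared[OF nu] parabola_def by simp
  hence "(mu \<nu> \<xi> ?z)\<^sup>2 = ?w\<^sup>2" using nu by simp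
  hence "mu \<nu> \<xi> ?z = ?w \<or> mu \<nu> \<xi> ?z = - ?w" by (simp add: power2_eq_iff)
  moreover have "mu \<nu> \<xi> ?z \<noteq> - ?w" using m a by auto
  ultimately show ?thesis by blast
qed

text \<open>\<open>\<nu> * |mu|\<^sup>2\<close> is the modulus of
  \<open>z + \<nu> * |xi|\<^sup>2\<close>, which is at least \<open>|Im z|\<close>. This keeps the
  factor \<open>1 / mu\<close> bounded away from the branch point, as the far-left estimate
  requires.\<close>

lemma mu_lower_bound:
  assumes nu: "\<nu> > 0" and z: "\<bar>Im z\<bar> \<ge> 1"
  shows "Re (mu \<nu> \<xi> z) > 0" "1 / cmod (mu \<nu> \<xi> z) \<le> sqrt \<nu>"
proof -
  have "z \<in> slit_plane (\<nu> * (xi_norm \<xi>)\<^sup>2)" using z by (auto simp: slit_plane_iff)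
  thus re: "Re (mu \<nu> \<xi> z) > 0" using Re_mu_pos[OF nu] slit_plane_mu by blast
  have "1 \<le> \<bar>Im (z + of_real (\<nu> * (xi_norm \<xi>)\<^sup>2))\<bar>" using z by simp
  also have "\<dots> \<le> cmod (z + of_real (\<nu> * (xi_norm \<xi>)\<^sup>2))" by (rule abs_Im_le_cmod)
  also have "\<dots> = \<nu> * (cmod (mu \<nu> \<xi> z))\<^sup>2"
    unfolding mu_squared[OF nu, symmetric] using nu by (simp add: norm_mult norm_power)
  also have "\<dots> = (sqrt \<nu> * cmod (mu \<nu> \<xi> z))\<^sup>2" using nu by (simp add: power_mult_distrib)
  finally have "1\<^sup>2 \<le> (sqrt \<nu> * cmod (mu \<nu> \<xi> z))\<^sup>2" by simp
  hence "1 \<le> sqrt \<nu> * cmod (mu \<nu> \<xi> z)" by (rule power2_le_imp_le) (use nu in simp)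
  moreover have "cmod (mu \<nu> \<xi> z) > 0" using re by auto
  ultimately show "1 / cmod (mu \<nu> \<xi> z) \<le> sqrt \<nu>" by (simp add: divide_le_eq)
qed

lemma exp_parabola:
  "exp (parabola \<nu> a s * of_real t) * exp (- (of_real (a + 1) + \<i> * of_real s) * of_real d) = line_exp \<nu> a t d s"
  unfolding line_exp_def exp_add[symmetric] parabola_def
  by (rule arg_cong[where f=exp]) (simp add: algebra_simps)

text \<open>The derivative of the parabola is \<open>2 * \<nu> * \<i> * mu\<close>; it cancels the
  factor \<open>1 / (2 * \<nu> * mu)\<close> and leaves a pure Gaussian.\<close>

lemma heat_contour_integral:
  assumes nu: "\<nu> > 0" and xi: "\<xi> \<noteq> 0" and \<gamma>: "admissible_path \<nu> \<xi> \<gamma>" and t: "t > 0" and d: "d \<ge> 0"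
  shows "has_improper_contour_integral (\<lambda>z. exp (z * of_real t) * (1 / (2 * of_real \<nu> * mu \<nu> \<xi> z)) * exp (- mu \<nu> \<xi> z * of_real d))
    (2 * of_real pi * \<i> * of_real (heat_ker \<nu> (xi_norm \<xi>) t d)) \<gamma>"
proof -
  define f where "f z = exp (z * of_real t) * (1 / (2 * of_real \<nu> * mu \<nu> \<xi> z)) * exp (- mu \<nu> \<xi> z * of_real d)" for z
  have a: "xi_norm \<xi> > 0" by (rule xi_norm_pos[OF xi])
  \<comment> \<open>The contour rule expects an integrand of the form \<open>g z / z\<close>. Here
    there is no pole at \<open>0\<close>, so the factor \<open>z\<close> is inserted and removed
    again on the path, which avoids \<open>0\<close>.\<close>
  have h: "has_improper_contour_integral (\<lambda>z. (z * f z) / z) (LINT s|lborel. \<i> * line_exp \<nu> (xi_norm \<xi>) t d s) \<gamma>"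
  proof (rule improper_contour_integral_parabola[OF nu xi \<gamma> t, where B = "sqrt \<nu> / (2 * \<nu>)"])
    show "(\<lambda>z. z * f z) holomorphic_on slit_plane (\<nu> * (xi_norm \<xi>)\<^sup>2)"
      unfolding f_def
    proof (intro holomorphic_intros mu_holomorphic)
      fix z assume "z \<in> slit_plane (\<nu> * (xi_norm \<xi>)\<^sup>2)"
      thus "2 * of_real \<nu> * mu \<nu> \<xi> z \<noteq> 0" using Re_mu_pos[OF nu, of z \<xi>] nu slit_plane_mu by fastforce
    qed
    fix z assume z: "1 \<le> \<bar>Im z\<bar>"
    hence z0: "z \<noteq> 0" by auto
    have m: "Re (mu \<nu> \<xi> z) > 0" "1 / cmod (mu \<nu> \<xi> z) \<le> sqrt \<nu>" using mu_lower_bound[OF nu z] by auto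
    have "cmod (f z) = exp (t * Re z) * (1 / cmod (mu \<nu> \<xi> z)) / (2 * \<nu>) * exp (- Re (mu \<nu> \<xi> z) * d)"
      using nu by (simp add: f_def norm_mult norm_divide mult.commute)
    also have "\<dots> \<le> exp (t * Re z) * sqrt \<nu> / (2 * \<nu>) * 1"
      using m nu d by (intro mult_mono divide_right_mono mult_left_mono) auto
    finally show "cmod (z * f z / z) \<le> sqrt \<nu> / (2 * \<nu>) * exp (t * Re z)" using z0 by (simp add: mult_ac)
  next
    fix s
    let ?w = "complex_of_real (xi_norm \<xi> + 1) + \<i> * of_real s"
    have p0: "parabola \<nu> (xi_norm \<xi>) s \<noteq> 0" using parabola_not_nonpos[OF nu a, of s] by auto
    have "Re ?w \<noteq> 0" using a by simp
    hence w0: "?w \<noteq> 0" by (metis zero_complex.simps(1))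
    have "f (parabola \<nu> (xi_norm \<xi>) s) = 1 / (2 * of_real \<nu> * ?w) * line_exp \<nu> (xi_norm \<xi>) t d s"
      unfolding f_def mu_parabola[OF nu xi] exp_parabola[symmetric] by (simp add: mult_ac)
    thus "2 * of_real \<nu> * \<i> * ?w * (parabola \<nu> (xi_norm \<xi>) s * f (parabola \<nu> (xi_norm \<xi>) s) / parabola \<nu> (xi_norm \<xi>) s) = \<i> * line_exp \<nu> (xi_norm \<xi>) t d s"
      using p0 w0 nu by simp
  qed (use integrable_line_exp[OF nu t] in \<open>auto intro!: continuous_intros\<close>)
  have v: "(LINT s|lborel. \<i> * line_exp \<nu> (xi_norm \<xi>) t d s) = 2 * of_real pi * \<i> * of_real (heat_ker \<nu> (xi_norm \<xi>) t d)"
    using integral_line_exp[OF nu t] by simp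
  have nz: "\<gamma> s \<noteq> 0" for s
    using \<gamma> unfolding admissible_path_def by blast
  show ?thesis unfolding f_def[symmetric]
    by (rule has_improper_contour_integral_cong[OF h[unfolded v]]) (use nz in simp)
qed

text \<open>On the parabola \<open>lam = \<nu> * (mu - |xi|) * (mu + |xi|)\<close>. Together with
  the derivative \<open>2 * \<nu> * \<i> * mu\<close> this reduces the coefficient to
  \<open>2 * \<i> / (|xi| * (mu - |xi|))\<close>.\<close>

lemma refl_contour_integral:
  assumes nu: "\<nu> > 0" and xi: "\<xi> \<noteq> 0" and \<gamma>: "admissible_path \<nu> \<xi> \<gamma>" and t: "t > 0" and x: "x \<ge> 0"
  defines "A \<equiv> complex_of_real (xi_norm \<xi>)"
  shows "has_improper_contour_integral (\<lambda>z. exp (z * of_real t) * ((mu \<nu> \<xi> z + A) / (mu \<nu> \<xi> z * z * A)) * exp (- mu \<nu> \<xi> z * of_real x))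
    (2 * of_real pi * \<i> * of_real (refl_part \<nu> (xi_norm \<xi>) t x)) \<gamma>"
proof -
  define g where "g z = exp (z * of_real t) * ((mu \<nu> \<xi> z + A) / (mu \<nu> \<xi> z * A)) * exp (- mu \<nu> \<xi> z * of_real x)" for z
  have a: "xi_norm \<xi> > 0" by (rule xi_norm_pos[OF xi])
  hence A0: "A \<noteq> 0" by (simp add: A_def)
  have eq: "exp (z * of_real t) * ((mu \<nu> \<xi> z + A) / (mu \<nu> \<xi> z * z * A)) * exp (- mu \<nu> \<xi> z * of_real x) = g z / z" for z
    by (simp add: g_def)
  have "has_improper_contour_integral (\<lambda>z. g z / z) (LINT s|lborel. (2 * \<i> / A) * (line_exp \<nu> (xi_norm \<xi>) t x s / (1 + \<i> * of_real s))) \<gamma>"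
  proof (rule improper_contour_integral_parabola[OF nu xi \<gamma> t, where B = "1 / xi_norm \<xi> + sqrt \<nu>"])
    show "g holomorphic_on slit_plane (\<nu> * (xi_norm \<xi>)\<^sup>2)"
      unfolding g_def
    proof (intro holomorphic_intros mu_holomorphic)
      fix z assume "z \<in> slit_plane (\<nu> * (xi_norm \<xi>)\<^sup>2)"
      thus "mu \<nu> \<xi> z * A \<noteq> 0" using Re_mu_pos[OF nu, of z \<xi>] A0 slit_plane_mu by fastforce
    qed
    fix z assume z: "1 \<le> \<bar>Im z\<bar>"
    have z1: "1 \<le> cmod z" using z abs_Im_le_cmod[of z] by linarith
    have m: "Re (mu \<nu> \<xi> z) > 0" "1 / cmod (mu \<nu> \<xi> z) \<le> sqrt \<nu>" using mu_lower_bound[OF nu z] by auto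
    have m0: "mu \<nu> \<xi> z \<noteq> 0" using m by auto
    \<comment> \<open>Split into partial fractions, the coefficient is visibly bounded where
      \<open>1 / mu\<close> is.\<close>
    have e: "(mu \<nu> \<xi> z + A) / (mu \<nu> \<xi> z * A) = 1 / A + 1 / mu \<nu> \<xi> z" using m0 A0 by (simp add: field_simps)
    have "cmod (g z / z) = exp (t * Re z) * cmod (1 / A + 1 / mu \<nu> \<xi> z) * exp (- Re (mu \<nu> \<xi> z) * x) / cmod z"
      unfolding g_def e by (simp add: norm_mult norm_divide mult.commute)
    also have "\<dots> \<le> exp (t * Re z) * cmod (1 / A + 1 / mu \<nu> \<xi> z) * exp (- Re (mu \<nu> \<xi> z) * x) / 1"
      using z1 by (intro divide_left_mono) auto
    also have "\<dots> \<le> exp (t * Re z) * (1 / xi_norm \<xi> + sqrt \<nu>) * 1"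
    proof -
      have "cmod (1 / A + 1 / mu \<nu> \<xi> z) \<le> cmod (1 / A) + cmod (1 / mu \<nu> \<xi> z)" by (rule norm_triangle_ineq)
      also have "\<dots> \<le> 1 / xi_norm \<xi> + sqrt \<nu>" using m(2) a by (simp add: norm_divide A_def)
      finally have "cmod (1 / A + 1 / mu \<nu> \<xi> z) \<le> 1 / xi_norm \<xi> + sqrt \<nu>" .
      moreover have "exp (- Re (mu \<nu> \<xi> z) * x) \<le> 1" using m(1) x by simp
      ultimately show ?thesis using a nu by (simp only: div_by_1) (intro mult_mono mult_left_mono; simp)
    qed
    finally show "cmod (g z / z) \<le> (1 / xi_norm \<xi> + sqrt \<nu>) * exp (t * Re z)" by (simp add: mult_ac)
  next
    fix s
    let ?w = "complex_of_real (xi_norm \<xi> + 1) + \<i> * of_real s" and ?p = "parabola \<nu> (xi_norm \<xi>) s"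
    have "Re ?w \<noteq> 0" using a by simp
    hence w0: "?w \<noteq> 0" by (metis zero_complex.simps(1))
    have "Re (1 + \<i> * complex_of_real s) \<noteq> 0" by simp
    hence u0: "1 + \<i> * complex_of_real s \<noteq> 0" by (metis zero_complex.simps(1))
    have "Re (?w + A) > 0" using a by (simp add: A_def)
    hence wA: "?w + A \<noteq> 0" by (metis less_irrefl zero_complex.simps(1))
    have p: "?p = of_real \<nu> * ((1 + \<i> * of_real s) * (?w + A))"
      by (simp add: parabola_def A_def power2_eq_square algebra_simps)
    have e: "g ?p = ((?w + A) / (?w * A)) * line_exp \<nu> (xi_norm \<xi>) t x s"
      unfolding g_def mu_parabola[OF nu xi] exp_parabola[symmetric] by (simp add: mult_ac)
    have gen: "2 * N * \<i> * W * (((W + A) / (W * A)) * E / (N * (u * (W + A)))) = (2 * \<i> / A) * (E / u)"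
      if "W \<noteq> 0" "u \<noteq> 0" "W + A \<noteq> 0" "N \<noteq> 0" for W u E N
      using that A0 by (simp add: divide_simps)
    show "2 * of_real \<nu> * \<i> * ?w * (g ?p / ?p) = (2 * \<i> / A) * (line_exp \<nu> (xi_norm \<xi>) t x s / (1 + \<i> * of_real s))"
      unfolding e unfolding p by (rule gen) (use w0 u0 wA nu in auto)
  next
    have u0: "1 + \<i> * complex_of_real s \<noteq> 0" for s
    proof -
      have "Re (1 + \<i> * complex_of_real s) \<noteq> 0" by simp
      thus ?thesis by (metis zero_complex.simps(1))
    qed
    show "continuous_on UNIV (\<lambda>s. (2 * \<i> / A) * (line_exp \<nu> (xi_norm \<xi>) t x s / (1 + \<i> * of_real s)))"
      using u0 A0 by (intro continuous_intros) auto
    show "integrable lborel (\<lambda>s. (2 * \<i> / A) * (line_exp \<nu> (xi_norm \<xi>) t x s / (1 + \<i> * of_real s)))"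
      by (intro integrable_mult_right integral_line_exp_pole(1)[OF nu a t])
  qed
  moreover have "(LINT s|lborel. (2 * \<i> / A) * (line_exp \<nu> (xi_norm \<xi>) t x s / (1 + \<i> * of_real s))) = 2 * of_real pi * \<i> * of_real (refl_part \<nu> (xi_norm \<xi>) t x)"
    unfolding integral_mult_right_zero integral_line_exp_pole(2)[OF nu a t] using A0 by (simp add: A_def)
  ultimately show ?thesis unfolding eq by simp
qed

lemma kernels_explicit:
  assumes nu: "\<nu> > 0" and xi: "\<xi> \<noteq> 0" and \<gamma>: "admissible_path \<nu> \<xi> \<gamma>" and t: "t > 0" and yz: "y \<ge> 0" "z \<ge> 0"
  shows "improper_contour_integrable (\<lambda>lam. G_integrand \<nu> \<xi> t y z lam $ i $ j) \<gamma>"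
    and "improper_contour_integrable (\<lambda>lam. R_integrand \<nu> \<xi> t y z lam $ i $ j) \<gamma>"
    and "R_kernel \<nu> \<xi> \<gamma> t y z = refl_part \<nu> (xi_norm \<xi>) t (y + z) *\<^sub>R xi_perp_mat \<xi>"
    and "H_kernel \<nu> \<xi> t y z = (heat_ker \<nu> (xi_norm \<xi>) t (z - y) + heat_ker \<nu> (xi_norm \<xi>) t (z + y)) *\<^sub>R mat 1"
    and "G_kernel \<nu> \<xi> \<gamma> t y z = (heat_ker \<nu> (xi_norm \<xi>) t (z - y) + heat_ker \<nu> (xi_norm \<xi>) t (z + y)) *\<^sub>R mat 1
      + refl_part \<nu> (xi_norm \<xi>) t (y + z) *\<^sub>R xi_perp_mat \<xi>"
proof -
  let ?a = "xi_norm \<xi>" and ?c = "2 * of_real pi * \<i>"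
  define fR where "fR lam = exp (lam * of_real t) * ((mu \<nu> \<xi> lam + of_real ?a) / (mu \<nu> \<xi> lam * lam * of_real ?a)) * exp (- mu \<nu> \<xi> lam * of_real (y + z))" for lam
  define fH where "fH d lam = exp (lam * of_real t) * (1 / (2 * of_real \<nu> * mu \<nu> \<xi> lam)) * exp (- mu \<nu> \<xi> lam * of_real d)" for d lam
  have hR: "has_improper_contour_integral fR (?c * of_real (refl_part \<nu> ?a t (y + z))) \<gamma>"
    unfolding fR_def using refl_contour_integral[OF nu xi \<gamma> t, of "y + z"] yz by simp
  have hH: "has_improper_contour_integral (fH d) (?c * of_real (heat_ker \<nu> ?a t d)) \<gamma>" if "d \<ge> 0" for d
    unfolding fH_def by (rule heat_contour_integral[OF nu xi \<gamma> t that])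
  have R: "has_improper_contour_integral (\<lambda>lam. R_integrand \<nu> \<xi> t y z lam $ i $ j)
      (xi_perp_mat \<xi> $ i $ j * (?c * of_real (refl_part \<nu> ?a t (y + z)))) \<gamma>" for i j
  proof (rule has_improper_contour_integral_cong[OF has_improper_contour_integral_cmul[OF hR]])
    fix s show "xi_perp_mat \<xi> $ i $ j * fR (\<gamma> s) = R_integrand \<nu> \<xi> t y z (\<gamma> s) $ i $ j"
      using yz by (simp add: R_integrand_def fR_def mult_ac)
  qed
  \<comment> \<open>These two facts permit replacing \<open>resolvent_kernel\<close> by
    \<open>Gker\<close> at every point of the path.\<close>
  have path: "\<gamma> s \<notin> complex_of_real ` {.. - \<nu> * ?a\<^sup>2}" "\<gamma> s \<noteq> 0" for s
    using \<gamma> unfolding admissible_path_def by blast+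
  have G: "has_improper_contour_integral (\<lambda>lam. G_integrand \<nu> \<xi> t y z lam $ i $ j)
      ((if i = j then 1 else 0) * (?c * of_real (heat_ker \<nu> ?a t \<bar>y - z\<bar>) + ?c * of_real (heat_ker \<nu> ?a t (y + z)))
        + xi_perp_mat \<xi> $ i $ j * (?c * of_real (refl_part \<nu> ?a t (y + z)))) \<gamma>" for i j
  proof (rule has_improper_contour_integral_cong[OF has_improper_contour_integral_add[OF
        has_improper_contour_integral_cmul[OF has_improper_contour_integral_add[OF hH hH]] has_improper_contour_integral_cmul[OF hR]]])
    fix s
    have gen: "(if i = j then 1 else 0) * (E * p * e1 + E * p * e2) + M * (E * q * e2)
        = E * ((if i = j then p else 0) * (e1 + e2) + q * M * e2)" for E p q e1 e2 M :: complex
      by (cases "i = j") (simp_all add: algebra_simps)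
    show "(if i = j then 1 else 0) * (fH \<bar>y - z\<bar> (\<gamma> s) + fH (y + z) (\<gamma> s)) + xi_perp_mat \<xi> $ i $ j * fR (\<gamma> s) = G_integrand \<nu> \<xi> t y z (\<gamma> s) $ i $ j"
      by (simp only: G_integrand_def vec_lambda_beta resolvent_kernel_eq[OF nu xi path yz] Gker_def Let_def
          fH_def fR_def exp_ker_def refl_ker_def gen)
  qed (use yz in auto)
  show "improper_contour_integrable (\<lambda>lam. G_integrand \<nu> \<xi> t y z lam $ i $ j) \<gamma>"
    "improper_contour_integrable (\<lambda>lam. R_integrand \<nu> \<xi> t y z lam $ i $ j) \<gamma>"
    using G R unfolding improper_contour_integrable_def by blast+
  have even: "heat_ker \<nu> ?a t \<bar>y - z\<bar> = heat_ker \<nu> ?a t (z - y)"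
    by (simp add: heat_ker_def power2_commute)
  have c0: "?c \<noteq> 0" by simp
  have c1: "1 / ?c * (M * (?c * r)) = r * M" for M r :: complex
    using c0 by (simp only: times_divide_eq_left times_divide_eq_right mult_1 mult.left_commute[of M] nonzero_mult_div_cancel_left) (simp add: mult.commute)
  have c2: "1 / ?c * (d * (?c * h + ?c * h') + M * (?c * r)) = d * (h + h') + r * M" for d h h' M r :: complex
    unfolding distrib_left[symmetric, of ?c] distrib_left[of "1 / ?c"] c1 by (simp only: mult.commute)
  show "R_kernel \<nu> \<xi> \<gamma> t y z = refl_part \<nu> ?a t (y + z) *\<^sub>R xi_perp_mat \<xi>"
    unfolding R_kernel_def improper_contour_integral_eqI[OF R] c1
    by (simp add: vec_eq_iff scaleR_conv_of_real[where 'a=complex])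
  show "G_kernel \<nu> \<xi> \<gamma> t y z = (heat_ker \<nu> ?a t (z - y) + heat_ker \<nu> ?a t (z + y)) *\<^sub>R mat 1
      + refl_part \<nu> ?a t (y + z) *\<^sub>R xi_perp_mat \<xi>"
    unfolding G_kernel_def improper_contour_integral_eqI[OF G] even c2
    by (simp add: vec_eq_iff scaleR_conv_of_real[where 'a=complex] mat_def add.commute[of y])
  show "H_kernel \<nu> \<xi> t y z = (heat_ker \<nu> ?a t (z - y) + heat_ker \<nu> ?a t (z + y)) *\<^sub>R mat 1"
    unfolding H_kernel_def
    by (rule arg_cong[where f="\<lambda>r. r *\<^sub>R mat 1"]) (simp add: heat_ker_def algebra_simps add_divide_distrib)
qed

section \<open>Closed form of the Green's function\<close>

lemma integrable_gauss1: "integrable lborel (\<lambda>s. exp (- s\<^sup>2) :: real)"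
  using integrable_gauss[of 1] by simp

lemma integrable_gauss_tail: "integrable lborel (\<lambda>s. indicator {v..} s * exp (- s\<^sup>2) :: real)"
  by (rule Bochner_Integration.integrable_bound[OF integrable_gauss1]) (auto simp: indicator_def)

lemma gauss_tail_nonneg: "gauss_tail v \<ge> 0"
  unfolding gauss_tail_def by (rule Bochner_Integration.integral_nonneg) auto

lemma gauss_tail_antimono: "u \<le> v \<Longrightarrow> gauss_tail v \<le> gauss_tail u"
  unfolding gauss_tail_def
  by (rule integral_mono[OF integrable_gauss_tail integrable_gauss_tail]) (auto simp: indicator_def)

lemma gauss_tail_split:
  assumes "u \<le> v" shows "gauss_tail v = gauss_tail u - integral {u..v} (\<lambda>s. exp (- s\<^sup>2))"
proof -
  have i: "integrable lborel (\<lambda>s. indicator {u..<v} s * exp (- s\<^sup>2) :: real)"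
    by (rule Bochner_Integration.integrable_bound[OF integrable_gauss1]) (auto simp: indicator_def)
  have "gauss_tail u = (LINT s|lborel. indicator {u..<v} s * exp (- s\<^sup>2) + indicator {v..} s * exp (- s\<^sup>2))"
    unfolding gauss_tail_def using assms by (intro Bochner_Integration.integral_cong) (auto simp: indicator_def)
  also have "\<dots> = (LINT s|lborel. indicator {u..<v} s * exp (- s\<^sup>2)) + gauss_tail v"
    unfolding gauss_tail_def by (rule Bochner_Integration.integral_add[OF i integrable_gauss_tail])
  also have "(LINT s|lborel. indicator {u..<v} s * exp (- s\<^sup>2)) = (LINT s|lborel. indicator {u..v} s * exp (- s\<^sup>2))"
    by (rule integral_cong_AE, measurable) (use AE_lborel_singleton[of v] in eventually_elim, auto simp: indicator_def)
  also have "\<dots> = integral {u..v} (\<lambda>s. exp (- s\<^sup>2))"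
  proof -
    have "set_integrable lborel {u..v} (\<lambda>s. exp (- s\<^sup>2) :: real)"
      unfolding set_integrable_def
      by (rule Bochner_Integration.integrable_bound[OF integrable_gauss1]) (auto simp: indicator_def)
    from set_borel_integral_eq_integral(2)[OF this] show ?thesis by (simp add: set_lebesgue_integral_def)
  qed
  finally show ?thesis by simp
qed

lemma gauss_tail_deriv: "(gauss_tail has_real_derivative - exp (- v\<^sup>2)) (at v)"
proof -
  \<comment> \<open>The base point \<open>v - 1\<close> lies strictly to the left of
    \<open>v\<close>, so the splitting of the tail holds in a neighbourhood of
    \<open>v\<close>.\<close>
  have "((\<lambda>w. integral {v - 1..w} (\<lambda>s. exp (- s\<^sup>2) :: real)) has_vector_derivative exp (- v\<^sup>2)) (at v within {v - 1..v + 1})"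
    by (rule integral_has_vector_derivative) (auto intro!: continuous_intros)
  moreover have "at v within {v - 1..v + 1} = at v"
    by (rule at_within_Icc_at) auto
  ultimately have "((\<lambda>w. integral {v - 1..w} (\<lambda>s. exp (- s\<^sup>2) :: real)) has_real_derivative exp (- v\<^sup>2)) (at v)"
    by (simp add: has_real_derivative_iff_has_vector_derivative)
  hence "((\<lambda>w. gauss_tail (v - 1) - integral {v - 1..w} (\<lambda>s. exp (- s\<^sup>2))) has_real_derivative 0 - exp (- v\<^sup>2)) (at v)"
    by (intro DERIV_diff DERIV_const)
  hence "((\<lambda>w. gauss_tail (v - 1) - integral {v - 1..w} (\<lambda>s. exp (- s\<^sup>2))) has_real_derivative - exp (- v\<^sup>2)) (at v)" by simp
  thus ?thesis
    by (rule has_field_derivative_transform_within_open[where S = "{v - 1<..}"]) (auto intro: gauss_tail_split[symmetric])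
qed

lemma gauss_tail_tendsto_0: "(gauss_tail \<longlongrightarrow> 0) at_top"
proof -
  have "((\<lambda>v::real. LINT s|lborel. indicator {v..} s * exp (- s\<^sup>2)) \<longlongrightarrow> (LINT s|(lborel::real measure). 0 :: real)) at_top"
  proof (rule integral_dominated_convergence_at_top[where w = "\<lambda>s. exp (- s\<^sup>2)" and f = "\<lambda>_. 0"
      and s = "\<lambda>v s. indicator {v..} s * exp (- s\<^sup>2)"])
    show "AE s in lborel. ((\<lambda>v. indicator {v..} s * exp (- s\<^sup>2)) \<longlongrightarrow> (0::real)) at_top"
    proof (rule AE_I2, rule tendsto_eventually)
      fix s :: real
      show "\<forall>\<^sub>F v in at_top. indicator {v..} s * exp (- s\<^sup>2) = (0::real)"
        using eventually_gt_at_top[of s] by eventually_elim (auto simp: indicator_def)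
    qed
    show "\<forall>\<^sub>F v in at_top. AE s in lborel. norm (indicator {v..} s * exp (- s\<^sup>2)) \<le> (exp (- s\<^sup>2) :: real)"
      by (auto simp: indicator_def)
  qed (use integrable_gauss1 in auto)
  thus ?thesis by (simp add: gauss_tail_def[abs_def])
qed

section \<open>Derivatives of the heat kernel and of the reflected part\<close>

lemma heat_ker_deriv_x:
  assumes "\<nu> > 0" "t > 0"
  shows "(heat_ker \<nu> a t has_real_derivative heat_ker \<nu> a t d * (- d / (2 * \<nu> * t))) (at d)"
proof -
  have "((\<lambda>d. - (d\<^sup>2 / (4 * \<nu> * t))) has_real_derivative - d / (2 * \<nu> * t)) (at d)"
    using assms by (auto intro!: derivative_eq_intros simp: field_simps)
  from DERIV_cdivide[OF DERIV_cmult_right[OF DERIV_fun_exp[OF this], of "exp (- \<nu> * a\<^sup>2 * t)"], of "sqrt (4 * pi * \<nu> * t)"]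
  show ?thesis by (simp add: heat_ker_def[abs_def] mult_ac)
qed

lemma heat_ker_deriv_t:
  assumes "\<nu> > 0" "t > 0"
  shows "((\<lambda>t. heat_ker \<nu> a t d) has_real_derivative heat_ker \<nu> a t d * (d\<^sup>2 / (4 * \<nu> * t\<^sup>2) - \<nu> * a\<^sup>2 - 1 / (2 * t))) (at t)"
proof -
  define E where "E s = exp (- (d\<^sup>2 / (4 * \<nu> * s))) * exp (- \<nu> * a\<^sup>2 * s)" for s
  have dE: "(E has_real_derivative E t * (d\<^sup>2 / (4 * \<nu> * t\<^sup>2) - \<nu> * a\<^sup>2)) (at t)"
  proof -
    have "((\<lambda>s. - (d\<^sup>2 / (4 * \<nu> * s)) + - \<nu> * a\<^sup>2 * s) has_real_derivative d\<^sup>2 / (4 * \<nu> * t\<^sup>2) - \<nu> * a\<^sup>2) (at t)"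
      using assms by (auto intro!: derivative_eq_intros simp: field_simps power2_eq_square)
    from DERIV_fun_exp[OF this] show ?thesis by (simp only: E_def[abs_def] exp_add)
  qed
  have dS: "((\<lambda>s. sqrt (4 * pi * \<nu> * s)) has_real_derivative sqrt (4 * pi * \<nu> * t) / (2 * t)) (at t)"
  proof -
    have "((\<lambda>s. sqrt (4 * pi * \<nu> * s)) has_real_derivative 4 * pi * \<nu> * (inverse (sqrt (4 * pi * \<nu> * t)) / 2)) (at t)"
    proof -
      have "((\<lambda>s. 4 * pi * \<nu> * s) has_real_derivative 4 * pi * \<nu>) (at t)" by (rule DERIV_cmult_Id)
      from DERIV_chain2[OF DERIV_real_sqrt this] show ?thesis using assms by (simp add: mult.commute)
    qed
    moreover have "4 * pi * \<nu> * (inverse (sqrt (4 * pi * \<nu> * t)) / 2) = sqrt (4 * pi * \<nu> * t) / (2 * t)"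
    proof -
      define k where "k = sqrt (4 * pi * \<nu> * t)"
      have k: "k > 0" "k * k = 4 * pi * \<nu> * t" using assms by (auto simp: k_def)
      have "4 * pi * \<nu> * (inverse k / 2) = (4 * pi * \<nu> * t) / k / (2 * t)" using assms by (simp add: field_simps)
      also have "\<dots> = k / (2 * t)" unfolding k(2)[symmetric] using k(1) by simp
      finally show ?thesis by (simp add: k_def)
    qed
    ultimately show ?thesis by simp
  qed
  have s0: "sqrt (4 * pi * \<nu> * t) > 0" using assms by simp
  have d1: "((\<lambda>s. E s / sqrt (4 * pi * \<nu> * s)) has_real_derivative
      (E t * (d\<^sup>2 / (4 * \<nu> * t\<^sup>2) - \<nu> * a\<^sup>2) * sqrt (4 * pi * \<nu> * t) - E t * (sqrt (4 * pi * \<nu> * t) / (2 * t))) / (sqrt (4 * pi * \<nu> * t) * sqrt (4 * pi * \<nu> * t))) (at t)"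
    by (rule DERIV_divide[OF dE dS]) (use assms in simp)
  have gen: "(P * X * S - P * (S / (2 * t))) / (S * S) = P / S * (X - 1 / (2 * t))" if "S > 0" for P X S
    using that assms by (simp add: field_simps)
  show ?thesis using d1 unfolding gen[OF s0] E_def times_divide_eq_left heat_ker_def[abs_def] .
qed

text \<open>Differentiating the Gaussian tail produces a Gaussian factor; together with
  \<open>exp (- a * x)\<close> it recombines to the heat kernel, by completing the square
  backwards.\<close>

lemma refl_part_key:
  assumes "\<nu> > 0" "t > 0"
  shows "exp (- a * x) * exp (- ((x - 2 * a * \<nu> * t) / sqrt (4 * \<nu> * t))\<^sup>2) / sqrt pi = sqrt (4 * \<nu> * t) * heat_ker \<nu> a t x"
proof -
  have "exp (- a * x) * exp (- ((x - 2 * a * \<nu> * t) / sqrt (4 * \<nu> * t))\<^sup>2) = exp (- (x\<^sup>2 / (4 * \<nu> * t))) * exp (- \<nu> * a\<^sup>2 * t)"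
    unfolding exp_add[symmetric] power_divide using assms
    by (intro arg_cong[where f=exp]) (simp add: field_simps power2_eq_square)
  moreover have "sqrt (4 * pi * \<nu> * t) = sqrt (4 * \<nu> * t) * sqrt pi" by (simp add: real_sqrt_mult[symmetric] mult_ac)
  ultimately show ?thesis using assms by (simp add: heat_ker_def)
qed

text \<open>The first-order relation between \<open>refl_part\<close> and \<open>heat_ker\<close> is
  the core of the closed form: at the boundary it is the Robin condition, and applied twice it
  yields the second derivative.\<close>

lemma refl_part_deriv_x:
  assumes nu: "\<nu> > 0" and a: "a > 0" and t: "t > 0"
  shows "(refl_part \<nu> a t has_real_derivative - a * refl_part \<nu> a t x - 2 / a * heat_ker \<nu> a t x) (at x)"
proof -
  define k where "k = sqrt (4 * \<nu> * t)"
  have k: "k > 0" using nu t by (simp add: k_def)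
  define v where "v x = (x - 2 * a * \<nu> * t) / k" for x
  have dv: "(v has_real_derivative 1 / k) (at x)" unfolding v_def
    by (rule derivative_eq_intros refl | use k in simp)+
  have dN: "((\<lambda>x. gauss_tail (v x)) has_real_derivative - exp (- (v x)\<^sup>2) * (1 / k)) (at x)"
    by (rule DERIV_chain2[OF gauss_tail_deriv dv])
  have de: "((\<lambda>x. 2 / a * exp (- a * x)) has_real_derivative - a * (2 / a * exp (- a * x))) (at x)"
    by (rule derivative_eq_intros refl | use a in simp)+
  have d1: "((\<lambda>x. (2 / a * exp (- a * x)) * gauss_tail (v x) / sqrt pi) has_real_derivative
      ((- a * (2 / a * exp (- a * x))) * gauss_tail (v x) + - exp (- (v x)\<^sup>2) * (1 / k) * (2 / a * exp (- a * x))) / sqrt pi) (at x)"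
    by (intro DERIV_cdivide DERIV_mult de dN)
  have e1: "((- a * (2 / a * exp (- a * x))) * gauss_tail (v x) + - exp (- (v x)\<^sup>2) * (1 / k) * (2 / a * exp (- a * x))) / sqrt pi
      = - a * (2 / a * exp (- a * x) * gauss_tail (v x) / sqrt pi) - 2 / a * ((exp (- a * x) * exp (- (v x)\<^sup>2) / sqrt pi) / k)"
    by (simp add: add_divide_distrib diff_divide_distrib mult_ac)
  have e2: "(exp (- a * x) * exp (- (v x)\<^sup>2) / sqrt pi) / k = heat_ker \<nu> a t x"
    using refl_part_key[OF nu t, of a x] nu t by (simp add: v_def k_def)
  show ?thesis using d1 unfolding e1 e2 refl_part_def[abs_def] k_def[symmetric] v_def[symmetric] .
qed

text \<open>Time enters only through the argument of the Gaussian tail, so no term with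
  \<open>refl_part\<close> survives. In the heat equation the term with \<open>a\<^sup>2\<close>
  cancels against the second space derivative.\<close>

lemma refl_part_deriv_t:
  assumes nu: "\<nu> > 0" and a: "a > 0" and t: "t > 0"
  shows "((\<lambda>t. refl_part \<nu> a t x) has_real_derivative 2 / a * heat_ker \<nu> a t x * (a * \<nu> + x / (2 * t))) (at t)"
proof -
  define k where "k s = sqrt (4 * \<nu> * s)" for s
  have k: "k t > 0" "k t * k t = 4 * \<nu> * t" using nu t by (auto simp: k_def)
  define v where "v s = (x - 2 * a * \<nu> * s) / k s" for s
  have dk: "(k has_real_derivative 2 * \<nu> / k t) (at t)"
  proof -
    have "((\<lambda>s. 4 * \<nu> * s) has_real_derivative 4 * \<nu>) (at t)" by (rule DERIV_cmult_Id)
    from DERIV_chain2[OF DERIV_real_sqrt this] have "(k has_real_derivative inverse (k t) / 2 * (4 * \<nu>)) (at t)"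
      using nu t by (simp add: k_def[abs_def])
    thus ?thesis by (simp add: field_simps)
  qed
  have dv: "(v has_real_derivative ((- (2 * a * \<nu>)) * k t - (x - 2 * a * \<nu> * t) * (2 * \<nu> / k t)) / (k t * k t)) (at t)"
    unfolding v_def
    by (rule DERIV_divide[OF _ dk]) (use k in \<open>auto intro!: derivative_eq_intros\<close>)
  have eqv: "((- (2 * a * \<nu>)) * k t - (x - 2 * a * \<nu> * t) * (2 * \<nu> / k t)) / (k t * k t) = - ((a * \<nu> + x / (2 * t)) / k t)"
  proof -
    have "((- (2 * a * \<nu>)) * k t - (x - 2 * a * \<nu> * t) * (2 * \<nu> / k t)) / (k t * k t)
        = (- (2 * a * \<nu>) - (x - 2 * a * \<nu> * t) * (2 * \<nu> / (k t * k t))) / k t"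
      using k(1) by (simp add: field_simps)
    also have "- (2 * a * \<nu>) - (x - 2 * a * \<nu> * t) * (2 * \<nu> / (k t * k t)) = - (a * \<nu> + x / (2 * t))"
      unfolding k(2) using nu t by (simp add: field_simps)
    finally show ?thesis by (simp only: minus_divide_left)
  qed
  have dN: "((\<lambda>s. gauss_tail (v s)) has_real_derivative - exp (- (v t)\<^sup>2) * (- ((a * \<nu> + x / (2 * t)) / k t))) (at t)"
    by (rule DERIV_chain2[OF gauss_tail_deriv dv[unfolded eqv]])
  have d1: "((\<lambda>s. (2 / a * exp (- a * x)) * gauss_tail (v s) / sqrt pi) has_real_derivative
      (2 / a * exp (- a * x)) * (- exp (- (v t)\<^sup>2) * (- ((a * \<nu> + x / (2 * t)) / k t))) / sqrt pi) (at t)"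
    by (intro DERIV_cdivide DERIV_cmult dN)
  have e1: "(2 / a * exp (- a * x)) * (- exp (- (v t)\<^sup>2) * (- ((a * \<nu> + x / (2 * t)) / k t))) / sqrt pi
      = 2 / a * ((exp (- a * x) * exp (- (v t)\<^sup>2) / sqrt pi) / k t) * (a * \<nu> + x / (2 * t))"
    by (simp add: mult_ac)
  have e2: "(exp (- a * x) * exp (- (v t)\<^sup>2) / sqrt pi) / k t = heat_ker \<nu> a t x"
    using refl_part_key[OF nu t, of a x] nu t by (simp add: v_def k_def)
  show ?thesis using d1 unfolding e1 e2 refl_part_def[abs_def] k_def[symmetric] v_def[symmetric] .
qed

text \<open>This formula makes sense for all real \<open>z\<close>, which gives two-sided
  derivatives in \<open>z\<close> even at the boundary; it is compared with \<open>G_kernel\<close>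
  only for \<open>t > 0\<close> and nonnegative \<open>y\<close> and \<open>z\<close>.\<close>

definition green_ker :: "real \<Rightarrow> int^2 \<Rightarrow> real \<Rightarrow> real \<Rightarrow> real \<Rightarrow> complex^2^2"
  where "green_ker \<nu> \<xi> t y z = (heat_ker \<nu> (xi_norm \<xi>) t (z - y) + heat_ker \<nu> (xi_norm \<xi>) t (z + y)) *\<^sub>R mat 1
      + refl_part \<nu> (xi_norm \<xi>) t (y + z) *\<^sub>R xi_perp_mat \<xi>"

lemma has_vector_derivative_mat_comb:
  fixes A B :: "complex^2^2"
  assumes "(p has_real_derivative p') (at x within S)" "(q has_real_derivative q') (at x within S)"
  shows "((\<lambda>x. p x *\<^sub>R A + q x *\<^sub>R B) has_vector_derivative p' *\<^sub>R A + q' *\<^sub>R B) (at x within S)"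
  using assms unfolding has_real_derivative_iff_has_vector_derivative
  by (intro has_vector_derivative_add bounded_linear.has_vector_derivative[OF bounded_linear_scaleR_left])

lemma xi_mat_eq: "\<xi> \<noteq> 0 \<Longrightarrow> xi_mat \<xi> = xi_norm \<xi> *\<^sub>R mat 1 - (1 / xi_norm \<xi>) *\<^sub>R xi_perp_mat \<xi>"
proof -
  assume "\<xi> \<noteq> 0"
  hence a: "complex_of_real (xi_norm \<xi>) \<noteq> 0" using xi_norm_pos by force
  have sq: "complex_of_real (xi_norm \<xi>) * complex_of_real (xi_norm \<xi>) = of_int (\<xi> $ 1) * of_int (\<xi> $ 1) + of_int (\<xi> $ 2) * of_int (\<xi> $ 2)"
    using xi_norm_sq_complex[of \<xi>] by (simp add: power2_eq_square)
  show ?thesis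
    using a sq
    by (simp add: vec_eq_iff forall_2 xi_mat_nth xi_perp_mat_nth mat_def scaleR_conv_of_real[where 'a=complex]
        power2_eq_square nonzero_eq_divide_eq nonzero_divide_eq_eq left_diff_distrib)
qed

lemma xi_mat_mult_perp: "xi_mat \<xi> ** xi_perp_mat \<xi> = 0"
  by (simp add: vec_eq_iff forall_2 matrix_matrix_mult_def sum_2 xi_mat_nth xi_perp_mat_nth power2_eq_square)

lemma matrix_mult_comb: "X ** (p *\<^sub>R mat 1 + q *\<^sub>R M) = p *\<^sub>R X + q *\<^sub>R (X ** (M :: complex^2^2))"
  by (simp add: vec_eq_iff forall_2 matrix_matrix_mult_def sum_2 mat_def algebra_simps)

text \<open>The coefficients of the identity matrix and of \<open>xi_perp_mat\<close> satisfy the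
  equation separately. In the boundary condition \<open>xi_mat\<close> annihilates the reflected
  part, and with \<open>xi_mat_eq\<close> everything collapses to a multiple of
  \<open>xi_perp_mat\<close> whose coefficient vanishes by the first-order relation for
  \<open>refl_part\<close>.\<close>

lemma green_ker_equations:
  assumes nu: "\<nu> > 0" and xi: "\<xi> \<noteq> 0"
  obtains Gt Gz Gzz :: "real \<Rightarrow> real \<Rightarrow> complex^2^2" where
    "\<And>t z. t > 0 \<Longrightarrow> ((\<lambda>s. green_ker \<nu> \<xi> s y z) has_vector_derivative Gt t z) (at t)"
    "\<And>t z. t > 0 \<Longrightarrow> ((\<lambda>x. green_ker \<nu> \<xi> t y x) has_vector_derivative Gz t z) (at z)"
    "\<And>t z. t > 0 \<Longrightarrow> ((\<lambda>x. Gz t x) has_vector_derivative Gzz t z) (at z)"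
    "\<And>t z. t > 0 \<Longrightarrow> Gt t z - \<nu> *\<^sub>R (- ((xi_norm \<xi>)\<^sup>2 *\<^sub>R green_ker \<nu> \<xi> t y z) + Gzz t z) = 0"
    "\<And>t. t > 0 \<Longrightarrow> - (\<nu> *\<^sub>R (Gz t 0 + xi_norm \<xi> *\<^sub>R green_ker \<nu> \<xi> t y 0)) + \<nu> *\<^sub>R (xi_mat \<xi> ** green_ker \<nu> \<xi> t y 0) = 0"
proof -
  define a where "a = xi_norm \<xi>"
  have a: "a > 0" unfolding a_def by (rule xi_norm_pos[OF xi])
  define M where "M = xi_perp_mat \<xi>"
  let ?h = "heat_ker \<nu> a" and ?r = "refl_part \<nu> a"
  define ht where "ht t d = ?h t d * (d\<^sup>2 / (4 * \<nu> * t\<^sup>2) - \<nu> * a\<^sup>2 - 1 / (2 * t))" for t d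
  define hx where "hx t d = ?h t d * (- d / (2 * \<nu> * t))" for t d
  define hxx where "hxx t d = ?h t d * (d\<^sup>2 / (4 * \<nu>\<^sup>2 * t\<^sup>2) - 1 / (2 * \<nu> * t))" for t d
  define rt where "rt t x = 2 / a * ?h t x * (a * \<nu> + x / (2 * t))" for t x
  define rx where "rx t x = - a * ?r t x - 2 / a * ?h t x" for t x
  \<comment> \<open>The second derivative comes from differentiating the first-order relation, with
    no further derivative of the Gaussian tail.\<close>
  define rxx where "rxx t x = - a * rx t x - 2 / a * hx t x" for t x
  have dht: "((\<lambda>s. ?h s d) has_real_derivative ht t d) (at t)" if "t > 0" for t d
    unfolding ht_def by (rule heat_ker_deriv_t[OF nu that])
  have dhx: "(?h t has_real_derivative hx t d) (at d)" if "t > 0" for t d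
    unfolding hx_def by (rule heat_ker_deriv_x[OF nu that])
  have dhxx: "(hx t has_real_derivative hxx t d) (at d)" if t: "t > 0" for t d
  proof -
    have l: "((\<lambda>d. - d / (2 * \<nu> * t)) has_real_derivative - 1 / (2 * \<nu> * t)) (at d)"
      by (intro DERIV_cdivide DERIV_minus DERIV_ident)
    have "hx t d * (- d / (2 * \<nu> * t)) + - 1 / (2 * \<nu> * t) * ?h t d = hxx t d"
      using nu t by (simp add: hx_def hxx_def field_simps power2_eq_square)
    thus ?thesis using DERIV_mult[OF dhx[OF t] l] unfolding hx_def[abs_def] by simp
  qed
  have drt: "((\<lambda>s. ?r s x) has_real_derivative rt t x) (at t)" if "t > 0" for t x
    unfolding rt_def by (rule refl_part_deriv_t[OF nu a that])
  have drx: "(?r t has_real_derivative rx t x) (at x)" if "t > 0" for t x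
    unfolding rx_def by (rule refl_part_deriv_x[OF nu a that])
  have drxx: "(rx t has_real_derivative rxx t x) (at x)" if t: "t > 0" for t x
  proof -
    have "((\<lambda>x. - a * ?r t x - 2 / a * ?h t x) has_real_derivative - a * rx t x - 2 / a * hx t x) (at x)"
      by (intro DERIV_diff DERIV_cmult drx dhx t)
    thus ?thesis by (simp only: rx_def[abs_def] rxx_def)
  qed
  define Gt where "Gt t z = (ht t (z - y) + ht t (z + y)) *\<^sub>R mat 1 + rt t (y + z) *\<^sub>R M" for t z
  define Gz where "Gz t z = (hx t (z - y) + hx t (z + y)) *\<^sub>R mat 1 + rx t (y + z) *\<^sub>R M" for t z
  define Gzz where "Gzz t z = (hxx t (z - y) + hxx t (z + y)) *\<^sub>R mat 1 + rxx t (y + z) *\<^sub>R M" for t z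
  have G: "green_ker \<nu> \<xi> t y z = (?h t (z - y) + ?h t (z + y)) *\<^sub>R mat 1 + ?r t (y + z) *\<^sub>R M" for t z
    by (simp add: green_ker_def a_def M_def)
  have shift: "((\<lambda>z. f (z - y) + f (z + y)) has_real_derivative f' (z - y) + f' (z + y)) (at z)"
    if "\<And>d. (f has_real_derivative f' d) (at d)" for f f' :: "real \<Rightarrow> real" and z
  proof (intro DERIV_add)
    show "((\<lambda>z. f (z - y)) has_real_derivative f' (z - y)) (at z)"
      using DERIV_chain2[OF that DERIV_diff[OF DERIV_ident DERIV_const]] by simp
    show "((\<lambda>z. f (z + y)) has_real_derivative f' (z + y)) (at z)"
      using DERIV_chain2[OF that DERIV_add[OF DERIV_ident DERIV_const]] by simp
  qed
  have shift': "((\<lambda>z. f (y + z)) has_real_derivative f' (y + z)) (at z)"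
    if "\<And>d. (f has_real_derivative f' d) (at d)" for f f' :: "real \<Rightarrow> real" and z
    using DERIV_chain2[OF that DERIV_add[OF DERIV_const DERIV_ident]] by simp
  show ?thesis
  proof (rule that[of Gt Gz Gzz])
    fix t z :: real assume t: "t > 0"
    show "((\<lambda>s. green_ker \<nu> \<xi> s y z) has_vector_derivative Gt t z) (at t)"
      unfolding G Gt_def by (intro has_vector_derivative_mat_comb DERIV_add dht drt t)
    show "((\<lambda>x. green_ker \<nu> \<xi> t y x) has_vector_derivative Gz t z) (at z)"
      unfolding G Gz_def by (rule has_vector_derivative_mat_comb[OF shift[OF dhx[OF t]] shift'[OF drx[OF t]]])
    show "((\<lambda>x. Gz t x) has_vector_derivative Gzz t z) (at z)"
      unfolding Gz_def Gzz_def by (rule has_vector_derivative_mat_comb[OF shift[OF dhxx[OF t]] shift'[OF drxx[OF t]]])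
    have heat: "ht t d - \<nu> * (- (a\<^sup>2 * ?h t d) + hxx t d) = 0" for d
      using nu t by (simp add: ht_def hxx_def field_simps power2_eq_square)
    have refl: "rt t x - \<nu> * (- (a\<^sup>2 * ?r t x) + rxx t x) = 0" for x
      using nu t a by (simp add: rt_def rxx_def rx_def hx_def field_simps power2_eq_square)
    have "Gt t z - \<nu> *\<^sub>R (- (a\<^sup>2 *\<^sub>R green_ker \<nu> \<xi> t y z) + Gzz t z)
      = ((ht t (z - y) - \<nu> * (- (a\<^sup>2 * ?h t (z - y)) + hxx t (z - y))) + (ht t (z + y) - \<nu> * (- (a\<^sup>2 * ?h t (z + y)) + hxx t (z + y)))) *\<^sub>R mat 1
        + (rt t (y + z) - \<nu> * (- (a\<^sup>2 * ?r t (y + z)) + rxx t (y + z))) *\<^sub>R M"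
      unfolding G Gt_def Gzz_def by (simp add: algebra_simps)
    thus "Gt t z - \<nu> *\<^sub>R (- ((xi_norm \<xi>)\<^sup>2 *\<^sub>R green_ker \<nu> \<xi> t y z) + Gzz t z) = 0"
      unfolding heat refl a_def[symmetric] by simp
  next
    fix t :: real assume t: "t > 0"
    have even: "?h t (- y) = ?h t y" by (simp add: heat_ker_def)
    \<comment> \<open>The even reflection: the derivative of the heat kernel is odd, so the two heat
      parts cancel at \<open>z = 0\<close>.\<close>
    have "hx t (0 - y) + hx t (0 + y) = 0" by (simp add: hx_def even)
    hence Gz0: "Gz t 0 = rx t y *\<^sub>R M" by (simp add: Gz_def)
    have G0: "green_ker \<nu> \<xi> t y 0 = (2 * ?h t y) *\<^sub>R mat 1 + ?r t y *\<^sub>R M" by (simp add: G even)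
    have X: "xi_mat \<xi> ** green_ker \<nu> \<xi> t y 0 = (2 * ?h t y) *\<^sub>R (a *\<^sub>R mat 1 - (1 / a) *\<^sub>R M)"
      unfolding G0 matrix_mult_comb M_def xi_mat_mult_perp unfolding xi_mat_eq[OF xi] a_def by simp
    have "- (\<nu> *\<^sub>R (Gz t 0 + a *\<^sub>R green_ker \<nu> \<xi> t y 0)) + \<nu> *\<^sub>R (xi_mat \<xi> ** green_ker \<nu> \<xi> t y 0)
      = (- \<nu> * (rx t y + a * ?r t y + 2 / a * ?h t y)) *\<^sub>R M"
      unfolding X unfolding Gz0 G0 by (simp add: algebra_simps)
    also have "rx t y + a * ?r t y + 2 / a * ?h t y = 0" by (simp add: rx_def)
    finally show "- (\<nu> *\<^sub>R (Gz t 0 + xi_norm \<xi> *\<^sub>R green_ker \<nu> \<xi> t y 0)) + \<nu> *\<^sub>R (xi_mat \<xi> ** green_ker \<nu> \<xi> t y 0) = 0"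
      by (simp add: a_def)
  qed
qed

section \<open>The initial condition\<close>

lemma integral_gauss: "(LINT s|lborel. exp (- s\<^sup>2)) = sqrt pi"
proof -
  have "complex_of_real (LINT s|lborel. exp (- s\<^sup>2)) = (LINT s|lborel. complex_of_real (exp (- s\<^sup>2)))"
    by (rule integral_complex_of_real[symmetric])
  also have "\<dots> = (LINT s|lborel. exp (of_real (- (1 * s\<^sup>2)) + \<i> * of_real (0 * s)))"
    by (simp flip: exp_of_real)
  also have "\<dots> = of_real (sqrt pi)" by (subst gauss_fourier) auto
  finally show ?thesis by (simp only: of_real_eq_iff)
qed

text \<open>A support inside the positive axis allows passing from \<open>half_line\<close> to
  \<open>lborel\<close>, where affine substitutions on the whole line are at hand.\<close>

lemma cpt_supp_integrals:
  fixes F :: "real \<Rightarrow> complex^2"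
  assumes c: "continuous_on UNIV F" and z: "\<And>x. x \<notin> {a..b} \<Longrightarrow> F x = 0" and a: "a > 0"
  shows "integrable half_line F" "integrable lborel F" "(LINT x|half_line. F x) = (LINT x|lborel. F x)"
proof -
  have "integrable half_line (\<lambda>x. indicator {..b} x *\<^sub>R F x)"
    by (rule loc_intD[OF loc_int_continuous[OF continuous_on_subset[OF c]]]) auto
  moreover have "(\<lambda>x. indicator {..b} x *\<^sub>R F x) = F" using z by (auto simp: indicator_def fun_eq_iff)
  ultimately show 1: "integrable half_line F" by simp
  have m: "F \<in> borel_measurable lborel" using borel_measurable_continuous_onI[OF c] by simp
  have F: "(\<lambda>x. indicator {0..} x *\<^sub>R F x) = F" using z a by (auto simp: indicator_def fun_eq_iff)
  show "integrable lborel F"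
    using 1 unfolding integrable_half_line_iff F integrable_completion[OF m] .
  show "(LINT x|half_line. F x) = (LINT x|lborel. F x)"
    unfolding integral_half_line_eq F by (rule integral_completion[OF m])
qed

lemma continuous_on_heat_ker: "continuous_on S (heat_ker \<nu> a t)"
  unfolding heat_ker_def[abs_def] divide_inverse by (intro continuous_intros)

lemma heat_ker_nonneg: "\<nu> > 0 \<Longrightarrow> t > 0 \<Longrightarrow> heat_ker \<nu> a t d \<ge> 0"
  by (simp add: heat_ker_def)

lemma heat_ker_antimono:
  assumes "\<nu> > 0" "t > 0" "0 \<le> d" "d \<le> d'" shows "heat_ker \<nu> a t d' \<le> heat_ker \<nu> a t d"
proof -
  have "d\<^sup>2 / (4 * \<nu> * t) \<le> d'\<^sup>2 / (4 * \<nu> * t)"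
    using assms by (intro divide_right_mono power_mono) auto
  thus ?thesis using assms unfolding heat_ker_def
    by (intro divide_right_mono mult_right_mono) auto
qed

lemma heat_ker_tendsto_0:
  assumes "\<nu> > 0" "y > 0" shows "((\<lambda>t. heat_ker \<nu> a t y) \<longlongrightarrow> 0) (at_right 0)"
  unfolding heat_ker_def using assms by real_asymp

text \<open>Since \<open>y > 0\<close>, the argument of the Gaussian tail tends to infinity as
  \<open>t\<close> decreases to \<open>0\<close>.\<close>

lemma refl_part_tendsto_0:
  assumes nu: "\<nu> > 0" and y: "y > 0"
  shows "((\<lambda>t. refl_part \<nu> a t y) \<longlongrightarrow> 0) (at_right 0)"
proof -
  have "filterlim (\<lambda>t. (y - 2 * a * \<nu> * t) / sqrt (4 * \<nu> * t)) at_top (at_right 0)"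
    using assms by real_asymp
  from filterlim_compose[OF gauss_tail_tendsto_0 this]
  have "((\<lambda>t. 2 / a * exp (- a * y) * gauss_tail ((y - 2 * a * \<nu> * t) / sqrt (4 * \<nu> * t)) / sqrt pi) \<longlongrightarrow> 2 / a * exp (- a * y) * 0 / sqrt pi) (at_right 0)"
    by (intro tendsto_intros) auto
  thus ?thesis by (simp add: refl_part_def)
qed

lemma refl_part_nonneg: "a > 0 \<Longrightarrow> refl_part \<nu> a t x \<ge> 0"
  by (simp add: refl_part_def gauss_tail_nonneg)

lemma refl_part_antimono:
  assumes "\<nu> > 0" "a > 0" "t > 0" "x \<le> x'" shows "refl_part \<nu> a t x' \<le> refl_part \<nu> a t x"
proof -
  have "(x - 2 * a * \<nu> * t) / sqrt (4 * \<nu> * t) \<le> (x' - 2 * a * \<nu> * t) / sqrt (4 * \<nu> * t)"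
    using assms by (intro divide_right_mono) auto
  hence g: "gauss_tail ((x' - 2 * a * \<nu> * t) / sqrt (4 * \<nu> * t)) \<le> gauss_tail ((x - 2 * a * \<nu> * t) / sqrt (4 * \<nu> * t))"
    by (rule gauss_tail_antimono)
  have e: "2 / a * exp (- a * x') \<le> 2 / a * exp (- a * x)"
    using assms by (intro mult_left_mono) auto
  show ?thesis unfolding refl_part_def
    by (intro divide_right_mono mult_mono g e) (use assms gauss_tail_nonneg in auto)
qed

text \<open>The substitution \<open>z = y + sqrt (4 * \<nu> * t) * s\<close> makes the Gaussian
  weight independent of \<open>t\<close> and moves the dependence into the bounded continuous
  \<open>f\<close>, so that dominated convergence applies.\<close>

lemma heat_ker_approx_identity:
  fixes f :: "real \<Rightarrow> complex^2"
  assumes nu: "\<nu> > 0" and c: "continuous_on UNIV f" and B: "\<And>x. norm (f x) \<le> B"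
  shows "((\<lambda>t. LINT z|lborel. heat_ker \<nu> a t (z - y) *\<^sub>R f z) \<longlongrightarrow> f y) (at_right 0)"
proof -
  define J where "J t = (LINT s|lborel. (exp (- s\<^sup>2) / sqrt pi) *\<^sub>R f (y + sqrt (4 * \<nu> * t) * s))" for t
  have eq: "(LINT z|lborel. heat_ker \<nu> a t (z - y) *\<^sub>R f z) = exp (- \<nu> * a\<^sup>2 * t) *\<^sub>R J t" if t: "t > 0" for t
  proof -
    define k where "k = sqrt (4 * \<nu> * t)"
    have k: "k > 0" "k\<^sup>2 = 4 * \<nu> * t" using nu t by (auto simp: k_def)
    have kp: "sqrt (4 * pi * \<nu> * t) = k * sqrt pi" by (simp add: k_def real_sqrt_mult[symmetric] mult_ac)
    have "(LINT z|lborel. heat_ker \<nu> a t (z - y) *\<^sub>R f z) = \<bar>k\<bar> *\<^sub>R (LINT s|lborel. heat_ker \<nu> a t ((y + k * s) - y) *\<^sub>R f (y + k * s))"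
      by (rule lborel_integral_real_affine) (use k in simp)
    also have "\<dots> = (LINT s|lborel. k *\<^sub>R (heat_ker \<nu> a t ((y + k * s) - y) *\<^sub>R f (y + k * s)))"
      using k(1) by (simp only: abs_of_pos integral_scaleR_right)
    also have "\<dots> = (LINT s|lborel. exp (- \<nu> * a\<^sup>2 * t) *\<^sub>R ((exp (- s\<^sup>2) / sqrt pi) *\<^sub>R f (y + k * s)))"
    proof (rule Bochner_Integration.integral_cong[OF refl])
      fix s
      have "(k * s)\<^sup>2 / (4 * \<nu> * t) = s\<^sup>2" using k nu t by (simp add: power_mult_distrib)
      hence "k * heat_ker \<nu> a t ((y + k * s) - y) = exp (- \<nu> * a\<^sup>2 * t) * (exp (- s\<^sup>2) / sqrt pi)"
        unfolding heat_ker_def kp using k(1) by simp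
      thus "k *\<^sub>R (heat_ker \<nu> a t ((y + k * s) - y) *\<^sub>R f (y + k * s)) = exp (- \<nu> * a\<^sup>2 * t) *\<^sub>R ((exp (- s\<^sup>2) / sqrt pi) *\<^sub>R f (y + k * s))"
        by (simp only: scaleR_scaleR)
    qed
    also have "\<dots> = exp (- \<nu> * a\<^sup>2 * t) *\<^sub>R J t" unfolding J_def k_def[symmetric] by (rule integral_scaleR_right)
    finally show ?thesis .
  qed
  have fm [measurable]: "f \<in> borel_measurable borel" using c by (rule borel_measurable_continuous_onI)
  have gi: "integrable lborel (\<lambda>s. exp (- s\<^sup>2) / sqrt pi :: real)" using integrable_gauss1 by simp
  \<comment> \<open>With \<open>t = inverse \<tau>\<close> the limit at \<open>0\<close> from the
    right becomes a limit at infinity, the form of the dominated convergence rule used here.\<close>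
  have "((\<lambda>\<tau>. LINT s|lborel. (exp (- s\<^sup>2) / sqrt pi) *\<^sub>R f (y + sqrt (4 * \<nu> * inverse \<tau>) * s)) \<longlongrightarrow> (LINT s|lborel. (exp (- s\<^sup>2) / sqrt pi) *\<^sub>R f y)) at_top"
  proof (rule integral_dominated_convergence_at_top[where w = "\<lambda>s. B * (exp (- s\<^sup>2) / sqrt pi)"])
    show "integrable lborel (\<lambda>s. B * (exp (- s\<^sup>2) / sqrt pi) :: real)" using gi by (intro integrable_mult_right)
    show "\<forall>\<^sub>F \<tau> in at_top. AE s in lborel. norm ((exp (- s\<^sup>2) / sqrt pi) *\<^sub>R f (y + sqrt (4 * \<nu> * inverse \<tau>) * s)) \<le> B * (exp (- s\<^sup>2) / sqrt pi)"
    proof (rule always_eventually, rule allI, rule AE_I2)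
      fix \<tau> s
      show "norm ((exp (- s\<^sup>2) / sqrt pi) *\<^sub>R f (y + sqrt (4 * \<nu> * inverse \<tau>) * s)) \<le> B * (exp (- s\<^sup>2) / sqrt pi)"
        using mult_left_mono[OF B[of "y + sqrt (4 * \<nu> * inverse \<tau>) * s"], of "exp (- s\<^sup>2) / sqrt pi"] by (simp add: mult.commute)
    qed
    show "AE s in lborel. ((\<lambda>\<tau>. (exp (- s\<^sup>2) / sqrt pi) *\<^sub>R f (y + sqrt (4 * \<nu> * inverse \<tau>) * s)) \<longlongrightarrow> (exp (- s\<^sup>2) / sqrt pi) *\<^sub>R f y) at_top"
    proof (rule AE_I2, rule tendsto_scaleR[OF tendsto_const])
      fix s
      have "((\<lambda>\<tau>. y + sqrt (4 * \<nu> * inverse \<tau>) * s) \<longlongrightarrow> y + sqrt (4 * \<nu> * 0) * s) at_top"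
        by (intro tendsto_intros tendsto_inverse_0_at_top filterlim_ident)
      hence "((\<lambda>\<tau>. y + sqrt (4 * \<nu> * inverse \<tau>) * s) \<longlongrightarrow> y) at_top" by simp
      moreover have "isCont f y" using c by (simp add: continuous_on_eq_continuous_at)
      ultimately show "((\<lambda>\<tau>. f (y + sqrt (4 * \<nu> * inverse \<tau>) * s)) \<longlongrightarrow> f y) at_top"
        by (rule isCont_tendsto_compose[rotated])
    qed
  qed measurable
  moreover have "(LINT s|lborel. (exp (- s\<^sup>2) / sqrt pi) *\<^sub>R f y) = f y"
    using gi integral_gauss by simp
  ultimately have "((\<lambda>\<tau>. J (inverse \<tau>)) \<longlongrightarrow> f y) at_top" by (simp add: J_def)
  hence J: "(J \<longlongrightarrow> f y) (at_right 0)" by (simp add: filterlim_at_right_to_top)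
  have "((\<lambda>t. exp (- \<nu> * a\<^sup>2 * t)) \<longlongrightarrow> exp (- \<nu> * a\<^sup>2 * 0)) (at_right 0)" by (intro tendsto_intros)
  hence "((\<lambda>t. exp (- \<nu> * a\<^sup>2 * t) *\<^sub>R J t) \<longlongrightarrow> exp (- \<nu> * a\<^sup>2 * 0) *\<^sub>R f y) (at_right 0)"
    by (intro tendsto_scaleR J)
  moreover have "\<forall>\<^sub>F t in at_right 0. exp (- \<nu> * a\<^sup>2 * t) *\<^sub>R J t = (LINT z|lborel. heat_ker \<nu> a t (z - y) *\<^sub>R f z)"
    using eventually_at_right_less[of 0] by eventually_elim (simp add: eq)
  ultimately show ?thesis using Lim_transform_eventually by fastforce
qed

text \<open>Only the direct heat kernel concentrates at \<open>y\<close>. The two reflected parts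
  are evaluated at arguments above \<open>y > 0\<close>, where they are bounded by their value at
  \<open>y\<close>, and that value tends to \<open>0\<close>.\<close>

lemma green_ker_initial:
  fixes f :: "real \<Rightarrow> complex^2"
  assumes nu: "\<nu> > 0" and xi: "\<xi> \<noteq> 0" and y: "y > 0" and f: "smooth_cpt_supp f"
  shows "t > 0 \<Longrightarrow> integrable half_line (\<lambda>z. green_ker \<nu> \<xi> t y z *v f z)"
    and "((\<lambda>t. LINT z|half_line. green_ker \<nu> \<xi> t y z *v f z) \<longlongrightarrow> f y) (at_right 0)"
proof -
  \<comment> \<open>\<open>f0\<close> is the extension of \<open>f\<close> by zero; replacing
    \<open>f\<close> by it changes the integrand on the half line only in the null set at
    \<open>0\<close>.\<close>
  obtain p q f0 where f0: "0 < p" "\<And>x. x > 0 \<Longrightarrow> f0 x = f x" "continuous_on UNIV f0" "\<And>x. x \<notin> {p..q} \<Longrightarrow> f0 x = 0"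
    using smooth_cpt_suppE[OF f] by metis
  define a where "a = xi_norm \<xi>"
  have a: "a > 0" unfolding a_def by (rule xi_norm_pos[OF xi])
  define M where "M = xi_perp_mat \<xi>"
  have Mbl: "bounded_linear ((*v) M)" by (rule bounded_linear_matrix_vector_mult)
  define g0 where "g0 z = M *v f0 z" for z
  have g0: "continuous_on UNIV g0" "\<And>x. x \<notin> {p..q} \<Longrightarrow> g0 x = 0"
    unfolding g0_def using bounded_linear.continuous_on[OF Mbl f0(3)] f0(4) by auto
  define F1 where "F1 t z = heat_ker \<nu> a t (z - y) *\<^sub>R f0 z" for t z
  define F2 where "F2 t z = heat_ker \<nu> a t (z + y) *\<^sub>R f0 z" for t z
  define F3 where "F3 t z = refl_part \<nu> a t (y + z) *\<^sub>R g0 z" for t z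
  have dec: "green_ker \<nu> \<xi> t y z *v f0 z = F1 t z + F2 t z + F3 t z" for t z
    unfolding green_ker_def F1_def F2_def F3_def g0_def a_def M_def
    by (simp add: vec_eq_iff forall_2 matrix_vector_mult_def sum_2 mat_def algebra_simps)
  have c1: "continuous_on UNIV (F1 t)" for t unfolding F1_def
    by (intro continuous_intros continuous_on_compose2[OF continuous_on_heat_ker] f0) auto
  have c2: "continuous_on UNIV (F2 t)" for t unfolding F2_def
    by (intro continuous_intros continuous_on_compose2[OF continuous_on_heat_ker] f0) auto
  have rc: "continuous_on UNIV (refl_part \<nu> a t)" if "t > 0" for t
    using refl_part_deriv_x[OF nu a that] by (intro continuous_at_imp_continuous_on ballI) (use DERIV_isCont in blast)
  have c3: "continuous_on UNIV (F3 t)" if "t > 0" for t unfolding F3_def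
    by (intro continuous_intros continuous_on_compose2[OF rc[OF that]] g0) auto
  have z: "F1 t x = 0" "F2 t x = 0" "F3 t x = 0" if "x \<notin> {p..q}" for t x
    using f0(4)[OF that] g0(2)[OF that] by (auto simp: F1_def F2_def F3_def)
  note i1 = cpt_supp_integrals[where b = q, OF c1 z(1) f0(1)] and i2 = cpt_supp_integrals[where b = q, OF c2 z(2) f0(1)] and i3 = cpt_supp_integrals[where b = q, OF c3 z(3) f0(1)]
  have AE: "AE z in half_line. green_ker \<nu> \<xi> t y z *v f z = F1 t z + F2 t z + F3 t z" for t
    using AE_half_line_pos by eventually_elim (simp add: dec[symmetric] f0(2))
  have iF: "integrable half_line (\<lambda>z. F1 t z + F2 t z + F3 t z)" if "t > 0" for t
    using i1(1) i2(1) i3(1)[OF that] by auto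
  have m: "(\<lambda>z. green_ker \<nu> \<xi> t y z *v f z) \<in> borel_measurable half_line" if "t > 0" for t
    by (rule measurable_half_line_AE_cong[OF borel_measurable_integrable[OF iF[OF that]] AE])
  show "integrable half_line (\<lambda>z. green_ker \<nu> \<xi> t y z *v f z)" if "t > 0" for t
    using integrable_cong_AE[OF m[OF that] borel_measurable_integrable[OF iF[OF that]] AE] iF[OF that] by blast
  have int: "(LINT z|half_line. green_ker \<nu> \<xi> t y z *v f z) = (LINT z|lborel. F1 t z) + (LINT z|lborel. F2 t z) + (LINT z|lborel. F3 t z)"
    if t: "t > 0" for t
  proof -
    have "(LINT z|half_line. green_ker \<nu> \<xi> t y z *v f z) = (LINT z|half_line. F1 t z + F2 t z + F3 t z)"
      by (rule integral_cong_AE[OF m[OF t] borel_measurable_integrable[OF iF[OF t]] AE])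
    also have "\<dots> = (LINT z|half_line. F1 t z) + (LINT z|half_line. F2 t z) + (LINT z|half_line. F3 t z)"
      using i1(1) i2(1) i3(1)[OF t] by simp
    finally show ?thesis using i1(3)[of t] i2(3)[of t] i3(3)[OF t] by simp
  qed
  have f0i: "integrable lborel f0" and g0i: "integrable lborel g0"
    using cpt_supp_integrals(2)[OF f0(3,4,1)] cpt_supp_integrals(2)[OF g0 f0(1)] by auto
  \<comment> \<open>A weight that is bounded on the positive axis by a quantity \<open>W t\<close>
    tending to \<open>0\<close> contributes nothing in the limit, because \<open>h\<close> is
    integrable and supported there.\<close>
  have small: "((\<lambda>t. LINT z|lborel. w t z *\<^sub>R h z) \<longlongrightarrow> 0) (at_right 0)"
    if h: "integrable lborel h" and hz: "\<And>x. x \<notin> {p..q} \<Longrightarrow> h x = 0" and w: "\<And>t z. t > 0 \<Longrightarrow> z > 0 \<Longrightarrow> \<bar>w t z\<bar> \<le> W t"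
      and W: "(W \<longlongrightarrow> 0) (at_right 0)" and wi: "\<And>t. t > 0 \<Longrightarrow> integrable lborel (\<lambda>z. w t z *\<^sub>R h z)"
    for w :: "real \<Rightarrow> real \<Rightarrow> real" and W and h :: "real \<Rightarrow> complex^2"
  proof (rule Lim_null_comparison)
    show "((\<lambda>t. W t * (LINT z|lborel. norm (h z))) \<longlongrightarrow> 0) (at_right 0)"
      using tendsto_mult_right[OF W, of "LINT z|lborel. norm (h z)"] by simp
    show "\<forall>\<^sub>F t in at_right 0. norm (LINT z|lborel. w t z *\<^sub>R h z) \<le> W t * (LINT z|lborel. norm (h z))"
      using eventually_at_right_less[of 0]
    proof eventually_elim
      case (elim t)
      have "norm (LINT z|lborel. w t z *\<^sub>R h z) \<le> (LINT z|lborel. norm (w t z *\<^sub>R h z))" by (rule integral_norm_bound)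
      also have "\<dots> \<le> (LINT z|lborel. W t * norm (h z))"
      proof (rule integral_mono[OF integrable_norm[OF wi[OF elim]] integrable_mult_right[OF integrable_norm[OF h]]])
        fix z
        show "norm (w t z *\<^sub>R h z) \<le> W t * norm (h z)"
        proof (cases "z > 0")
          case True thus ?thesis using w[OF elim True] by (simp add: mult_right_mono)
        next
          case False thus ?thesis using hz[of z] f0(1) by auto
        qed
      qed
      finally show ?case by simp
    qed
  qed
  have L1: "((\<lambda>t. LINT z|lborel. F1 t z) \<longlongrightarrow> f0 y) (at_right 0)"
  proof -
    have "compact (f0 ` {p..q})" by (intro compact_continuous_image continuous_on_subset[OF f0(3)]) auto
    then obtain B where B: "\<And>x. x \<in> {p..q} \<Longrightarrow> norm (f0 x) \<le> B"
      using compact_imp_bounded bounded_iff by (metis image_eqI)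
    have "norm (f0 x) \<le> \<bar>B\<bar>" for x
      using B[of x] f0(4)[of x] by (cases "x \<in> {p..q}") auto
    from heat_ker_approx_identity[OF nu f0(3) this] show ?thesis unfolding F1_def .
  qed
  have L2: "((\<lambda>t. LINT z|lborel. F2 t z) \<longlongrightarrow> 0) (at_right 0)"
    unfolding F2_def
  proof (rule small[OF f0i f0(4)])
    show "\<bar>heat_ker \<nu> a t (z + y)\<bar> \<le> heat_ker \<nu> a t y" if "t > 0" "z > 0" for t z
      using heat_ker_nonneg[OF nu that(1)] heat_ker_antimono[OF nu that(1), of y "z + y"] y that by simp
    show "((\<lambda>t. heat_ker \<nu> a t y) \<longlongrightarrow> 0) (at_right 0)" by (rule heat_ker_tendsto_0[OF nu y])
    show "integrable lborel (\<lambda>z. heat_ker \<nu> a t (z + y) *\<^sub>R f0 z)" for t using i2(2)[of t] by (simp add: F2_def[abs_def])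
  qed auto
  have L3: "((\<lambda>t. LINT z|lborel. F3 t z) \<longlongrightarrow> 0) (at_right 0)"
    unfolding F3_def
  proof (rule small[OF g0i g0(2)])
    show "\<bar>refl_part \<nu> a t (y + z)\<bar> \<le> refl_part \<nu> a t y" if "t > 0" "z > 0" for t z
      using refl_part_nonneg[OF a] refl_part_antimono[OF nu a that(1), of y "y + z"] that by simp
    show "((\<lambda>t. refl_part \<nu> a t y) \<longlongrightarrow> 0) (at_right 0)" by (rule refl_part_tendsto_0[OF nu y])
    show "integrable lborel (\<lambda>z. refl_part \<nu> a t (y + z) *\<^sub>R g0 z)" if "t > 0" for t using i3(2)[OF that] by (simp add: F3_def[abs_def])
  qed auto
  have "((\<lambda>t. (LINT z|lborel. F1 t z) + (LINT z|lborel. F2 t z) + (LINT z|lborel. F3 t z)) \<longlongrightarrow> f0 y + 0 + 0) (at_right 0)"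
    by (intro tendsto_add L1 L2 L3)
  moreover have "\<forall>\<^sub>F t in at_right 0. (LINT z|lborel. F1 t z) + (LINT z|lborel. F2 t z) + (LINT z|lborel. F3 t z) = (LINT z|half_line. green_ker \<nu> \<xi> t y z *v f z)"
    using eventually_at_right_less[of 0] by eventually_elim (simp add: int)
  ultimately show "((\<lambda>t. LINT z|half_line. green_ker \<nu> \<xi> t y z *v f z) \<longlongrightarrow> f y) (at_right 0)"
    using Lim_transform_eventually f0(2)[OF y] by fastforce
qed

theorem theorem4p2:
  fixes \<nu> :: real and \<xi> :: "int^2" and \<gamma> :: "real \<Rightarrow> complex"
  assumes "\<nu> > 0" and "\<xi> \<noteq> 0" and "admissible_path \<nu> \<xi> \<gamma>"
  shows "(\<forall>t>0. \<forall>y\<ge>0. \<forall>z\<ge>0.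
      (\<forall>i j. improper_contour_integrable (\<lambda>lam. G_integrand \<nu> \<xi> t y z lam $ i $ j) \<gamma> \<and>
             improper_contour_integrable (\<lambda>lam. R_integrand \<nu> \<xi> t y z lam $ i $ j) \<gamma>) \<and>
      G_kernel \<nu> \<xi> \<gamma> t y z = H_kernel \<nu> \<xi> t y z + R_kernel \<nu> \<xi> \<gamma> t y z)
    \<and> (\<forall>y>0.
      (\<exists>Gt Gz Gzz :: real \<Rightarrow> real \<Rightarrow> complex^2^2. \<forall>t>0.
        (\<forall>z\<ge>0.
          ((\<lambda>s. G_kernel \<nu> \<xi> \<gamma> s y z) has_vector_derivative Gt t z) (at t) \<and>
          ((\<lambda>x. G_kernel \<nu> \<xi> \<gamma> t y x) has_vector_derivative Gz t z) (at z within {0..}) \<and>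
          ((\<lambda>x. Gz t x) has_vector_derivative Gzz t z) (at z within {0..}) \<and>
          Gt t z - \<nu> *\<^sub>R (- ((xi_norm \<xi>)\<^sup>2 *\<^sub>R G_kernel \<nu> \<xi> \<gamma> t y z) + Gzz t z) = 0) \<and>
        - (\<nu> *\<^sub>R (Gz t 0 + xi_norm \<xi> *\<^sub>R G_kernel \<nu> \<xi> \<gamma> t y 0))
          + \<nu> *\<^sub>R (xi_mat \<xi> ** G_kernel \<nu> \<xi> \<gamma> t y 0) = 0) \<and>
      (\<forall>f :: real \<Rightarrow> complex^2. smooth_cpt_supp f \<longrightarrow>
        (\<forall>t>0. integrable half_line (\<lambda>z. G_kernel \<nu> \<xi> \<gamma> t y z *v f z)) \<and>
        ((\<lambda>t. LINT z|half_line. G_kernel \<nu> \<xi> \<gamma> t y z *v f z) \<longlongrightarrow> f y) (at_right 0)))"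
proof (intro conjI allI impI)
  fix t y z :: real and i j :: 2 assume "t > 0" "y \<ge> 0" "z \<ge> 0"
  note k = kernels_explicit[OF assms this]
  show "improper_contour_integrable (\<lambda>lam. G_integrand \<nu> \<xi> t y z lam $ i $ j) \<gamma>" by (rule k(1))
  show "improper_contour_integrable (\<lambda>lam. R_integrand \<nu> \<xi> t y z lam $ i $ j) \<gamma>" by (rule k(2))
next
  fix t y z :: real assume "t > 0" "y \<ge> 0" "z \<ge> 0"
  note k = kernels_explicit[OF assms this]
  show "G_kernel \<nu> \<xi> \<gamma> t y z = H_kernel \<nu> \<xi> t y z + R_kernel \<nu> \<xi> \<gamma> t y z"
    unfolding k(3-5) ..
next
  fix y :: real assume y: "y > 0"
  have G: "G_kernel \<nu> \<xi> \<gamma> t y z = green_ker \<nu> \<xi> t y z" if "t > 0" "z \<ge> 0" for t z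
    unfolding green_ker_def by (rule kernels_explicit(5)[OF assms that(1) less_imp_le[OF y] that(2)])
  obtain Gt Gz Gzz where D:
    "\<And>t z. t > 0 \<Longrightarrow> ((\<lambda>s. green_ker \<nu> \<xi> s y z) has_vector_derivative Gt t z) (at t)"
    "\<And>t z. t > 0 \<Longrightarrow> ((\<lambda>x. green_ker \<nu> \<xi> t y x) has_vector_derivative Gz t z) (at z)"
    "\<And>t z. t > 0 \<Longrightarrow> ((\<lambda>x. Gz t x) has_vector_derivative Gzz t z) (at z)"
    "\<And>t z. t > 0 \<Longrightarrow> Gt t z - \<nu> *\<^sub>R (- ((xi_norm \<xi>)\<^sup>2 *\<^sub>R green_ker \<nu> \<xi> t y z) + Gzz t z) = 0"
    "\<And>t. t > 0 \<Longrightarrow> - (\<nu> *\<^sub>R (Gz t 0 + xi_norm \<xi> *\<^sub>R green_ker \<nu> \<xi> t y 0)) + \<nu> *\<^sub>R (xi_mat \<xi> ** green_ker \<nu> \<xi> t y 0) = 0"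
    by (rule green_ker_equations[OF assms(1,2)]) (rule that; assumption)
  show "\<exists>Gt Gz Gzz :: real \<Rightarrow> real \<Rightarrow> complex^2^2. \<forall>t>0.
        (\<forall>z\<ge>0.
          ((\<lambda>s. G_kernel \<nu> \<xi> \<gamma> s y z) has_vector_derivative Gt t z) (at t) \<and>
          ((\<lambda>x. G_kernel \<nu> \<xi> \<gamma> t y x) has_vector_derivative Gz t z) (at z within {0..}) \<and>
          ((\<lambda>x. Gz t x) has_vector_derivative Gzz t z) (at z within {0..}) \<and>
          Gt t z - \<nu> *\<^sub>R (- ((xi_norm \<xi>)\<^sup>2 *\<^sub>R G_kernel \<nu> \<xi> \<gamma> t y z) + Gzz t z) = 0) \<and>
        - (\<nu> *\<^sub>R (Gz t 0 + xi_norm \<xi> *\<^sub>R G_kernel \<nu> \<xi> \<gamma> t y 0))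
          + \<nu> *\<^sub>R (xi_mat \<xi> ** G_kernel \<nu> \<xi> \<gamma> t y 0) = 0"
  proof (rule exI[of _ Gt], rule exI[of _ Gz], rule exI[of _ Gzz], intro allI impI conjI)
    fix t z :: real assume t: "t > 0" and z: "z \<ge> 0"
    \<comment> \<open>The identification with \<open>green_ker\<close> holds for all positive times,
      an open set around \<open>t\<close>.\<close>
    show "((\<lambda>s. G_kernel \<nu> \<xi> \<gamma> s y z) has_vector_derivative Gt t z) (at t)"
      by (rule has_vector_derivative_transform_within_open[OF D(1)[OF t], of "{0<..}"]) (use t z G in auto)
    \<comment> \<open>In \<open>z\<close> the identification holds on the closed half line only, so
      the derivative is transferred within \<open>{0..}\<close>.\<close>
    show "((\<lambda>x. G_kernel \<nu> \<xi> \<gamma> t y x) has_vector_derivative Gz t z) (at z within {0..})"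
      by (rule has_vector_derivative_transform[OF _ _ has_vector_derivative_at_within[OF D(2)[OF t]]]) (use t z G in auto)
    show "((\<lambda>x. Gz t x) has_vector_derivative Gzz t z) (at z within {0..})"
      by (rule has_vector_derivative_at_within[OF D(3)[OF t]])
    show "Gt t z - \<nu> *\<^sub>R (- ((xi_norm \<xi>)\<^sup>2 *\<^sub>R G_kernel \<nu> \<xi> \<gamma> t y z) + Gzz t z) = 0"
      unfolding G[OF t z] by (rule D(4)[OF t])
  next
    fix t :: real assume t: "t > 0"
    show "- (\<nu> *\<^sub>R (Gz t 0 + xi_norm \<xi> *\<^sub>R G_kernel \<nu> \<xi> \<gamma> t y 0)) + \<nu> *\<^sub>R (xi_mat \<xi> ** G_kernel \<nu> \<xi> \<gamma> t y 0) = 0"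
      unfolding G[OF t order_refl] by (rule D(5)[OF t])
  qed
  fix f :: "real \<Rightarrow> complex^2" assume f: "smooth_cpt_supp f"
  have cong: "integrable half_line (\<lambda>z. G_kernel \<nu> \<xi> \<gamma> t y z *v f z) \<longleftrightarrow> integrable half_line (\<lambda>z. green_ker \<nu> \<xi> t y z *v f z)"
    "(LINT z|half_line. G_kernel \<nu> \<xi> \<gamma> t y z *v f z) = (LINT z|half_line. green_ker \<nu> \<xi> t y z *v f z)" if "t > 0" for t
    using that G by (auto intro!: Bochner_Integration.integrable_cong Bochner_Integration.integral_cong)
  show "integrable half_line (\<lambda>z. G_kernel \<nu> \<xi> \<gamma> t y z *v f z)" if "t > 0" for t
    unfolding cong(1)[OF that] by (rule green_ker_initial(1)[OF assms(1,2) y f that])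
  have "\<forall>\<^sub>F t in at_right 0. (LINT z|half_line. green_ker \<nu> \<xi> t y z *v f z) = (LINT z|half_line. G_kernel \<nu> \<xi> \<gamma> t y z *v f z)"
    using eventually_at_right_less[of 0] by eventually_elim (simp add: cong(2))
  from Lim_transform_eventually[OF green_ker_initial(2)[OF assms(1,2) y f] this]
  show "((\<lambda>t. LINT z|half_line. G_kernel \<nu> \<xi> \<gamma> t y z *v f z) \<longlongrightarrow> f y) (at_right 0)" .
qed

end
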